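(* Let $M$ be a $(B,A)$-bimodule such that $M_A$ is finitely generated projective, and let $S=\mathrm{End}_A(M)$. Then: (1) If $M$ is a separable bimodule, then the comatrix coring $M^*\otimes_BM$ is a coseparable $A$-coring. (2) If the comatrix coring $M^*\otimes_BM$ is a coseparable $A$-coring, then the Sweedler coring $S\otimes_BS$ is a coseparable $S$-coring.
   Context: All rings are associative with $1$. For a $(B,A)$-bimodule $M$ with $M_A$ finitely generated projective, $M^*=\mathrm{Hom}_A(M,A)$ is an $(A,B)$-bimodule, and with a finite dual basis $\{e_i,e_i^*\}_{i\in I}$ the comatrix $A$-coring is $M^*\otimes_BM$ with coproduct $\varphi\otimes m\mapsto\sum_i\varphi\otimes e_i\otimes e_i^*\otimes m$ and counit $\varphi\otimes m\mapsto\varphi(m)$. $S=\mathrm{End}_A(M)$ with composition, and $B\to S$, $b\mapsto(m\mapsto bm)$. The Sweedler $S$-coring $S\otimes_BS$ has coproduct $s\otimes s'\mapsto s\otimes1_S\otimes s'$ and counit $s\otimes s'\mapsto ss'$. Let ${}^*M=\mathrm{Hom}_B(M,B)$ (left $B$-module maps), an $(A,B)$-bimodule via $(a\varphi)(m)=\varphi(ma)$, $(\varphi b)(m)=\varphi(m)b$; $M$ is a separable bimodule ($B$ is $M$-separable over $A$) if the evaluation map $M\otimes_A{}^*M\to B$, $m\otimes\varphi\mapsto\varphi(m)$, is a split epimorphism of $(B,B)$-bimodules. For an $A$-coring $\mathcal{C}$ with coproduct $\Delta(c)=\sum c_{(1)}\otimes c_{(2)}$ and counit $\varepsilon$, a cointegral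 is an $(A,A)$-bimodule map $\gamma:\mathcal{C}\otimes_A\mathcal{C}\to A$ with $\sum c_{(1)}\gamma(c_{(2)}\otimes c')=\sum\gamma(c\otimes c'_{(1)})c'_{(2)}$ for all $c,c'$ and $\gamma\circ\Delta=\varepsilon$; $\mathcal{C}$ is coseparable if it admits a cointegral (equivalently, $\Delta$ is a split monomorphism of $\mathcal{C}$-bicomodules). *)

theory Defs
  imports "HOL-Algebra.Ring" "HOL-Library.FuncSet"
begin

text \<open>An (R,S)-bimodule: an additive abelian group (the ring-record fields mult and one
  are unused) together with a left R-action and a right S-action.\<close>

record ('r, 's, 'm) bimod = "'m ring" +
  lact :: "'r \<Rightarrow> 'm \<Rightarrow> 'm"
  ract :: "'m \<Rightarrow> 's \<Rightarrow> 'm"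

definition bimodule :: "('r, 'x) ring_scheme \<Rightarrow> ('s, 'y) ring_scheme \<Rightarrow> ('r, 's, 'm) bimod \<Rightarrow> bool" where
  "bimodule R S M \<longleftrightarrow> ring R \<and> ring S \<and> abelian_group M \<and>
    (\<forall>r\<in>carrier R. \<forall>x\<in>carrier M. lact M r x \<in> carrier M) \<and>
    (\<forall>s\<in>carrier S. \<forall>x\<in>carrier M. ract M x s \<in> carrier M) \<and>
    (\<forall>r\<in>carrier R. \<forall>x\<in>carrier M. \<forall>y\<in>carrier M. lact M r (x \<oplus>\<^bsub>M\<^esub> y) = lact M r x \<oplus>\<^bsub>M\<^esub> lact M r y) \<and>
    (\<forall>r\<in>carrier R. \<forall>r'\<in>carrier R. \<forall>x\<in>carrier M. lact M (r \<oplus>\<^bsub>R\<^esub> r') x = lact M r x \<oplus>\<^bsub>M\<^esub> lact M r' x) \<and>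
    (\<forall>r\<in>carrier R. \<forall>r'\<in>carrier R. \<forall>x\<in>carrier M. lact M (r \<otimes>\<^bsub>R\<^esub> r') x = lact M r (lact M r' x)) \<and>
    (\<forall>x\<in>carrier M. lact M \<one>\<^bsub>R\<^esub> x = x) \<and>
    (\<forall>s\<in>carrier S. \<forall>x\<in>carrier M. \<forall>y\<in>carrier M. ract M (x \<oplus>\<^bsub>M\<^esub> y) s = ract M x s \<oplus>\<^bsub>M\<^esub> ract M y s) \<and>
    (\<forall>s\<in>carrier S. \<forall>s'\<in>carrier S. \<forall>x\<in>carrier M. ract M x (s \<oplus>\<^bsub>S\<^esub> s') = ract M x s \<oplus>\<^bsub>M\<^esub> ract M x s') \<and>
    (\<forall>s\<in>carrier S. \<forall>s'\<in>carrier S. \<forall>x\<in>carrier M. ract M x (s \<otimes>\<^bsub>S\<^esub> s') = ract M (ract M x s) s') \<and>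
    (\<forall>x\<in>carrier M. ract M x \<one>\<^bsub>S\<^esub> = x) \<and>
    (\<forall>r\<in>carrier R. \<forall>s\<in>carrier S. \<forall>x\<in>carrier M. lact M r (ract M x s) = ract M (lact M r x) s)"

definition ring_bimod :: "('a, 'c) ring_scheme \<Rightarrow> ('a, 'a, 'a) bimod" where
  "ring_bimod R = \<lparr>carrier = carrier R, mult = mult R, one = one R, zero = zero R, add = add R,
     lact = mult R, ract = mult R\<rparr>"

text \<open>For an (R,T)-bimodule M and a (T,U)-bimodule N, the tensor product M \<otimes>_T N is
  the free abelian group on carrier M \<times> carrier N modulo the subgroup generated by the
  biadditivity and T-balancing relations; it is an (R,U)-bimodule.\<close>

definition fsupp :: "('p \<Rightarrow> int) \<Rightarrow> 'p set" where
  "fsupp f = {p. f p \<noteq> 0}"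

definition free_ab :: "('m, 'x) ring_scheme \<Rightarrow> ('n, 'y) ring_scheme \<Rightarrow> ('m \<times> 'n \<Rightarrow> int) set" where
  "free_ab M N = {f. finite (fsupp f) \<and> fsupp f \<subseteq> carrier M \<times> carrier N}"

definition gen :: "'m \<Rightarrow> 'n \<Rightarrow> ('m \<times> 'n \<Rightarrow> int)" where
  "gen x y = (\<lambda>p. if p = (x, y) then 1 else 0)"

definition tens_rels :: "('t, 'z) ring_scheme \<Rightarrow> ('r, 't, 'm) bimod \<Rightarrow> ('t, 'u, 'n) bimod \<Rightarrow> ('m \<times> 'n \<Rightarrow> int) set" where
  "tens_rels T M N =
     {(\<lambda>p. gen (x \<oplus>\<^bsub>M\<^esub> x') y p - gen x y p - gen x' y p) | x x' y.
        x \<in> carrier M \<and> x' \<in> carrier M \<and> y \<in> carrier N} \<union>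
     {(\<lambda>p. gen x (y \<oplus>\<^bsub>N\<^esub> y') p - gen x y p - gen x y' p) | x y y'.
        x \<in> carrier M \<and> y \<in> carrier N \<and> y' \<in> carrier N} \<union>
     {(\<lambda>p. gen (ract M x t) y p - gen x (lact N t y) p) | x t y.
        x \<in> carrier M \<and> t \<in> carrier T \<and> y \<in> carrier N}"

definition tens_sub :: "('t, 'z) ring_scheme \<Rightarrow> ('r, 't, 'm) bimod \<Rightarrow> ('t, 'u, 'n) bimod \<Rightarrow> ('m \<times> 'n \<Rightarrow> int) set" where
  "tens_sub T M N = \<Inter>{H. tens_rels T M N \<subseteq> H \<and> (\<lambda>p. 0) \<in> H \<and>
                           (\<forall>f\<in>H. \<forall>g\<in>H. (\<lambda>p. f p - g p) \<in> H)}"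

definition tcls :: "('t, 'z) ring_scheme \<Rightarrow> ('r, 't, 'm) bimod \<Rightarrow> ('t, 'u, 'n) bimod \<Rightarrow> ('m \<times> 'n \<Rightarrow> int) \<Rightarrow> ('m \<times> 'n \<Rightarrow> int) set" where
  "tcls T M N f = {g \<in> free_ab M N. (\<lambda>p. f p - g p) \<in> tens_sub T M N}"

definition trep :: "('p \<Rightarrow> int) set \<Rightarrow> ('p \<Rightarrow> int)" where
  "trep X = (SOME f. f \<in> X)"

definition tens :: "('t, 'z) ring_scheme \<Rightarrow> ('r, 't, 'm) bimod \<Rightarrow> ('t, 'u, 'n) bimod \<Rightarrow> 'm \<Rightarrow> 'n \<Rightarrow> ('m \<times> 'n \<Rightarrow> int) set" where
  "tens T M N x y = tcls T M N (gen x y)"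

text \<open>The map out of a tensor product induced by a (balanced, biadditive) map h:
  x \<otimes> y \<mapsto> h x y, evaluated on a representative.\<close>
definition lift :: "('c, 'w) ring_scheme \<Rightarrow> ('m \<Rightarrow> 'n \<Rightarrow> 'c) \<Rightarrow> ('m \<times> 'n \<Rightarrow> int) set \<Rightarrow> 'c" where
  "lift G h X = finsum G (\<lambda>p. add_pow G (trep X p) (h (fst p) (snd p))) (fsupp (trep X))"

definition tensor_grp :: "('t, 'z) ring_scheme \<Rightarrow> ('r, 't, 'm) bimod \<Rightarrow> ('t, 'u, 'n) bimod \<Rightarrow> ('m \<times> 'n \<Rightarrow> int) set ring" where
  "tensor_grp T M N = \<lparr>carrier = tcls T M N ` free_ab M N, mult = undefined, one = undefined,
      zero = tcls T M N (\<lambda>p. 0),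
      add = (\<lambda>X Y. tcls T M N (\<lambda>p. trep X p + trep Y p))\<rparr>"

definition tensor :: "('t, 'z) ring_scheme \<Rightarrow> ('r, 't, 'm) bimod \<Rightarrow> ('t, 'u, 'n) bimod \<Rightarrow> ('r, 'u, ('m \<times> 'n \<Rightarrow> int) set) bimod" where
  "tensor T M N = \<lparr>carrier = carrier (tensor_grp T M N), mult = undefined, one = undefined,
      zero = zero (tensor_grp T M N), add = add (tensor_grp T M N),
      lact = (\<lambda>r X. lift (tensor_grp T M N) (\<lambda>x y. tens T M N (lact M r x) y) X),
      ract = (\<lambda>X u. lift (tensor_grp T M N) (\<lambda>x y. tens T M N x (ract N y u)) X)\<rparr>"

definition rdual :: "('a, 'c) ring_scheme \<Rightarrow> ('b, 'a, 'm) bimod \<Rightarrow> ('a, 'b, 'm \<Rightarrow> 'a) bimod" where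
  "rdual A M = \<lparr>carrier = {f \<in> carrier M \<rightarrow>\<^sub>E carrier A.
        (\<forall>x\<in>carrier M. \<forall>y\<in>carrier M. f (x \<oplus>\<^bsub>M\<^esub> y) = f x \<oplus>\<^bsub>A\<^esub> f y) \<and>
        (\<forall>x\<in>carrier M. \<forall>a\<in>carrier A. f (ract M x a) = f x \<otimes>\<^bsub>A\<^esub> a)},
      mult = undefined, one = undefined,
      zero = (\<lambda>x\<in>carrier M. \<zero>\<^bsub>A\<^esub>),
      add = (\<lambda>f g. \<lambda>x\<in>carrier M. f x \<oplus>\<^bsub>A\<^esub> g x),
      lact = (\<lambda>a f. \<lambda>x\<in>carrier M. a \<otimes>\<^bsub>A\<^esub> f x),
      ract = (\<lambda>f b. \<lambda>x\<in>carrier M. f (lact M b x))\<rparr>"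

definition ldual :: "('b, 'c) ring_scheme \<Rightarrow> ('b, 'a, 'm) bimod \<Rightarrow> ('a, 'b, 'm \<Rightarrow> 'b) bimod" where
  "ldual B M = \<lparr>carrier = {f \<in> carrier M \<rightarrow>\<^sub>E carrier B.
        (\<forall>x\<in>carrier M. \<forall>y\<in>carrier M. f (x \<oplus>\<^bsub>M\<^esub> y) = f x \<oplus>\<^bsub>B\<^esub> f y) \<and>
        (\<forall>x\<in>carrier M. \<forall>b\<in>carrier B. f (lact M b x) = b \<otimes>\<^bsub>B\<^esub> f x)},
      mult = undefined, one = undefined,
      zero = (\<lambda>x\<in>carrier M. \<zero>\<^bsub>B\<^esub>),
      add = (\<lambda>f g. \<lambda>x\<in>carrier M. f x \<oplus>\<^bsub>B\<^esub> g x),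
      lact = (\<lambda>a f. \<lambda>x\<in>carrier M. f (ract M x a)),
      ract = (\<lambda>f b. \<lambda>x\<in>carrier M. f x \<otimes>\<^bsub>B\<^esub> b)\<rparr>"

definition endo_ring :: "('a, 'c) ring_scheme \<Rightarrow> ('b, 'a, 'm) bimod \<Rightarrow> ('m \<Rightarrow> 'm) ring" where
  "endo_ring A M = \<lparr>carrier = {f \<in> carrier M \<rightarrow>\<^sub>E carrier M.
        (\<forall>x\<in>carrier M. \<forall>y\<in>carrier M. f (x \<oplus>\<^bsub>M\<^esub> y) = f x \<oplus>\<^bsub>M\<^esub> f y) \<and>
        (\<forall>x\<in>carrier M. \<forall>a\<in>carrier A. f (ract M x a) = ract M (f x) a)},
      mult = (\<lambda>f g. \<lambda>x\<in>carrier M. f (g x)),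
      one = (\<lambda>x\<in>carrier M. x),
      zero = (\<lambda>x\<in>carrier M. \<zero>\<^bsub>M\<^esub>),
      add = (\<lambda>f g. \<lambda>x\<in>carrier M. f x \<oplus>\<^bsub>M\<^esub> g x)\<rparr>"

text \<open>S as an (S,B)-bimodule and as a (B,S)-bimodule, via the ring map B \<rightarrow> S, b \<mapsto> (m \<mapsto> b m).\<close>
definition endo_SB :: "('a, 'c) ring_scheme \<Rightarrow> ('b, 'a, 'm) bimod \<Rightarrow> ('m \<Rightarrow> 'm, 'b, 'm \<Rightarrow> 'm) bimod" where
  "endo_SB A M = \<lparr>carrier = carrier (endo_ring A M), mult = mult (endo_ring A M),
      one = one (endo_ring A M), zero = zero (endo_ring A M), add = add (endo_ring A M),
      lact = mult (endo_ring A M),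
      ract = (\<lambda>s b. \<lambda>x\<in>carrier M. s (lact M b x))\<rparr>"

definition endo_BS :: "('a, 'c) ring_scheme \<Rightarrow> ('b, 'a, 'm) bimod \<Rightarrow> ('b, 'm \<Rightarrow> 'm, 'm \<Rightarrow> 'm) bimod" where
  "endo_BS A M = \<lparr>carrier = carrier (endo_ring A M), mult = mult (endo_ring A M),
      one = one (endo_ring A M), zero = zero (endo_ring A M), add = add (endo_ring A M),
      lact = (\<lambda>b s. \<lambda>x\<in>carrier M. lact M b (s x)),
      ract = mult (endo_ring A M)\<rparr>"

text \<open>M_A finitely generated projective: a direct summand of a finitely generated free
  right A-module A^n, i.e. there are right A-linear maps i : M \<rightarrow> A^n, p : A^n \<rightarrow> M with
  p \<circ> i = id.  Elements of A^n are extensional functions on {0..<n}.\<close>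
definition fg_projective_right :: "('a, 'c) ring_scheme \<Rightarrow> ('b, 'a, 'm) bimod \<Rightarrow> bool" where
  "fg_projective_right A M \<longleftrightarrow> (\<exists>(n::nat) i p.
     i \<in> carrier M \<rightarrow> ({0..<n} \<rightarrow>\<^sub>E carrier A) \<and>
     p \<in> ({0..<n} \<rightarrow>\<^sub>E carrier A) \<rightarrow> carrier M \<and>
     (\<forall>x\<in>carrier M. \<forall>y\<in>carrier M. i (x \<oplus>\<^bsub>M\<^esub> y) = (\<lambda>k\<in>{0..<n}. i x k \<oplus>\<^bsub>A\<^esub> i y k)) \<and>
     (\<forall>x\<in>carrier M. \<forall>a\<in>carrier A. i (ract M x a) = (\<lambda>k\<in>{0..<n}. i x k \<otimes>\<^bsub>A\<^esub> a)) \<and>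
     (\<forall>v\<in>{0..<n} \<rightarrow>\<^sub>E carrier A. \<forall>w\<in>{0..<n} \<rightarrow>\<^sub>E carrier A.
        p (\<lambda>k\<in>{0..<n}. v k \<oplus>\<^bsub>A\<^esub> w k) = p v \<oplus>\<^bsub>M\<^esub> p w) \<and>
     (\<forall>v\<in>{0..<n} \<rightarrow>\<^sub>E carrier A. \<forall>a\<in>carrier A.
        p (\<lambda>k\<in>{0..<n}. v k \<otimes>\<^bsub>A\<^esub> a) = ract M (p v) a) \<and>
     (\<forall>x\<in>carrier M. p (i x) = x))"

definition dual_basis :: "('a, 'c) ring_scheme \<Rightarrow> ('b, 'a, 'm) bimod \<Rightarrow> 'i set \<Rightarrow> ('i \<Rightarrow> 'm) \<Rightarrow> ('i \<Rightarrow> 'm \<Rightarrow> 'a) \<Rightarrow> bool" where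
  "dual_basis A M I e es \<longleftrightarrow> finite I \<and> e \<in> I \<rightarrow> carrier M \<and> es \<in> I \<rightarrow> carrier (rdual A M) \<and>
     (\<forall>m\<in>carrier M. m = finsum M (\<lambda>i. ract M (e i) (es i m)) I)"

definition separable_bimodule :: "('a, 'c) ring_scheme \<Rightarrow> ('b, 'd) ring_scheme \<Rightarrow> ('b, 'a, 'm) bimod \<Rightarrow> bool" where
  "separable_bimodule A B M \<longleftrightarrow>
    (let T = tensor A M (ldual B M); ev = lift B (\<lambda>m f. f m) in
     \<exists>\<sigma>. \<sigma> \<in> carrier B \<rightarrow> carrier T \<and>
        (\<forall>b\<in>carrier B. \<forall>b'\<in>carrier B. \<sigma> (b \<oplus>\<^bsub>B\<^esub> b') = \<sigma> b \<oplus>\<^bsub>T\<^esub> \<sigma> b') \<and>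
        (\<forall>b\<in>carrier B. \<forall>b'\<in>carrier B. \<sigma> (b \<otimes>\<^bsub>B\<^esub> b') = lact T b (\<sigma> b')) \<and>
        (\<forall>b\<in>carrier B. \<forall>b'\<in>carrier B. \<sigma> (b \<otimes>\<^bsub>B\<^esub> b') = ract T (\<sigma> b) b') \<and>
        (\<forall>b\<in>carrier B. ev (\<sigma> b) = b))"

definition cointegral :: "('r, 'z) ring_scheme \<Rightarrow> ('r, 'r, 'c) bimod \<Rightarrow>
    ('c \<Rightarrow> ('c \<times> 'c \<Rightarrow> int) set) \<Rightarrow> ('c \<Rightarrow> 'r) \<Rightarrow> (('c \<times> 'c \<Rightarrow> int) set \<Rightarrow> 'r) \<Rightarrow> bool" where
  "cointegral R C \<Delta> \<epsilon> \<gamma> \<longleftrightarrow>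
    (let CC = tensor R C C in
      \<gamma> \<in> carrier CC \<rightarrow> carrier R \<and>
      (\<forall>X\<in>carrier CC. \<forall>Y\<in>carrier CC. \<gamma> (X \<oplus>\<^bsub>CC\<^esub> Y) = \<gamma> X \<oplus>\<^bsub>R\<^esub> \<gamma> Y) \<and>
      (\<forall>r\<in>carrier R. \<forall>X\<in>carrier CC. \<gamma> (lact CC r X) = r \<otimes>\<^bsub>R\<^esub> \<gamma> X) \<and>
      (\<forall>r\<in>carrier R. \<forall>X\<in>carrier CC. \<gamma> (ract CC X r) = \<gamma> X \<otimes>\<^bsub>R\<^esub> r) \<and>
      (\<forall>c\<in>carrier C. \<forall>c'\<in>carrier C.
         lift C (\<lambda>x y. ract C x (\<gamma> (tens R C C y c'))) (\<Delta> c) =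
         lift C (\<lambda>x y. lact C (\<gamma> (tens R C C c x)) y) (\<Delta> c')) \<and>
      (\<forall>c\<in>carrier C. \<gamma> (\<Delta> c) = \<epsilon> c))"

definition coseparable :: "('r, 'z) ring_scheme \<Rightarrow> ('r, 'r, 'c) bimod \<Rightarrow>
    ('c \<Rightarrow> ('c \<times> 'c \<Rightarrow> int) set) \<Rightarrow> ('c \<Rightarrow> 'r) \<Rightarrow> bool" where
  "coseparable R C \<Delta> \<epsilon> \<longleftrightarrow> (\<exists>\<gamma>. cointegral R C \<Delta> \<epsilon> \<gamma>)"

definition comatrix :: "('a, 'c) ring_scheme \<Rightarrow> ('b, 'd) ring_scheme \<Rightarrow> ('b, 'a, 'm) bimod \<Rightarrow>
    ('a, 'a, (('m \<Rightarrow> 'a) \<times> 'm \<Rightarrow> int) set) bimod" where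
  "comatrix A B M = tensor B (rdual A M) M"

definition comatrix_comult where
  "comatrix_comult A B M I e es X =
     lift (tensor A (comatrix A B M) (comatrix A B M))
       (\<lambda>f m. finsum (tensor A (comatrix A B M) (comatrix A B M))
          (\<lambda>i. tens A (comatrix A B M) (comatrix A B M)
                 (tens B (rdual A M) M f (e i)) (tens B (rdual A M) M (es i) m)) I) X"

definition comatrix_counit where
  "comatrix_counit A B M X = lift A (\<lambda>f m. f m) X"

definition sweedler :: "('a, 'c) ring_scheme \<Rightarrow> ('b, 'd) ring_scheme \<Rightarrow> ('b, 'a, 'm) bimod \<Rightarrow>
    ('m \<Rightarrow> 'm, 'm \<Rightarrow> 'm, (('m \<Rightarrow> 'm) \<times> ('m \<Rightarrow> 'm) \<Rightarrow> int) set) bimod" where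
  "sweedler A B M = tensor B (endo_SB A M) (endo_BS A M)"

definition sweedler_comult where
  "sweedler_comult A B M X =
     lift (tensor (endo_ring A M) (sweedler A B M) (sweedler A B M))
       (\<lambda>s s'. tens (endo_ring A M) (sweedler A B M) (sweedler A B M)
          (tens B (endo_SB A M) (endo_BS A M) s \<one>\<^bsub>endo_ring A M\<^esub>)
          (tens B (endo_SB A M) (endo_BS A M) \<one>\<^bsub>endo_ring A M\<^esub> s')) X"

definition sweedler_counit where
  "sweedler_counit A B M X = lift (endo_ring A M) (\<lambda>s s'. s \<otimes>\<^bsub>endo_ring A M\<^esub> s') X"

end

theory Submission
  imports Defs
begin

text \<open>The dual basis gives \<open>M \<otimes>\<^sub>A M* = S\<close>, the pair \<open>m, g\<close> corresponding to the rank one map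
  \<open>x \<mapsto> m g(x)\<close>, so \<open>S\<close> acts centrally on \<open>\<Sum> e\<^sub>i \<otimes> e\<^sub>i*\<close>.

  If \<open>M\<close> is separable, a splitting of the evaluation map yields a \<open>(B,B)\<close>-linear retraction
  \<open>\<psi> : S \<rightarrow> B\<close>, and \<open>(f \<otimes> m) \<otimes> (g \<otimes> n) \<mapsto> f (\<psi> (m g) n)\<close> is a cointegral of the comatrix coring.

  Conversely \<open>S \<otimes>\<^sub>B S = M \<otimes>\<^sub>A (M* \<otimes>\<^sub>B M) \<otimes>\<^sub>A M*\<close>, and a cointegral \<open>\<gamma>\<close> of the comatrix coring
  induces the cointegral of the Sweedler coring that sends \<open>(s \<otimes> t) \<otimes> (u \<otimes> v)\<close> to the endomorphism
  \<open>x \<mapsto> \<Sum>\<^sub>i\<^sub>j e\<^sub>i \<gamma> ((e\<^sub>i* s \<otimes> t u e\<^sub>j) \<otimes> (e\<^sub>j* \<otimes> v x))\<close>.\<close>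

subsection \<open>Additive maps\<close>

text \<open>With \<open>C = M* \<otimes>\<^sub>B M\<close>, the identification
  \<open>M \<otimes>\<^sub>A M* = S\<close> turns \<open>C \<otimes>\<^sub>A C\<close> into
  \<open>M* \<otimes>\<^sub>B S \<otimes>\<^sub>B M\<close>. The coproduct inserts the dual basis,
  that is the unit of \<open>S\<close>, in the middle, so the counit condition on a cointegral only
  concerns its values at middle factor 1. This explains the first formula: apply
  \<open>\<psi>\<close> to the middle factor, then evaluate. Its colinearity is the balancing
  \<open>f \<psi>(s) \<otimes> n = f \<otimes> \<psi>(s) n\<close> over \<open>B\<close>, and its
  counit condition is \<open>\<psi>(1) = 1\<close>.

  In the second part \<open>\<gamma>\<close> takes values in \<open>A\<close>, and no map
  \<open>S \<rightarrow> B\<close> is extracted from it. Instead \<open>\<gamma>\<close> is tensored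
  with \<open>M\<close> on the left and \<open>M*\<close> on the right, which gives a map
  \<open>S \<otimes>\<^sub>B S \<otimes>\<^sub>B S \<rightarrow> S\<close>; its colinearity comes
  from that of \<open>\<gamma>\<close> by the same tensoring.

  Since elements of tensor products are classes with chosen representatives, these identifications
  are not built as isomorphisms. Expansions in the dual basis replace them, and identities are
  checked on pure tensors, between maps known to be additive.\<close>

definition add_map :: "('a, 'x) ring_scheme \<Rightarrow> ('b, 'y) ring_scheme \<Rightarrow> ('a \<Rightarrow> 'b) \<Rightarrow> bool" where
  "add_map G H F \<longleftrightarrow> F \<in> carrier G \<rightarrow> carrier H \<and>
     (\<forall>x\<in>carrier G. \<forall>y\<in>carrier G. F (x \<oplus>\<^bsub>G\<^esub> y) = F x \<oplus>\<^bsub>H\<^esub> F y)"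

lemma add_mapI:
  assumes "\<And>x. x \<in> carrier G \<Longrightarrow> F x \<in> carrier H"
    and "\<And>x y. x \<in> carrier G \<Longrightarrow> y \<in> carrier G \<Longrightarrow> F (x \<oplus>\<^bsub>G\<^esub> y) = F x \<oplus>\<^bsub>H\<^esub> F y"
  shows "add_map G H F"
  using assms by (auto simp: add_map_def)

lemma add_map_closed: "add_map G H F \<Longrightarrow> x \<in> carrier G \<Longrightarrow> F x \<in> carrier H"
  by (auto simp: add_map_def)

lemma add_map_add:
  "add_map G H F \<Longrightarrow> x \<in> carrier G \<Longrightarrow> y \<in> carrier G \<Longrightarrow> F (x \<oplus>\<^bsub>G\<^esub> y) = F x \<oplus>\<^bsub>H\<^esub> F y"
  by (auto simp: add_map_def)

lemma add_map_zero:
  assumes "abelian_group G" "abelian_group H" "add_map G H F"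
  shows "F \<zero>\<^bsub>G\<^esub> = \<zero>\<^bsub>H\<^esub>"
proof -
  interpret G: abelian_group G by fact
  interpret H: abelian_group H by fact
  have c: "F \<zero>\<^bsub>G\<^esub> \<in> carrier H" using assms(3) by (simp add: add_map_closed)
  have "F \<zero>\<^bsub>G\<^esub> = F \<zero>\<^bsub>G\<^esub> \<oplus>\<^bsub>H\<^esub> F \<zero>\<^bsub>G\<^esub>"
    using add_map_add[OF assms(3), of "\<zero>\<^bsub>G\<^esub>" "\<zero>\<^bsub>G\<^esub>"] by simp
  then show ?thesis using c by (metis H.add.l_cancel_one')
qed

lemma add_map_finsum:
  assumes "abelian_group G" "abelian_group H" "add_map G H F" "x \<in> I \<rightarrow> carrier G"
  shows "F (finsum G x I) = finsum H (\<lambda>i. F (x i)) I"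
proof -
  interpret G: abelian_group G by fact
  interpret H: abelian_group H by fact
  show ?thesis using assms(4)
  proof (induction I rule: infinite_finite_induct)
    \<comment> \<open>Over an infinite index set \<open>finsum\<close> is zero by convention, so
      this case says only that \<open>F\<close> preserves zero.\<close>
    case (infinite I)
    then show ?case using add_map_zero[OF assms(1-3)] by (simp add: G.finsum_infinite H.finsum_infinite)
  next
    case empty
    then show ?case using add_map_zero[OF assms(1-3)] by (simp add: G.finsum_empty H.finsum_empty)
  next
    case (insert i I)
    then have x: "x i \<in> carrier G" "x \<in> I \<rightarrow> carrier G" by auto
    then have "(\<lambda>i. F (x i)) \<in> I \<rightarrow> carrier H" "F (x i) \<in> carrier H"
      using add_map_closed[OF assms(3)] by auto
    with x insert show ?case
      by (simp add: G.finsum_insert H.finsum_insert add_map_add[OF assms(3)] G.finsum_closed)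
  qed
qed

lemma add_map_comp:
  "add_map G H F \<Longrightarrow> add_map H K F' \<Longrightarrow> add_map G K (\<lambda>x. F' (F x))"
  by (auto simp: add_map_def Pi_def)

lemma add_map_id: "add_map G G (\<lambda>x. x)"
  by (auto simp: add_map_def)

lemma add_map_plus:
  assumes "abelian_group H" "add_map G H F" "add_map G H F'"
  shows "add_map G H (\<lambda>x. F x \<oplus>\<^bsub>H\<^esub> F' x)"
proof -
  interpret H: abelian_group H by fact
  show ?thesis
    by (rule add_mapI)
      (use assms in \<open>auto simp: add_map_closed add_map_add H.a_ac\<close>)
qed

lemma add_map_finsum_fun:
  assumes "abelian_group H" "\<And>i. i \<in> I \<Longrightarrow> add_map G H (F i)"
  shows "add_map G H (\<lambda>x. finsum H (\<lambda>i. F i x) I)"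
proof -
  interpret H: abelian_group H by fact
  have c: "F i x \<in> carrier H" if "i \<in> I" "x \<in> carrier G" for i x
    using add_map_closed[OF assms(2)] that by blast
  show ?thesis
  proof (rule add_mapI)
    fix x y assume x: "x \<in> carrier G" and y: "y \<in> carrier G"
    have "finsum H (\<lambda>i. F i (x \<oplus>\<^bsub>G\<^esub> y)) I = finsum H (\<lambda>i. F i x \<oplus>\<^bsub>H\<^esub> F i y) I"
      using x y by (intro H.finsum_cong') (auto simp: add_map_add[OF assms(2)] c)
    also have "\<dots> = finsum H (\<lambda>i. F i x) I \<oplus>\<^bsub>H\<^esub> finsum H (\<lambda>i. F i y) I"
      using x y by (intro H.finsum_addf) (auto simp: c)
    finally show "finsum H (\<lambda>i. F i (x \<oplus>\<^bsub>G\<^esub> y)) I = \<dots>" .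
  qed (auto intro!: H.finsum_closed simp: c)
qed

lemma finsum_swap:
  assumes "abelian_group G" "finite J" "\<And>i j. i \<in> I \<Longrightarrow> j \<in> J \<Longrightarrow> f i j \<in> carrier G"
  shows "finsum G (\<lambda>i. finsum G (f i) J) I = finsum G (\<lambda>j. finsum G (\<lambda>i. f i j) I) J"
proof -
  interpret G: abelian_group G by fact
  show ?thesis using assms(2,3)
  proof (induction J rule: finite_induct)
    case empty
    then show ?case by (simp add: G.finsum_empty G.finsum_zero)
  next
    case (insert j J)
    have "finsum G (\<lambda>i. finsum G (f i) (insert j J)) I = finsum G (\<lambda>i. f i j \<oplus>\<^bsub>G\<^esub> finsum G (f i) J) I"
      using insert by (intro G.finsum_cong') (auto simp: G.finsum_insert Pi_def G.finsum_closed)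
    also have "\<dots> = finsum G (\<lambda>i. f i j) I \<oplus>\<^bsub>G\<^esub> finsum G (\<lambda>i. finsum G (f i) J) I"
      using insert by (intro G.finsum_addf) (auto simp: Pi_def intro!: G.finsum_closed)
    finally show ?case
      using insert by (simp add: G.finsum_insert Pi_def G.finsum_closed)
  qed
qed

subsection \<open>Bimodules\<close>

lemma bimoduleD:
  assumes "bimodule R S M"
  shows "ring R" "ring S" "abelian_group M"
    and "\<And>r x. r \<in> carrier R \<Longrightarrow> x \<in> carrier M \<Longrightarrow> lact M r x \<in> carrier M"
    and "\<And>s x. s \<in> carrier S \<Longrightarrow> x \<in> carrier M \<Longrightarrow> ract M x s \<in> carrier M"
    and "\<And>r x y. r \<in> carrier R \<Longrightarrow> x \<in> carrier M \<Longrightarrow> y \<in> carrier M \<Longrightarrow>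
      lact M r (x \<oplus>\<^bsub>M\<^esub> y) = lact M r x \<oplus>\<^bsub>M\<^esub> lact M r y"
    and "\<And>r r' x. r \<in> carrier R \<Longrightarrow> r' \<in> carrier R \<Longrightarrow> x \<in> carrier M \<Longrightarrow>
      lact M (r \<oplus>\<^bsub>R\<^esub> r') x = lact M r x \<oplus>\<^bsub>M\<^esub> lact M r' x"
    and "\<And>r r' x. r \<in> carrier R \<Longrightarrow> r' \<in> carrier R \<Longrightarrow> x \<in> carrier M \<Longrightarrow>
      lact M (r \<otimes>\<^bsub>R\<^esub> r') x = lact M r (lact M r' x)"
    and "\<And>x. x \<in> carrier M \<Longrightarrow> lact M \<one>\<^bsub>R\<^esub> x = x"
    and "\<And>s x y. s \<in> carrier S \<Longrightarrow> x \<in> carrier M \<Longrightarrow> y \<in> carrier M \<Longrightarrow>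
      ract M (x \<oplus>\<^bsub>M\<^esub> y) s = ract M x s \<oplus>\<^bsub>M\<^esub> ract M y s"
    and "\<And>s s' x. s \<in> carrier S \<Longrightarrow> s' \<in> carrier S \<Longrightarrow> x \<in> carrier M \<Longrightarrow>
      ract M x (s \<oplus>\<^bsub>S\<^esub> s') = ract M x s \<oplus>\<^bsub>M\<^esub> ract M x s'"
    and "\<And>s s' x. s \<in> carrier S \<Longrightarrow> s' \<in> carrier S \<Longrightarrow> x \<in> carrier M \<Longrightarrow>
      ract M x (s \<otimes>\<^bsub>S\<^esub> s') = ract M (ract M x s) s'"
    and "\<And>x. x \<in> carrier M \<Longrightarrow> ract M x \<one>\<^bsub>S\<^esub> = x"
    and "\<And>r s x. r \<in> carrier R \<Longrightarrow> s \<in> carrier S \<Longrightarrow> x \<in> carrier M \<Longrightarrow>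
      lact M r (ract M x s) = ract M (lact M r x) s"
  using assms by (auto simp: bimodule_def)

lemmas bimodule_rules = bimoduleD(4-14)

lemma add_map_lact: "bimodule R S M \<Longrightarrow> r \<in> carrier R \<Longrightarrow> add_map M M (lact M r)"
  by (rule add_mapI) (auto simp: bimoduleD)

lemma add_map_ract: "bimodule R S M \<Longrightarrow> s \<in> carrier S \<Longrightarrow> add_map M M (\<lambda>x. ract M x s)"
  by (rule add_mapI) (auto simp: bimoduleD)

lemma add_map_lact_scalar: "bimodule R S M \<Longrightarrow> x \<in> carrier M \<Longrightarrow> add_map R M (\<lambda>r. lact M r x)"
  by (rule add_mapI) (auto simp: bimoduleD)

lemma add_map_ract_scalar: "bimodule R S M \<Longrightarrow> x \<in> carrier M \<Longrightarrow> add_map S M (ract M x)"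
  by (rule add_mapI) (auto simp: bimoduleD)

lemma add_map_mult_left: "ring R \<Longrightarrow> r \<in> carrier R \<Longrightarrow> add_map R R (\<lambda>x. r \<otimes>\<^bsub>R\<^esub> x)"
  by (rule add_mapI) (auto simp: ring.ring_simprules)

lemma add_map_mult_right: "ring R \<Longrightarrow> r \<in> carrier R \<Longrightarrow> add_map R R (\<lambda>x. x \<otimes>\<^bsub>R\<^esub> r)"
  by (rule add_mapI) (auto simp: ring.ring_simprules)

subsection \<open>The free abelian group on pairs\<close>

text \<open>The homomorphism that the free abelian group attaches to \<open>h\<close>. As
  \<open>lift\<close> is its value at the representative chosen by \<open>trep\<close>,
  well-definedness of \<open>lift\<close> amounts to its vanishing on the tensor relations.\<close>

definition free_eval :: "('c, 'w) ring_scheme \<Rightarrow> ('m \<Rightarrow> 'n \<Rightarrow> 'c) \<Rightarrow> ('m \<times> 'n \<Rightarrow> int) \<Rightarrow> 'c" where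
  "free_eval G h f = finsum G (\<lambda>p. add_pow G (f p) (h (fst p) (snd p))) (fsupp f)"

lemma lift_eq_free_eval: "lift G h X = free_eval G h (trep X)"
  by (simp add: lift_def free_eval_def)

lemma fsupp_finite: "f \<in> free_ab M N \<Longrightarrow> finite (fsupp f)"
  by (simp add: free_ab_def)

lemma free_ab_zero: "(\<lambda>p. 0) \<in> free_ab M N"
  by (simp add: free_ab_def fsupp_def)

lemma free_ab_gen: "x \<in> carrier M \<Longrightarrow> y \<in> carrier N \<Longrightarrow> gen x y \<in> free_ab M N"
  by (simp add: free_ab_def fsupp_def gen_def)

lemma free_ab_add: "f \<in> free_ab M N \<Longrightarrow> g \<in> free_ab M N \<Longrightarrow> (\<lambda>p. f p + g p) \<in> free_ab M N"
proof -
  assume f: "f \<in> free_ab M N" and g: "g \<in> free_ab M N"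
  have "fsupp (\<lambda>p. f p + g p) \<subseteq> fsupp f \<union> fsupp g" by (auto simp: fsupp_def)
  then show ?thesis using f g unfolding free_ab_def by (auto intro: finite_subset)
qed

lemma free_ab_uminus: "f \<in> free_ab M N \<Longrightarrow> (\<lambda>p. - f p) \<in> free_ab M N"
  unfolding free_ab_def fsupp_def by auto

lemma free_ab_diff: "f \<in> free_ab M N \<Longrightarrow> g \<in> free_ab M N \<Longrightarrow> (\<lambda>p. f p - g p) \<in> free_ab M N"
  using free_ab_add[of f M N "\<lambda>p. - g p"] free_ab_uminus[of g M N] by simp

text \<open>A point is stripped from the support and its integer coefficient is then rebuilt one
  unit at a time, upwards or downwards; hence both an adding and a subtracting step.\<close>

lemma free_ab_induct [consumes 1, case_names zero add sub]:
  fixes f :: "'a \<times> 'b \<Rightarrow> int"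
  assumes "f \<in> free_ab M N"
    and zero: "P (\<lambda>p. 0)"
    and add: "\<And>f x y. f \<in> free_ab M N \<Longrightarrow> x \<in> carrier M \<Longrightarrow> y \<in> carrier N \<Longrightarrow> P f \<Longrightarrow>
      P (\<lambda>p. f p + gen x y p)"
    and sub: "\<And>f x y. f \<in> free_ab M N \<Longrightarrow> x \<in> carrier M \<Longrightarrow> y \<in> carrier N \<Longrightarrow> P f \<Longrightarrow>
      P (\<lambda>p. f p - gen x y p)"
  shows "P f"
proof -
  have "\<forall>f. f \<in> free_ab M N \<longrightarrow> fsupp f \<subseteq> F \<longrightarrow> P f" if "finite F" for F
    using that
  proof (induction F rule: finite_induct)
    case empty
    show ?case
    proof (intro allI impI)
      fix f :: "'a \<times> 'b \<Rightarrow> int" assume "fsupp f \<subseteq> {}"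
      then have "f = (\<lambda>p. 0)" by (auto simp: fsupp_def fun_eq_iff)
      then show "P f" using zero by simp
    qed
  next
    case (insert q F)
    show ?case
    proof (intro allI impI)
      fix f assume f: "f \<in> free_ab M N" "fsupp f \<subseteq> insert q F"
      show "P f"
      proof (cases "q \<in> fsupp f")
        case False
        then show ?thesis using insert f by auto
      next
        case True
        obtain x y where q: "q = (x, y)" by (cases q)
        have xy: "x \<in> carrier M" "y \<in> carrier N" using True f q by (auto simp: free_ab_def)
        define g where "g = f(q := 0)"
        have g: "g \<in> free_ab M N" "fsupp g \<subseteq> F"
        proof -
          have "fsupp g = fsupp f - {q}" by (auto simp: g_def fsupp_def)
          then show "g \<in> free_ab M N" "fsupp g \<subseteq> F" using f by (auto simp: free_ab_def)
        qed
        have "P g" using g insert by auto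
        have step: "(\<lambda>p. g p + k * gen x y p) \<in> free_ab M N" for k
        proof -
          have "fsupp (\<lambda>p. g p + k * gen x y p) \<subseteq> insert (x, y) (fsupp g)"
            by (auto simp: fsupp_def gen_def)
          moreover have "finite (insert (x, y) (fsupp g))"
            "insert (x, y) (fsupp g) \<subseteq> carrier M \<times> carrier N"
            using g xy by (auto simp: free_ab_def)
          ultimately show ?thesis
            unfolding free_ab_def using finite_subset order_trans by blast
        qed
        have all: "P (\<lambda>p. g p + k * gen x y p)" for k
        proof (induction k rule: int_induct[where k = 0])
          case base
          then show ?case using \<open>P g\<close> by simp
        next
          case (step1 i)
          show ?case using add[OF step xy step1(2)] by (simp add: algebra_simps)
        next
          case (step2 i)
          show ?case using sub[OF step xy step2(2)] by (simp add: algebra_simps)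
        qed
        have "(\<lambda>p. g p + f q * gen x y p) = f"
          by (rule ext) (simp add: g_def gen_def q)
        then show ?thesis using all[of "f q"] by simp
      qed
    qed
  qed
  from this[of "fsupp f"] show ?thesis using assms(1) by (simp add: fsupp_finite)
qed

text \<open>Points with coefficient 0 contribute zero. A common index set is what allows two
  functions to be added, since their supports differ and that of the sum may shrink by
  cancellation.\<close>

lemma free_eval_superset:
  assumes "abelian_group G" "\<And>x y. x \<in> carrier M \<Longrightarrow> y \<in> carrier N \<Longrightarrow> h x y \<in> carrier G"
    and "finite F" "fsupp f \<subseteq> F" "F \<subseteq> carrier M \<times> carrier N"
  shows "free_eval G h f = finsum G (\<lambda>p. add_pow G (f p) (h (fst p) (snd p))) F"
proof -
  interpret G: abelian_group G by fact
  have F: "h (fst p) (snd p) \<in> carrier G" if "p \<in> F" for p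
    using that assms(2,5) by auto
  show ?thesis unfolding free_eval_def
  proof (rule G.add.finprod_mono_neutral_cong_left)
    show "(\<lambda>p. add_pow G (f p) (h (fst p) (snd p))) \<in> F \<rightarrow> carrier G"
      using F by (intro Pi_I G.add.int_pow_closed)
  qed (use assms(3,4) in \<open>auto simp: fsupp_def add_pow_def\<close>)
qed

context
  fixes G :: "('c, 'w) ring_scheme" and M :: "('r, 't, 'm) bimod" and N :: "('t, 'u, 'n) bimod"
    and h :: "'m \<Rightarrow> 'n \<Rightarrow> 'c"
  assumes G: "abelian_group G"
    and h: "\<And>x y. x \<in> carrier M \<Longrightarrow> y \<in> carrier N \<Longrightarrow> h x y \<in> carrier G"
begin

lemma free_eval_closed:
  assumes "f \<in> free_ab M N"
  shows "free_eval G h f \<in> carrier G"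
proof -
  interpret G: abelian_group G by (rule G)
  show ?thesis unfolding free_eval_def using assms
    by (intro G.finsum_closed) (auto simp: free_ab_def intro!: G.add.int_pow_closed h)
qed

lemma free_eval_zero: "free_eval G h (\<lambda>p. 0) = \<zero>\<^bsub>G\<^esub>"
proof -
  interpret G: abelian_group G by (rule G)
  show ?thesis unfolding free_eval_def by (simp add: fsupp_def)
qed

lemma free_eval_gen:
  assumes "x \<in> carrier M" "y \<in> carrier N"
  shows "free_eval G h (gen x y) = h x y"
proof -
  interpret G: abelian_group G by (rule G)
  have "fsupp (gen x y) = {(x, y)}" by (auto simp: fsupp_def gen_def)
  then show ?thesis unfolding free_eval_def using h[OF assms]
    by (simp add: G.finsum_insert gen_def)
qed

lemma free_eval_add:
  assumes f: "f \<in> free_ab M N" and g: "g \<in> free_ab M N"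
  shows "free_eval G h (\<lambda>p. f p + g p) = free_eval G h f \<oplus>\<^bsub>G\<^esub> free_eval G h g"
proof -
  interpret G: abelian_group G by (rule G)
  define F where "F = fsupp f \<union> fsupp g"
  have F: "finite F" "F \<subseteq> carrier M \<times> carrier N" "fsupp f \<subseteq> F" "fsupp g \<subseteq> F"
      "fsupp (\<lambda>p. f p + g p) \<subseteq> F"
    using f g by (auto simp: F_def free_ab_def) (auto simp: fsupp_def)
  have hF: "h (fst p) (snd p) \<in> carrier G" if "p \<in> F" for p
    using that F(2) h by auto
  have "free_eval G h (\<lambda>p. f p + g p) =
      finsum G (\<lambda>p. add_pow G (f p + g p) (h (fst p) (snd p))) F"
    by (rule free_eval_superset[OF G h F(1,5,2)])
  also have "\<dots> = finsum G (\<lambda>p. add_pow G (f p) (h (fst p) (snd p)) \<oplus>\<^bsub>G\<^esub>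
      add_pow G (g p) (h (fst p) (snd p))) F"
    by (rule G.finsum_cong') (auto simp: hF G.add.int_pow_mult)
  also have "\<dots> = free_eval G h f \<oplus>\<^bsub>G\<^esub> free_eval G h g"
  proof -
    have "free_eval G h f = finsum G (\<lambda>p. add_pow G (f p) (h (fst p) (snd p))) F"
      by (rule free_eval_superset[OF G h F(1,3,2)])
    moreover have "free_eval G h g = finsum G (\<lambda>p. add_pow G (g p) (h (fst p) (snd p))) F"
      by (rule free_eval_superset[OF G h F(1,4,2)])
    moreover have "(\<lambda>p. add_pow G (k p) (h (fst p) (snd p))) \<in> F \<rightarrow> carrier G" for k :: "'m \<times> 'n \<Rightarrow> int"
      using hF by (intro Pi_I G.add.int_pow_closed)
    ultimately show ?thesis using G.finsum_addf by simp
  qed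
  finally show ?thesis .
qed

lemma free_eval_diff:
  assumes f: "f \<in> free_ab M N" and g: "g \<in> free_ab M N"
  shows "free_eval G h (\<lambda>p. f p - g p) = free_eval G h f \<ominus>\<^bsub>G\<^esub> free_eval G h g"
proof -
  interpret G: abelian_group G by (rule G)
  have "free_eval G h f = free_eval G h (\<lambda>p. f p - g p) \<oplus>\<^bsub>G\<^esub> free_eval G h g"
    using free_eval_add[OF free_ab_diff[OF f g] g] by simp
  then show ?thesis
    using free_eval_closed[OF f] free_eval_closed[OF g] free_eval_closed[OF free_ab_diff[OF f g]]
    by (simp add: G.minus_eq G.a_assoc G.r_neg)
qed

end

subsection \<open>Tensor products\<close>

text \<open>The three clauses match the three families in \<open>tens_rels\<close>: these are the
  maps that factor through the tensor product over \<open>T\<close>.\<close>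

definition balanced ::
  "('t, 'z) ring_scheme \<Rightarrow> ('r, 't, 'm) bimod \<Rightarrow> ('t, 'u, 'n) bimod \<Rightarrow> ('c, 'w) ring_scheme \<Rightarrow>
    ('m \<Rightarrow> 'n \<Rightarrow> 'c) \<Rightarrow> bool" where
  "balanced T M N G h \<longleftrightarrow>
     (\<forall>x\<in>carrier M. add_map N G (h x)) \<and>
     (\<forall>y\<in>carrier N. add_map M G (\<lambda>x. h x y)) \<and>
     (\<forall>x\<in>carrier M. \<forall>t\<in>carrier T. \<forall>y\<in>carrier N. h (ract M x t) y = h x (lact N t y))"

lemma balancedI:
  assumes "\<And>x. x \<in> carrier M \<Longrightarrow> add_map N G (h x)"
    and "\<And>y. y \<in> carrier N \<Longrightarrow> add_map M G (\<lambda>x. h x y)"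
    and "\<And>x t y. x \<in> carrier M \<Longrightarrow> t \<in> carrier T \<Longrightarrow> y \<in> carrier N \<Longrightarrow>
      h (ract M x t) y = h x (lact N t y)"
  shows "balanced T M N G h"
  using assms by (simp add: balanced_def)

lemma balancedD:
  assumes "balanced T M N G h"
  shows "x \<in> carrier M \<Longrightarrow> add_map N G (h x)"
    and "y \<in> carrier N \<Longrightarrow> add_map M G (\<lambda>x. h x y)"
    and "x \<in> carrier M \<Longrightarrow> t \<in> carrier T \<Longrightarrow> y \<in> carrier N \<Longrightarrow>
      h (ract M x t) y = h x (lact N t y)"
  using assms by (simp_all add: balanced_def)

lemma balanced_closed:
  assumes "balanced T M N G h" "x \<in> carrier M" "y \<in> carrier N"
  shows "h x y \<in> carrier G"
  using add_map_closed[OF balancedD(1)[OF assms(1,2)] assms(3)] .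

lemma tens_sub_rels: "f \<in> tens_rels T M N \<Longrightarrow> f \<in> tens_sub T M N"
  by (auto simp: tens_sub_def)

lemma tens_sub_zero: "(\<lambda>p. 0) \<in> tens_sub T M N"
  by (auto simp: tens_sub_def)

lemma tens_sub_diff:
  "f \<in> tens_sub T M N \<Longrightarrow> g \<in> tens_sub T M N \<Longrightarrow> (\<lambda>p. f p - g p) \<in> tens_sub T M N"
  by (auto simp: tens_sub_def)

lemma tens_sub_uminus: "f \<in> tens_sub T M N \<Longrightarrow> (\<lambda>p. - f p) \<in> tens_sub T M N"
  using tens_sub_diff[OF tens_sub_zero, of f T M N] by simp

lemma tens_sub_add:
  "f \<in> tens_sub T M N \<Longrightarrow> g \<in> tens_sub T M N \<Longrightarrow> (\<lambda>p. f p + g p) \<in> tens_sub T M N"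
  using tens_sub_diff[OF _ tens_sub_uminus, of f T M N g] by simp

lemma tens_sub_least:
  assumes "tens_rels T M N \<subseteq> H" "(\<lambda>p. 0) \<in> H"
    and "\<And>f g. f \<in> H \<Longrightarrow> g \<in> H \<Longrightarrow> (\<lambda>p. f p - g p) \<in> H"
  shows "tens_sub T M N \<subseteq> H"
  using assms unfolding tens_sub_def by blast

lemma tcls_eqI:
  assumes "(\<lambda>p. f p - g p) \<in> tens_sub T M N"
  shows "tcls T M N f = tcls T M N g"
proof -
  have "(\<lambda>p. g p - k p) \<in> tens_sub T M N" if "(\<lambda>p. f p - k p) \<in> tens_sub T M N" for k
    using tens_sub_diff[OF that assms] by simp
  moreover have "(\<lambda>p. f p - k p) \<in> tens_sub T M N" if "(\<lambda>p. g p - k p) \<in> tens_sub T M N" for k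
    using tens_sub_add[OF that assms] by simp
  ultimately show ?thesis by (auto simp: tcls_def)
qed

text \<open>The class contains \<open>f\<close>, so the choice operator picks a member of it.
  Nothing else is known about the chosen representative.\<close>

lemma trep_tcls:
  assumes "f \<in> free_ab M N"
  shows "trep (tcls T M N f) \<in> free_ab M N"
    and "(\<lambda>p. f p - trep (tcls T M N f) p) \<in> tens_sub T M N"
proof -
  have "f \<in> tcls T M N f" using assms by (simp add: tcls_def tens_sub_zero)
  then have "trep (tcls T M N f) \<in> tcls T M N f" unfolding trep_def
    by (rule someI[where P = "\<lambda>g. g \<in> tcls T M N f"])
  then show "trep (tcls T M N f) \<in> free_ab M N"
      "(\<lambda>p. f p - trep (tcls T M N f) p) \<in> tens_sub T M N"
    by (simp_all add: tcls_def)
qed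

locale tensor_pair =
  fixes R :: "('r, 'x) ring_scheme" and T :: "('t, 'z) ring_scheme" and U :: "('u, 'y) ring_scheme"
    and M :: "('r, 't, 'm) bimod" and N :: "('t, 'u, 'n) bimod"
  assumes bimod_left: "bimodule R T M" and bimod_right: "bimodule T U N"
begin

abbreviation TP :: "('r, 'u, ('m \<times> 'n \<Rightarrow> int) set) bimod" where
  "TP \<equiv> tensor T M N"

abbreviation pure :: "'m \<Rightarrow> 'n \<Rightarrow> ('m \<times> 'n \<Rightarrow> int) set"  (infixl "\<diamondop>" 75) where
  "x \<diamondop> y \<equiv> tens T M N x y"

sublocale M: abelian_group M using bimod_left by (rule bimoduleD)
sublocale N: abelian_group N using bimod_right by (rule bimoduleD)

lemmas M_rules = bimodule_rules[OF bimod_left]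
lemmas N_rules = bimodule_rules[OF bimod_right]

lemma tens_rels_free: "tens_rels T M N \<subseteq> free_ab M N"
  unfolding tens_rels_def
  by (auto intro!: free_ab_diff free_ab_gen M.a_closed N.a_closed M_rules N_rules)

lemma carrier_tensor: "carrier TP = tcls T M N ` free_ab M N"
  by (simp add: tensor_def tensor_grp_def)

lemma zero_tensor: "\<zero>\<^bsub>TP\<^esub> = tcls T M N (\<lambda>p. 0)"
  by (simp add: tensor_def tensor_grp_def)

lemma tcls_closed: "f \<in> free_ab M N \<Longrightarrow> tcls T M N f \<in> carrier TP"
  by (simp add: carrier_tensor)

lemma add_tcls:
  assumes "f \<in> free_ab M N" "g \<in> free_ab M N"
  shows "tcls T M N f \<oplus>\<^bsub>TP\<^esub> tcls T M N g = tcls T M N (\<lambda>p. f p + g p)"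
proof -
  have "(\<lambda>p. f p + g p - (trep (tcls T M N f) p + trep (tcls T M N g) p)) \<in> tens_sub T M N"
    using tens_sub_add[OF trep_tcls(2)[OF assms(1)] trep_tcls(2)[OF assms(2)]]
    by (simp add: algebra_simps)
  from tcls_eqI[OF this] show ?thesis by (simp add: tensor_def tensor_grp_def)
qed

lemma abelian_group_tensor: "abelian_group TP"
proof (rule abelian_groupI)
  fix X Y Z
  assume X: "X \<in> carrier TP" and Y: "Y \<in> carrier TP" and Z: "Z \<in> carrier TP"
  show "X \<oplus>\<^bsub>TP\<^esub> Y \<in> carrier TP"
    using X Y by (auto simp: carrier_tensor add_tcls free_ab_add)
  show "X \<oplus>\<^bsub>TP\<^esub> Y \<oplus>\<^bsub>TP\<^esub> Z = X \<oplus>\<^bsub>TP\<^esub> (Y \<oplus>\<^bsub>TP\<^esub> Z)"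
    using X Y Z by (auto simp: carrier_tensor add_tcls free_ab_add add.assoc)
  show "X \<oplus>\<^bsub>TP\<^esub> Y = Y \<oplus>\<^bsub>TP\<^esub> X"
    using X Y by (auto simp: carrier_tensor add_tcls add.commute)
next
  show "\<zero>\<^bsub>TP\<^esub> \<in> carrier TP" by (simp add: zero_tensor tcls_closed free_ab_zero)
next
  fix X assume X: "X \<in> carrier TP"
  show "\<zero>\<^bsub>TP\<^esub> \<oplus>\<^bsub>TP\<^esub> X = X"
    using X by (auto simp: zero_tensor carrier_tensor add_tcls free_ab_zero)
  from X obtain f where f: "f \<in> free_ab M N" "X = tcls T M N f" by (auto simp: carrier_tensor)
  have "tcls T M N (\<lambda>p. - f p) \<oplus>\<^bsub>TP\<^esub> X = \<zero>\<^bsub>TP\<^esub>"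
    using f by (simp add: add_tcls free_ab_uminus zero_tensor)
  then show "\<exists>Y\<in>carrier TP. Y \<oplus>\<^bsub>TP\<^esub> X = \<zero>\<^bsub>TP\<^esub>"
    using tcls_closed[OF free_ab_uminus[OF f(1)]] by blast
qed

sublocale TP: abelian_group TP by (rule abelian_group_tensor)

lemma balanced_tens: "balanced T M N TP (\<diamondop>)"
proof (rule balancedI)
  fix x assume x: "x \<in> carrier M"
  show "add_map N TP ((\<diamondop>) x)"
  proof (rule add_mapI)
    fix y y' assume y: "y \<in> carrier N" "y' \<in> carrier N"
    have "(\<lambda>p. gen x (y \<oplus>\<^bsub>N\<^esub> y') p - gen x y p - gen x y' p) \<in> tens_sub T M N"
      by (rule tens_sub_rels) (use x y in \<open>auto simp: tens_rels_def\<close>)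
    then have "(\<lambda>p. gen x (y \<oplus>\<^bsub>N\<^esub> y') p - (gen x y p + gen x y' p)) \<in> tens_sub T M N"
      by (simp add: algebra_simps)
    from tcls_eqI[OF this] show "x \<diamondop> (y \<oplus>\<^bsub>N\<^esub> y') = x \<diamondop> y \<oplus>\<^bsub>TP\<^esub> x \<diamondop> y'"
      using x y by (simp add: tens_def add_tcls free_ab_gen)
  qed (use x in \<open>auto simp: tens_def tcls_closed free_ab_gen\<close>)
next
  fix y assume y: "y \<in> carrier N"
  show "add_map M TP (\<lambda>x. x \<diamondop> y)"
  proof (rule add_mapI)
    fix x x' assume x: "x \<in> carrier M" "x' \<in> carrier M"
    have "(\<lambda>p. gen (x \<oplus>\<^bsub>M\<^esub> x') y p - gen x y p - gen x' y p) \<in> tens_sub T M N"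
      by (rule tens_sub_rels) (use x y in \<open>auto simp: tens_rels_def\<close>)
    then have "(\<lambda>p. gen (x \<oplus>\<^bsub>M\<^esub> x') y p - (gen x y p + gen x' y p)) \<in> tens_sub T M N"
      by (simp add: algebra_simps)
    from tcls_eqI[OF this] show "(x \<oplus>\<^bsub>M\<^esub> x') \<diamondop> y = x \<diamondop> y \<oplus>\<^bsub>TP\<^esub> x' \<diamondop> y"
      using x y by (simp add: tens_def add_tcls free_ab_gen)
  qed (use y in \<open>auto simp: tens_def tcls_closed free_ab_gen\<close>)
next
  fix x t y assume *: "x \<in> carrier M" "t \<in> carrier T" "y \<in> carrier N"
  have "(\<lambda>p. gen (ract M x t) y p - gen x (lact N t y) p) \<in> tens_sub T M N"
    by (rule tens_sub_rels) (use * in \<open>auto simp: tens_rels_def\<close>)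
  from tcls_eqI[OF this] show "ract M x t \<diamondop> y = x \<diamondop> lact N t y" by (simp add: tens_def)
qed

lemmas tens_add_map_right = balancedD(1)[OF balanced_tens]
lemmas tens_add_map_left = balancedD(2)[OF balanced_tens]
lemmas tens_balanced = balancedD(3)[OF balanced_tens]
lemmas tens_closed = balanced_closed[OF balanced_tens]

text \<open>The finitely supported functions killed by \<open>free_eval G h\<close> contain the
  relations and zero and are closed under differences, so minimality of \<open>tens_sub\<close> puts
  it inside them. Membership in \<open>free_ab\<close> is carried along because additivity of
  \<open>free_eval\<close> is available only there.\<close>

lemma free_eval_tens_sub:
  assumes "abelian_group G" "balanced T M N G h" "f \<in> tens_sub T M N"
  shows "f \<in> free_ab M N \<and> free_eval G h f = \<zero>\<^bsub>G\<^esub>"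
proof -
  interpret G: abelian_group G by fact
  note hc = balanced_closed[OF assms(2)]
  note ev = free_eval_diff[where M = M and N = N and G = G and h = h, OF assms(1) hc]
    free_eval_gen[where M = M and N = N and G = G and h = h, OF assms(1) hc]
    free_eval_zero[where M = M and N = N and G = G and h = h, OF assms(1) hc]
  \<comment> \<open>The shape that both biadditivity relations take after evaluation.\<close>
  have cancel: "a \<oplus>\<^bsub>G\<^esub> b \<ominus>\<^bsub>G\<^esub> a \<ominus>\<^bsub>G\<^esub> b = \<zero>\<^bsub>G\<^esub>"
    if "a \<in> carrier G" "b \<in> carrier G" for a b
  proof -
    have "a \<oplus>\<^bsub>G\<^esub> b \<ominus>\<^bsub>G\<^esub> a = b"
      using that by (simp add: G.minus_eq G.a_comm[of a b] G.a_assoc G.r_neg)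
    then show ?thesis using that by (simp add: G.minus_eq G.r_neg)
  qed
  note fr = free_ab_gen free_ab_diff M_rules N_rules M.a_closed N.a_closed hc
  have "free_eval G h (\<lambda>p. gen (x \<oplus>\<^bsub>M\<^esub> x') y p - gen x y p - gen x' y p) = \<zero>\<^bsub>G\<^esub>"
    if "x \<in> carrier M" "x' \<in> carrier M" "y \<in> carrier N" for x x' y
    using that by (simp add: ev fr cancel add_map_add[OF balancedD(2)[OF assms(2)]])
  moreover have "free_eval G h (\<lambda>p. gen x (y \<oplus>\<^bsub>N\<^esub> y') p - gen x y p - gen x y' p) = \<zero>\<^bsub>G\<^esub>"
    if "x \<in> carrier M" "y \<in> carrier N" "y' \<in> carrier N" for x y y'
    using that by (simp add: ev fr cancel add_map_add[OF balancedD(1)[OF assms(2)]])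
  moreover have "free_eval G h (\<lambda>p. gen (ract M x t) y p - gen x (lact N t y) p) = \<zero>\<^bsub>G\<^esub>"
    if "x \<in> carrier M" "t \<in> carrier T" "y \<in> carrier N" for x t y
    using that by (simp add: ev fr G.minus_eq G.r_neg balancedD(3)[OF assms(2)])
  ultimately have "free_eval G h f = \<zero>\<^bsub>G\<^esub>" if "f \<in> tens_rels T M N" for f
    using that by (auto simp: tens_rels_def)
  then have "tens_sub T M N \<subseteq> {f \<in> free_ab M N. free_eval G h f = \<zero>\<^bsub>G\<^esub>}"
    using tens_rels_free
    by (intro tens_sub_least) (auto simp: free_ab_zero free_ab_diff ev G.minus_eq G.r_neg)
  then show ?thesis using assms(3) by auto
qed

text \<open>Independence of the representative: \<open>f\<close> and the chosen one differ by an
  element of \<open>tens_sub\<close>, which evaluates to zero.\<close>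

lemma lift_tcls:
  assumes "abelian_group G" "balanced T M N G h" "f \<in> free_ab M N"
  shows "lift G h (tcls T M N f) = free_eval G h f"
proof -
  interpret G: abelian_group G by fact
  note hc = balanced_closed[OF assms(2)]
  let ?g = "trep (tcls T M N f)"
  have g: "?g \<in> free_ab M N" by (rule trep_tcls(1)[OF assms(3)])
  have c: "free_eval G h f \<in> carrier G" "free_eval G h ?g \<in> carrier G"
    using free_eval_closed[where M = M and N = N and G = G and h = h, OF assms(1) hc] assms(3) g
    by auto
  have "free_eval G h (\<lambda>p. f p - ?g p) = \<zero>\<^bsub>G\<^esub>"
    using free_eval_tens_sub[OF assms(1,2) trep_tcls(2)[OF assms(3)]] by blast
  then have "free_eval G h f \<ominus>\<^bsub>G\<^esub> free_eval G h ?g = \<zero>\<^bsub>G\<^esub>"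
    using free_eval_diff[where M = M and N = N and G = G and h = h, OF assms(1) hc assms(3) g] by simp
  moreover have "free_eval G h f \<ominus>\<^bsub>G\<^esub> free_eval G h ?g \<oplus>\<^bsub>G\<^esub> free_eval G h ?g = free_eval G h f"
    using c by (simp add: G.minus_eq G.a_assoc G.l_neg)
  ultimately have "free_eval G h f = free_eval G h ?g"
    using c by simp
  then show ?thesis by (simp add: lift_eq_free_eval)
qed

lemma lift_add_map:
  assumes "abelian_group G" "balanced T M N G h"
  shows "add_map TP G (lift G h)"
proof (rule add_mapI)
  note hc = balanced_closed[OF assms(2)]
  fix X assume "X \<in> carrier TP"
  then obtain f where f: "f \<in> free_ab M N" "X = tcls T M N f" by (auto simp: carrier_tensor)
  then show "lift G h X \<in> carrier G"
    using free_eval_closed[where M = M and N = N and G = G and h = h, OF assms(1) hc]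
    by (simp add: lift_tcls[OF assms])
  fix Y assume "Y \<in> carrier TP"
  then obtain g where g: "g \<in> free_ab M N" "Y = tcls T M N g" by (auto simp: carrier_tensor)
  show "lift G h (X \<oplus>\<^bsub>TP\<^esub> Y) = lift G h X \<oplus>\<^bsub>G\<^esub> lift G h Y"
    using f g free_eval_add[where M = M and N = N and G = G and h = h, OF assms(1) hc]
    by (simp add: lift_tcls[OF assms] add_tcls free_ab_add)
qed

lemma lift_tens:
  assumes "abelian_group G" "balanced T M N G h" "x \<in> carrier M" "y \<in> carrier N"
  shows "lift G h (x \<diamondop> y) = h x y"
  using free_eval_gen[where M = M and N = N and G = G and h = h,
      OF assms(1) balanced_closed[OF assms(2)] assms(3,4)] assms(3,4)
  by (simp add: tens_def lift_tcls[OF assms(1,2)] free_ab_gen)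

text \<open>Every element is a sum of pure tensors, without signs: the negative of
  \<open>x \<otimes> y\<close> is the pure tensor of \<open>-x\<close> and \<open>y\<close>, and
  zero is the pure tensor of the two zeros. Hence there is no case for inverses.\<close>

lemma tensor_induct [consumes 1, case_names tens add]:
  assumes X: "X \<in> carrier TP"
    and tens: "\<And>x y. x \<in> carrier M \<Longrightarrow> y \<in> carrier N \<Longrightarrow> P (x \<diamondop> y)"
    and add: "\<And>X Y. X \<in> carrier TP \<Longrightarrow> Y \<in> carrier TP \<Longrightarrow> P X \<Longrightarrow> P Y \<Longrightarrow> P (X \<oplus>\<^bsub>TP\<^esub> Y)"
  shows "P X"
proof -
  have neg: "tcls T M N (\<lambda>p. - gen x y p) = (\<ominus>\<^bsub>M\<^esub> x) \<diamondop> y"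
    if "x \<in> carrier M" "y \<in> carrier N" for x y
  proof -
    have "(\<ominus>\<^bsub>M\<^esub> x) \<diamondop> y \<oplus>\<^bsub>TP\<^esub> x \<diamondop> y = \<zero>\<^bsub>M\<^esub> \<diamondop> y"
      using add_map_add[OF tens_add_map_left[OF that(2)], of "\<ominus>\<^bsub>M\<^esub> x" x] that
      by (simp add: M.l_neg)
    also have "\<dots> = \<zero>\<^bsub>TP\<^esub>"
      using add_map_zero[OF M.abelian_group_axioms abelian_group_tensor tens_add_map_left[OF that(2)]] .
    finally have "(\<ominus>\<^bsub>M\<^esub> x) \<diamondop> y \<oplus>\<^bsub>TP\<^esub> x \<diamondop> y = \<zero>\<^bsub>TP\<^esub>" .
    moreover have "tcls T M N (\<lambda>p. - gen x y p) \<oplus>\<^bsub>TP\<^esub> x \<diamondop> y = \<zero>\<^bsub>TP\<^esub>"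
      using that by (simp add: tens_def add_tcls free_ab_gen free_ab_uminus zero_tensor)
    ultimately show ?thesis
      using that TP.add.right_cancel[of "x \<diamondop> y" "tcls T M N (\<lambda>p. - gen x y p)" "(\<ominus>\<^bsub>M\<^esub> x) \<diamondop> y"]
      by (simp add: tcls_closed free_ab_gen free_ab_uminus tens_closed)
  qed
  from X obtain f where f: "f \<in> free_ab M N" "X = tcls T M N f" by (auto simp: carrier_tensor)
  have "P (tcls T M N f)" using f(1)
  proof (induction rule: free_ab_induct)
    case zero
    have "\<zero>\<^bsub>M\<^esub> \<diamondop> \<zero>\<^bsub>N\<^esub> = tcls T M N (\<lambda>p. 0)"
      using add_map_zero[OF M.abelian_group_axioms abelian_group_tensor tens_add_map_left[of "\<zero>\<^bsub>N\<^esub>"]]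
      by (simp add: zero_tensor)
    then show ?case using tens[of "\<zero>\<^bsub>M\<^esub>" "\<zero>\<^bsub>N\<^esub>"] by simp
  next
    case (add f x y)
    have "P (tcls T M N f \<oplus>\<^bsub>TP\<^esub> x \<diamondop> y)"
      by (intro assms(3) tcls_closed tens_closed tens add)
    then show ?case using add by (simp add: tens_def add_tcls free_ab_gen)
  next
    case (sub f x y)
    have "P (tcls T M N f \<oplus>\<^bsub>TP\<^esub> (\<ominus>\<^bsub>M\<^esub> x) \<diamondop> y)"
      by (intro assms(3) tcls_closed tens_closed tens sub M.a_inv_closed)
    then show ?case using sub by (simp add: neg[symmetric] add_tcls free_ab_gen free_ab_uminus)
  qed
  then show ?thesis using f by simp
qed

text \<open>The uniqueness half of the universal property. It asks for additivity alone, so one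
  principle settles bimodule laws, linearity statements and cointegral identities alike.\<close>

lemma add_map_ext:
  assumes "add_map TP G F" "add_map TP G F'"
    and "\<And>x y. x \<in> carrier M \<Longrightarrow> y \<in> carrier N \<Longrightarrow> F (x \<diamondop> y) = F' (x \<diamondop> y)"
    and "X \<in> carrier TP"
  shows "F X = F' X"
  using assms(4)
  by (induction rule: tensor_induct)
    (auto simp: assms(3) add_map_add[OF assms(1)] add_map_add[OF assms(2)])

text \<open>The actions on \<open>tensor\<close> are defined by lifting into the bare group
  \<open>tensor_grp\<close>, which has the same carrier and addition. This and the next lemmas let
  results about one serve the other.\<close>

lemma add_map_tensor_grp: "add_map TP (tensor_grp T M N) F = add_map TP TP F"
  by (simp add: add_map_def tensor_def)

lemma abelian_group_tensor_grp: "abelian_group (tensor_grp T M N)"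
proof -
  have "carrier (tensor_grp T M N) = carrier TP" "add (tensor_grp T M N) = add TP"
      "zero (tensor_grp T M N) = zero TP"
    by (simp_all add: tensor_def)
  then show ?thesis
    by (intro abelian_groupI) (auto simp: TP.a_ac TP.add.l_inv_ex)
qed

lemma balanced_tensor_grp: "balanced T M N (tensor_grp T M N) h = balanced T M N TP h"
  by (simp add: balanced_def add_map_def tensor_def)

lemma balanced_lact: "r \<in> carrier R \<Longrightarrow> balanced T M N TP (\<lambda>x y. lact M r x \<diamondop> y)"
  by (rule balancedI)
    (auto intro!: tens_add_map_right M_rules
      add_map_comp[OF add_map_lact[OF bimod_left] tens_add_map_left] simp: M_rules tens_balanced)

lemma balanced_ract: "u \<in> carrier U \<Longrightarrow> balanced T M N TP (\<lambda>x y. x \<diamondop> ract N y u)"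
  by (rule balancedI)
    (auto intro!: tens_add_map_left N_rules
      add_map_comp[OF add_map_ract[OF bimod_right] tens_add_map_right] simp: N_rules tens_balanced)

lemma tensor_lact_def: "lact TP r = lift (tensor_grp T M N) (\<lambda>x y. lact M r x \<diamondop> y)"
  and tensor_ract_def: "(\<lambda>X. ract TP X u) = lift (tensor_grp T M N) (\<lambda>x y. x \<diamondop> ract N y u)"
  by (simp_all add: tensor_def fun_eq_iff)

lemma lact_tens:
  "r \<in> carrier R \<Longrightarrow> x \<in> carrier M \<Longrightarrow> y \<in> carrier N \<Longrightarrow> lact TP r (x \<diamondop> y) = lact M r x \<diamondop> y"
  using lift_tens[OF abelian_group_tensor_grp] balanced_lact[of r]
  by (simp add: tensor_lact_def balanced_tensor_grp)

lemma ract_tens: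
  "u \<in> carrier U \<Longrightarrow> x \<in> carrier M \<Longrightarrow> y \<in> carrier N \<Longrightarrow> ract TP (x \<diamondop> y) u = x \<diamondop> ract N y u"
  using lift_tens[OF abelian_group_tensor_grp] balanced_ract[of u] tensor_ract_def[of u, THEN fun_cong]
  by (simp add: balanced_tensor_grp)

lemma add_map_tensor_lact: "r \<in> carrier R \<Longrightarrow> add_map TP TP (lact TP r)"
  using lift_add_map[OF abelian_group_tensor_grp] balanced_lact[of r]
  by (simp add: tensor_lact_def balanced_tensor_grp add_map_tensor_grp)

lemma add_map_tensor_ract: "u \<in> carrier U \<Longrightarrow> add_map TP TP (\<lambda>X. ract TP X u)"
  using lift_add_map[OF abelian_group_tensor_grp] balanced_ract[of u]
  unfolding tensor_ract_def by (simp add: balanced_tensor_grp add_map_tensor_grp)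

text \<open>Once the actions are known to be additive, each remaining law equates two additive maps
  of the tensor and is inherited from the factors on pure tensors.\<close>

lemma bimodule_tensor: "bimodule R U TP"
proof -
  interpret R: ring R using bimod_left by (rule bimoduleD)
  interpret U: ring U using bimod_right by (rule bimoduleD)
  note L = add_map_tensor_lact and A = add_map_tensor_ract
  note C = add_map_closed[OF L] add_map_closed[OF A]
  have "lact TP (r \<oplus>\<^bsub>R\<^esub> r') X = lact TP r X \<oplus>\<^bsub>TP\<^esub> lact TP r' X"
    if "r \<in> carrier R" "r' \<in> carrier R" "X \<in> carrier TP" for r r' X
    by (rule add_map_ext[OF L[of "r \<oplus>\<^bsub>R\<^esub> r'"] add_map_plus[OF abelian_group_tensor L[of r] L[of r']]])
      (use that in \<open>simp_all add: lact_tens M_rules add_map_add[OF tens_add_map_left]\<close>)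
  moreover have "lact TP (r \<otimes>\<^bsub>R\<^esub> r') X = lact TP r (lact TP r' X)"
    if "r \<in> carrier R" "r' \<in> carrier R" "X \<in> carrier TP" for r r' X
    by (rule add_map_ext[OF L[of "r \<otimes>\<^bsub>R\<^esub> r'"] add_map_comp[OF L[of r'] L[of r]]])
      (use that in \<open>simp_all add: lact_tens M_rules\<close>)
  moreover have "lact TP \<one>\<^bsub>R\<^esub> X = X" if "X \<in> carrier TP" for X
    by (rule add_map_ext[OF L[of "\<one>\<^bsub>R\<^esub>"] add_map_id])
      (use that in \<open>simp_all add: lact_tens M_rules\<close>)
  moreover have "ract TP X (u \<oplus>\<^bsub>U\<^esub> u') = ract TP X u \<oplus>\<^bsub>TP\<^esub> ract TP X u'"
    if "u \<in> carrier U" "u' \<in> carrier U" "X \<in> carrier TP" for u u' X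
    by (rule add_map_ext[OF A[of "u \<oplus>\<^bsub>U\<^esub> u'"] add_map_plus[OF abelian_group_tensor A[of u] A[of u']]])
      (use that in \<open>simp_all add: ract_tens N_rules add_map_add[OF tens_add_map_right]\<close>)
  moreover have "ract TP X (u \<otimes>\<^bsub>U\<^esub> u') = ract TP (ract TP X u) u'"
    if "u \<in> carrier U" "u' \<in> carrier U" "X \<in> carrier TP" for u u' X
    by (rule add_map_ext[OF A[of "u \<otimes>\<^bsub>U\<^esub> u'"] add_map_comp[OF A[of u] A[of u']]])
      (use that in \<open>simp_all add: ract_tens N_rules\<close>)
  moreover have "ract TP X \<one>\<^bsub>U\<^esub> = X" if "X \<in> carrier TP" for X
    by (rule add_map_ext[OF A[of "\<one>\<^bsub>U\<^esub>"] add_map_id])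
      (use that in \<open>simp_all add: ract_tens N_rules\<close>)
  moreover have "lact TP r (ract TP X u) = ract TP (lact TP r X) u"
    if "r \<in> carrier R" "u \<in> carrier U" "X \<in> carrier TP" for r u X
    by (rule add_map_ext[OF add_map_comp[OF A[of u] L[of r]] add_map_comp[OF L[of r] A[of u]]])
      (use that in \<open>simp_all add: ract_tens lact_tens N_rules M_rules\<close>)
  ultimately show ?thesis
    unfolding bimodule_def
    by (simp add: R.ring_axioms U.ring_axioms abelian_group_tensor C
        add_map_add[OF L] add_map_add[OF A])
qed

no_notation pure (infixl "\<diamondop>" 75)

end

subsection \<open>Cointegrals on tensor products\<close>

text \<open>Covers both corings of the theorem, each being a tensor product over \<open>B\<close>
  with one ring acting on both outer sides. No coproduct is fixed here; it enters only with the
  cointegral criterion.\<close>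

locale tensor_coring = tensor_pair R T R M N
  for R :: "('r, 'x) ring_scheme" and T :: "('t, 'z) ring_scheme"
    and M :: "('r, 't, 'm) bimod" and N :: "('t, 'r, 'n) bimod"
begin

sublocale CC: tensor_pair R R R TP TP
  by unfold_locales (rule bimodule_tensor)+

sublocale R: ring R using bimod_left by (rule bimoduleD)

lemma abelian_group_base: "abelian_group R"
  by (rule R.abelian_group_axioms)

text \<open>The universal property is used three times: \<open>H\<close> absorbs the right-hand
  pair, \<open>K\<close> the left-hand pair, and lifting \<open>K\<close> the outer tensor product
  over \<open>R\<close>. The hypothesis \<open>middle\<close> balances \<open>K\<close> over
  \<open>R\<close>; \<open>lact\<close> and \<open>ract\<close> become bilinearity of the
  result.\<close>

lemma balanced_extension:
  fixes h :: "'m \<Rightarrow> 'n \<Rightarrow> 'm \<Rightarrow> 'n \<Rightarrow> 'r"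
  assumes left: "\<And>p' q'. p' \<in> carrier M \<Longrightarrow> q' \<in> carrier N \<Longrightarrow> balanced T M N R (\<lambda>p q. h p q p' q')"
    and right: "\<And>p q. p \<in> carrier M \<Longrightarrow> q \<in> carrier N \<Longrightarrow> balanced T M N R (h p q)"
    and middle: "\<And>p q r p' q'. p \<in> carrier M \<Longrightarrow> q \<in> carrier N \<Longrightarrow> r \<in> carrier R \<Longrightarrow>
      p' \<in> carrier M \<Longrightarrow> q' \<in> carrier N \<Longrightarrow> h p (ract N q r) p' q' = h p q (lact M r p') q'"
    and lact: "\<And>p q r p' q'. p \<in> carrier M \<Longrightarrow> q \<in> carrier N \<Longrightarrow> r \<in> carrier R \<Longrightarrow>
      p' \<in> carrier M \<Longrightarrow> q' \<in> carrier N \<Longrightarrow> h (lact M r p) q p' q' = r \<otimes>\<^bsub>R\<^esub> h p q p' q'"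
    and ract: "\<And>p q r p' q'. p \<in> carrier M \<Longrightarrow> q \<in> carrier N \<Longrightarrow> r \<in> carrier R \<Longrightarrow>
      p' \<in> carrier M \<Longrightarrow> q' \<in> carrier N \<Longrightarrow> h p q p' (ract N q' r) = h p q p' q' \<otimes>\<^bsub>R\<^esub> r"
  obtains \<gamma> where "add_map CC.TP R \<gamma>"
    and "\<And>r X. r \<in> carrier R \<Longrightarrow> X \<in> carrier CC.TP \<Longrightarrow> \<gamma> (lact CC.TP r X) = r \<otimes>\<^bsub>R\<^esub> \<gamma> X"
    and "\<And>r X. r \<in> carrier R \<Longrightarrow> X \<in> carrier CC.TP \<Longrightarrow> \<gamma> (ract CC.TP X r) = \<gamma> X \<otimes>\<^bsub>R\<^esub> r"
    and "\<And>p q p' q'. p \<in> carrier M \<Longrightarrow> q \<in> carrier N \<Longrightarrow> p' \<in> carrier M \<Longrightarrow> q' \<in> carrier N \<Longrightarrow>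
      \<gamma> (CC.pure (pure p q) (pure p' q')) = h p q p' q'"
proof -
  note R = abelian_group_base
  define H where "H p q = lift R (h p q)" for p q
  have H: "add_map TP R (H p q)" if "p \<in> carrier M" "q \<in> carrier N" for p q
    unfolding H_def by (rule lift_add_map[OF R right[OF that]])
  have H_pure: "H p q (pure p' q') = h p q p' q'"
    if "p \<in> carrier M" "q \<in> carrier N" "p' \<in> carrier M" "q' \<in> carrier N" for p q p' q'
    unfolding H_def by (rule lift_tens[OF R right]) (use that in auto)
  \<comment> \<open>The hypothesis \<open>left\<close> speaks of a pure second factor only;
    additivity of \<open>H p q\<close> extends it to every \<open>c\<close>.\<close>
  have Hbal: "balanced T M N R (\<lambda>p q. H p q c)" if c: "c \<in> carrier TP" for c
  proof (intro balancedI add_mapI)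
    fix p q q' assume p: "p \<in> carrier M" and q: "q \<in> carrier N" "q' \<in> carrier N"
    note qq = N.a_closed[OF q]
    show "H p (q \<oplus>\<^bsub>N\<^esub> q') c = H p q c \<oplus>\<^bsub>R\<^esub> H p q' c"
      by (rule add_map_ext[OF H[OF p qq] add_map_plus[OF R H[OF p q(1)] H[OF p q(2)]] _ c])
        (simp add: H_pure p q add_map_add[OF balancedD(1)[OF left]])
  next
    fix q p p' assume q: "q \<in> carrier N" and p: "p \<in> carrier M" "p' \<in> carrier M"
    note pp = M.a_closed[OF p]
    show "H (p \<oplus>\<^bsub>M\<^esub> p') q c = H p q c \<oplus>\<^bsub>R\<^esub> H p' q c"
      by (rule add_map_ext[OF H[OF pp q] add_map_plus[OF R H[OF p(1) q] H[OF p(2) q]] _ c])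
        (simp add: H_pure p q add_map_add[OF balancedD(2)[OF left]])
  next
    fix p t q assume *: "p \<in> carrier M" "t \<in> carrier T" "q \<in> carrier N"
    note pt = M_rules(2)[OF *(2,1)] and tq = N_rules(1)[OF *(2,3)]
    show "H (ract M p t) q c = H p (lact N t q) c"
      by (rule add_map_ext[OF H[OF pt *(3)] H[OF *(1) tq] _ c])
        (simp add: H_pure * pt tq balancedD(3)[OF left])
  qed (auto intro: add_map_closed[OF H] c)
  define K where "K c c' = lift R (\<lambda>p q. H p q c') c" for c c'
  have K_left: "add_map TP R (\<lambda>c. K c c')" if "c' \<in> carrier TP" for c'
    unfolding K_def by (rule lift_add_map[OF R Hbal[OF that]])
  have K_pure: "K (pure p q) c = H p q c"
    if "p \<in> carrier M" "q \<in> carrier N" "c \<in> carrier TP" for p q c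
    unfolding K_def by (rule lift_tens[OF R Hbal]) (use that in auto)
  \<comment> \<open>\<open>K\<close> is a lift in its first argument, so additivity in the second is
    not automatic: it is tested on pure first arguments, where \<open>K\<close> reduces to
    \<open>H\<close>.\<close>
  have K_right: "add_map TP R (K c)" if c: "c \<in> carrier TP" for c
  proof (rule add_mapI)
    fix d d' assume d: "d \<in> carrier TP" "d' \<in> carrier TP"
    note dd = TP.a_closed[OF d]
    show "K c d \<in> carrier R" by (rule add_map_closed[OF K_left[OF d(1)] c])
    show "K c (d \<oplus>\<^bsub>TP\<^esub> d') = K c d \<oplus>\<^bsub>R\<^esub> K c d'"
      by (rule add_map_ext[OF K_left[OF dd] add_map_plus[OF R K_left[OF d(1)] K_left[OF d(2)]] _ c])
        (simp add: K_pure d dd add_map_add[OF H])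
  qed
  \<comment> \<open>Balancing over \<open>R\<close> is reduced first to a pure \<open>c\<close> and
    then to a pure \<open>d\<close>, where it is the hypothesis \<open>middle\<close>.\<close>
  have K: "balanced R TP TP R K"
  proof (rule balancedI[OF K_right K_left])
    fix c r d assume *: "c \<in> carrier TP" "r \<in> carrier R" "d \<in> carrier TP"
    note rd = CC.N_rules(1)[OF *(2,3)]
    show "K (ract TP c r) d = K c (lact TP r d)"
    proof (rule add_map_ext[OF add_map_comp[OF add_map_tensor_ract K_left] K_left _ *(1)])
      fix p q assume p: "p \<in> carrier M" "q \<in> carrier N"
      note qr = N_rules(2)[OF *(2) p(2)]
      have "K (pure p (ract N q r)) d = K (pure p q) (lact TP r d)"
        unfolding K_pure[OF p(1) qr *(3)] K_pure[OF p rd]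
        by (rule add_map_ext[OF H[OF p(1) qr] add_map_comp[OF add_map_tensor_lact[OF *(2)] H[OF p]] _ *(3)])
          (simp add: p qr * lact_tens H_pure middle M_rules)
      then show "K (ract TP (pure p q) r) d = K (pure p q) (lact TP r d)"
        by (simp add: ract_tens p *)
    qed (use * rd in auto)
  qed
  define \<gamma> where "\<gamma> = lift R K"
  have \<gamma>: "add_map CC.TP R \<gamma>" unfolding \<gamma>_def by (rule CC.lift_add_map[OF R K])
  have \<gamma>_pure: "\<gamma> (CC.pure c d) = K c d" if "c \<in> carrier TP" "d \<in> carrier TP" for c d
    unfolding \<gamma>_def by (rule CC.lift_tens[OF R K that])
  have K_lact: "K (lact TP r c) d = r \<otimes>\<^bsub>R\<^esub> K c d"
    if r: "r \<in> carrier R" and c: "c \<in> carrier TP" and d: "d \<in> carrier TP" for r c d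
  proof (rule add_map_ext[OF add_map_comp[OF add_map_tensor_lact[OF r] K_left[OF d]]
        add_map_comp[OF K_left[OF d] add_map_mult_left[OF R.ring_axioms r]] _ c])
    fix p q assume p: "p \<in> carrier M" "q \<in> carrier N"
    note rp = M_rules(1)[OF r p(1)]
    have "H (lact M r p) q d = r \<otimes>\<^bsub>R\<^esub> H p q d"
      by (rule add_map_ext[OF H[OF rp p(2)] add_map_comp[OF H[OF p] add_map_mult_left[OF R.ring_axioms r]] _ d])
        (simp add: H_pure p r rp lact)
    then show "K (lact TP r (pure p q)) d = r \<otimes>\<^bsub>R\<^esub> K (pure p q) d"
      by (simp add: lact_tens K_pure p r rp d)
  qed
  have K_ract: "K c (ract TP d r) = K c d \<otimes>\<^bsub>R\<^esub> r"
    if r: "r \<in> carrier R" and c: "c \<in> carrier TP" and d: "d \<in> carrier TP" for r c d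
  proof (rule add_map_ext[OF K_left[OF CC.N_rules(2)[OF r d]]
        add_map_comp[OF K_left[OF d] add_map_mult_right[OF R.ring_axioms r]] _ c])
    fix p q assume p: "p \<in> carrier M" "q \<in> carrier N"
    have "H p q (ract TP d r) = H p q d \<otimes>\<^bsub>R\<^esub> r"
      by (rule add_map_ext[OF add_map_comp[OF add_map_tensor_ract[OF r] H[OF p]]
            add_map_comp[OF H[OF p] add_map_mult_right[OF R.ring_axioms r]] _ d])
        (simp add: ract_tens H_pure p r N_rules ract)
    then show "K (pure p q) (ract TP d r) = K (pure p q) d \<otimes>\<^bsub>R\<^esub> r"
      by (simp add: K_pure p d CC.N_rules(2)[OF r])
  qed
  show thesis
  proof (rule that[OF \<gamma>])
    fix r X assume r: "r \<in> carrier R" and X: "X \<in> carrier CC.TP"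
    show "\<gamma> (lact CC.TP r X) = r \<otimes>\<^bsub>R\<^esub> \<gamma> X"
      by (rule CC.add_map_ext[OF add_map_comp[OF CC.add_map_tensor_lact[OF r] \<gamma>]
            add_map_comp[OF \<gamma> add_map_mult_left[OF R.ring_axioms r]] _ X])
        (simp add: CC.lact_tens r \<gamma>_pure K_lact CC.M_rules)
    show "\<gamma> (ract CC.TP X r) = \<gamma> X \<otimes>\<^bsub>R\<^esub> r"
      by (rule CC.add_map_ext[OF add_map_comp[OF CC.add_map_tensor_ract[OF r] \<gamma>]
            add_map_comp[OF \<gamma> add_map_mult_right[OF R.ring_axioms r]] _ X])
        (simp add: CC.ract_tens r \<gamma>_pure K_ract CC.N_rules)
  next
    fix p q p' q' assume *: "p \<in> carrier M" "q \<in> carrier N" "p' \<in> carrier M" "q' \<in> carrier N"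
    then show "\<gamma> (CC.pure (pure p q) (pure p' q')) = h p q p' q'"
      by (simp add: \<gamma>_pure tens_closed K_pure H_pure)
  qed
qed

section \<open>Bilinear forms on the square of the coring and the colinearity identity\<close>

context
  fixes \<gamma>
  assumes \<gamma>: "add_map CC.TP R \<gamma>"
    and \<gamma>_lact: "\<forall>r\<in>carrier R. \<forall>X\<in>carrier CC.TP. \<gamma> (lact CC.TP r X) = r \<otimes>\<^bsub>R\<^esub> \<gamma> X"
    and \<gamma>_ract: "\<forall>r\<in>carrier R. \<forall>X\<in>carrier CC.TP. \<gamma> (ract CC.TP X r) = \<gamma> X \<otimes>\<^bsub>R\<^esub> r"
begin

lemma add_map_pure_left: "d \<in> carrier TP \<Longrightarrow> add_map TP R (\<lambda>c. \<gamma> (CC.pure c d))"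
  by (rule add_map_comp[OF CC.tens_add_map_left \<gamma>])

lemma add_map_pure_right: "c \<in> carrier TP \<Longrightarrow> add_map TP R (\<lambda>d. \<gamma> (CC.pure c d))"
  by (rule add_map_comp[OF CC.tens_add_map_right \<gamma>])

lemma pure_closed: "c \<in> carrier TP \<Longrightarrow> d \<in> carrier TP \<Longrightarrow> \<gamma> (CC.pure c d) \<in> carrier R"
  by (rule add_map_closed[OF add_map_pure_left])

lemma pure_lact:
  "r \<in> carrier R \<Longrightarrow> c \<in> carrier TP \<Longrightarrow> d \<in> carrier TP \<Longrightarrow>
    \<gamma> (CC.pure (lact TP r c) d) = r \<otimes>\<^bsub>R\<^esub> \<gamma> (CC.pure c d)"
  using \<gamma>_lact[rule_format, of r "CC.pure c d"] by (simp add: CC.tens_closed CC.lact_tens)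

lemma pure_ract:
  "r \<in> carrier R \<Longrightarrow> c \<in> carrier TP \<Longrightarrow> d \<in> carrier TP \<Longrightarrow>
    \<gamma> (CC.pure c (ract TP d r)) = \<gamma> (CC.pure c d) \<otimes>\<^bsub>R\<^esub> r"
  using \<gamma>_ract[rule_format, of r "CC.pure c d"] by (simp add: CC.tens_closed CC.ract_tens)

text \<open>Colinearity of a cointegral is phrased with \<open>lift\<close>, whose values can be
  computed once the lifted map is balanced. Left linearity of \<open>\<gamma>\<close> provides the
  balancing on this side; on the mirrored side it is right linearity.\<close>

lemma balanced_cointegral_left:
  assumes d: "d \<in> carrier TP"
  shows "balanced R TP TP TP (\<lambda>x y. ract TP x (\<gamma> (CC.pure y d)))"
proof (rule balancedI)
  fix x assume x: "x \<in> carrier TP"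
  show "add_map TP TP (\<lambda>y. ract TP x (\<gamma> (CC.pure y d)))"
    by (rule add_map_comp[OF add_map_pure_left[OF d] add_map_ract_scalar[OF CC.bimod_left x]])
next
  fix y assume y: "y \<in> carrier TP"
  show "add_map TP TP (\<lambda>x. ract TP x (\<gamma> (CC.pure y d)))"
    by (rule add_map_tensor_ract[OF pure_closed[OF y d]])
next
  fix x r y assume "x \<in> carrier TP" "r \<in> carrier R" "y \<in> carrier TP"
  with d show "ract TP (ract TP x r) (\<gamma> (CC.pure y d)) = ract TP x (\<gamma> (CC.pure (lact TP r y) d))"
    by (simp add: pure_lact pure_closed CC.M_rules)
qed

lemma balanced_cointegral_right:
  assumes c: "c \<in> carrier TP"
  shows "balanced R TP TP TP (\<lambda>x y. lact TP (\<gamma> (CC.pure c x)) y)"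
proof (rule balancedI)
  fix x assume x: "x \<in> carrier TP"
  show "add_map TP TP (lact TP (\<gamma> (CC.pure c x)))"
    by (rule add_map_tensor_lact[OF pure_closed[OF c x]])
next
  fix y assume y: "y \<in> carrier TP"
  show "add_map TP TP (\<lambda>x. lact TP (\<gamma> (CC.pure c x)) y)"
    by (rule add_map_comp[OF add_map_pure_right[OF c] add_map_lact_scalar[OF CC.bimod_left y]])
next
  fix x r y assume "x \<in> carrier TP" "r \<in> carrier R" "y \<in> carrier TP"
  with c show "lact TP (\<gamma> (CC.pure c (ract TP x r))) y = lact TP (\<gamma> (CC.pure c x)) (lact TP r y)"
    by (simp add: pure_ract pure_closed CC.M_rules)
qed

lemma lift_cointegral_left:
  assumes "a \<in> J \<rightarrow> carrier TP" "b \<in> J \<rightarrow> carrier TP" "d \<in> carrier TP"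
  shows "lift TP (\<lambda>x y. ract TP x (\<gamma> (CC.pure y d))) (finsum CC.TP (\<lambda>j. CC.pure (a j) (b j)) J) =
    finsum TP (\<lambda>j. ract TP (a j) (\<gamma> (CC.pure (b j) d))) J"
proof -
  note bal = balanced_cointegral_left[OF assms(3)]
  have "lift TP (\<lambda>x y. ract TP x (\<gamma> (CC.pure y d))) (finsum CC.TP (\<lambda>j. CC.pure (a j) (b j)) J) =
      finsum TP (\<lambda>j. lift TP (\<lambda>x y. ract TP x (\<gamma> (CC.pure y d))) (CC.pure (a j) (b j))) J"
    by (rule add_map_finsum[OF CC.abelian_group_tensor abelian_group_tensor
          CC.lift_add_map[OF abelian_group_tensor bal]])
      (use assms in \<open>auto intro!: CC.tens_closed\<close>)
  also have "\<dots> = finsum TP (\<lambda>j. ract TP (a j) (\<gamma> (CC.pure (b j) d))) J"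
    by (rule TP.finsum_cong')
      (use assms in \<open>auto simp: Pi_iff CC.lift_tens[OF abelian_group_tensor bal] pure_closed CC.M_rules\<close>)
  finally show ?thesis .
qed

lemma lift_cointegral_right:
  assumes "a \<in> J \<rightarrow> carrier TP" "b \<in> J \<rightarrow> carrier TP" "c \<in> carrier TP"
  shows "lift TP (\<lambda>x y. lact TP (\<gamma> (CC.pure c x)) y) (finsum CC.TP (\<lambda>j. CC.pure (a j) (b j)) J) =
    finsum TP (\<lambda>j. lact TP (\<gamma> (CC.pure c (a j))) (b j)) J"
proof -
  note bal = balanced_cointegral_right[OF assms(3)]
  have "lift TP (\<lambda>x y. lact TP (\<gamma> (CC.pure c x)) y) (finsum CC.TP (\<lambda>j. CC.pure (a j) (b j)) J) =
      finsum TP (\<lambda>j. lift TP (\<lambda>x y. lact TP (\<gamma> (CC.pure c x)) y) (CC.pure (a j) (b j))) J"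
    by (rule add_map_finsum[OF CC.abelian_group_tensor abelian_group_tensor
          CC.lift_add_map[OF abelian_group_tensor bal]])
      (use assms in \<open>auto intro!: CC.tens_closed\<close>)
  also have "\<dots> = finsum TP (\<lambda>j. lact TP (\<gamma> (CC.pure c (a j))) (b j)) J"
    by (rule TP.finsum_cong')
      (use assms in \<open>auto simp: Pi_iff CC.lift_tens[OF abelian_group_tensor bal] pure_closed CC.M_rules\<close>)
  finally show ?thesis .
qed

end

text \<open>Both defining identities of a cointegral are additive in every argument, so they only have
  to be checked on pure tensors.\<close>

lemma cointegralI:
  assumes \<gamma>: "add_map CC.TP R \<gamma>"
    and \<gamma>_lact: "\<And>r X. r \<in> carrier R \<Longrightarrow> X \<in> carrier CC.TP \<Longrightarrow> \<gamma> (lact CC.TP r X) = r \<otimes>\<^bsub>R\<^esub> \<gamma> X"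
    and \<gamma>_ract: "\<And>r X. r \<in> carrier R \<Longrightarrow> X \<in> carrier CC.TP \<Longrightarrow> \<gamma> (ract CC.TP X r) = \<gamma> X \<otimes>\<^bsub>R\<^esub> r"
    and \<Delta>: "add_map TP CC.TP \<Delta>"
    and \<epsilon>: "add_map TP R \<epsilon>"
    and \<Delta>_pure: "\<And>p q. p \<in> carrier M \<Longrightarrow> q \<in> carrier N \<Longrightarrow>
      \<Delta> (pure p q) = finsum CC.TP (\<lambda>j. CC.pure (a p q j) (b p q j)) J"
    and a: "\<And>p q j. p \<in> carrier M \<Longrightarrow> q \<in> carrier N \<Longrightarrow> j \<in> J \<Longrightarrow> a p q j \<in> carrier TP"
    and b: "\<And>p q j. p \<in> carrier M \<Longrightarrow> q \<in> carrier N \<Longrightarrow> j \<in> J \<Longrightarrow> b p q j \<in> carrier TP"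
    and colinear: "\<And>p q p' q'. p \<in> carrier M \<Longrightarrow> q \<in> carrier N \<Longrightarrow> p' \<in> carrier M \<Longrightarrow> q' \<in> carrier N \<Longrightarrow>
      finsum TP (\<lambda>j. ract TP (a p q j) (\<gamma> (CC.pure (b p q j) (pure p' q')))) J =
      finsum TP (\<lambda>j. lact TP (\<gamma> (CC.pure (pure p q) (a p' q' j))) (b p' q' j)) J"
    and counit: "\<And>p q. p \<in> carrier M \<Longrightarrow> q \<in> carrier N \<Longrightarrow>
      finsum R (\<lambda>j. \<gamma> (CC.pure (a p q j) (b p q j))) J = \<epsilon> (pure p q)"
  shows "cointegral R TP \<Delta> \<epsilon> \<gamma>"
proof -
  have \<gamma>s: "add_map CC.TP R \<gamma>"
      "\<forall>r\<in>carrier R. \<forall>X\<in>carrier CC.TP. \<gamma> (lact CC.TP r X) = r \<otimes>\<^bsub>R\<^esub> \<gamma> X"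
      "\<forall>r\<in>carrier R. \<forall>X\<in>carrier CC.TP. \<gamma> (ract CC.TP X r) = \<gamma> X \<otimes>\<^bsub>R\<^esub> r"
    using \<gamma> \<gamma>_lact \<gamma>_ract by auto
  define l where "l d = (\<lambda>x y. ract TP x (\<gamma> (CC.pure y d)))" for d
  define r where "r c = (\<lambda>x y. lact TP (\<gamma> (CC.pure c x)) y)" for c
  have app: "l d x y = ract TP x (\<gamma> (CC.pure y d))" "r c x y = lact TP (\<gamma> (CC.pure c x)) y"
    for c d x y by (simp_all add: l_def r_def)
  have l: "balanced R TP TP TP (l d)" if "d \<in> carrier TP" for d
    unfolding l_def by (rule balanced_cointegral_left[OF \<gamma>s that])
  have r: "balanced R TP TP TP (r c)" if "c \<in> carrier TP" for c
    unfolding r_def by (rule balanced_cointegral_right[OF \<gamma>s that])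
  note lift = CC.lift_add_map[OF abelian_group_tensor]
  note lift_pure = CC.lift_tens[OF abelian_group_tensor]
  note \<Delta>c = add_map_closed[OF \<Delta>]
  \<comment> \<open>Here \<open>d\<close> sits inside the map being lifted, so
    \<open>lift_add_map\<close> says nothing about it; additivity in \<open>d\<close> is checked on
    pure tensors in place of \<open>X\<close>.\<close>
  have L: "add_map TP TP (\<lambda>d. lift TP (l d) X)" if X: "X \<in> carrier CC.TP" for X
  proof (rule add_mapI)
    fix d d' assume d: "d \<in> carrier TP" "d' \<in> carrier TP"
    note dd = TP.a_closed[OF d]
    show "lift TP (l d) X \<in> carrier TP" by (rule add_map_closed[OF lift[OF l[OF d(1)]] X])
    show "lift TP (l (d \<oplus>\<^bsub>TP\<^esub> d')) X = lift TP (l d) X \<oplus>\<^bsub>TP\<^esub> lift TP (l d') X"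
    proof (rule CC.add_map_ext[OF lift[OF l[OF dd]]
          add_map_plus[OF abelian_group_tensor lift[OF l[OF d(1)]] lift[OF l[OF d(2)]]] _ X])
      fix x y assume "x \<in> carrier TP" "y \<in> carrier TP"
      with d dd show "lift TP (l (d \<oplus>\<^bsub>TP\<^esub> d')) (CC.pure x y) =
          lift TP (l d) (CC.pure x y) \<oplus>\<^bsub>TP\<^esub> lift TP (l d') (CC.pure x y)"
        by (simp add: lift_pure[OF l] app add_map_add[OF add_map_pure_right[OF \<gamma>s]]
            pure_closed[OF \<gamma>s] CC.M_rules)
    qed
  qed
  have R: "add_map TP TP (\<lambda>c. lift TP (r c) X)" if X: "X \<in> carrier CC.TP" for X
  proof (rule add_mapI)
    fix d d' assume d: "d \<in> carrier TP" "d' \<in> carrier TP"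
    note dd = TP.a_closed[OF d]
    show "lift TP (r d) X \<in> carrier TP" by (rule add_map_closed[OF lift[OF r[OF d(1)]] X])
    show "lift TP (r (d \<oplus>\<^bsub>TP\<^esub> d')) X = lift TP (r d) X \<oplus>\<^bsub>TP\<^esub> lift TP (r d') X"
    proof (rule CC.add_map_ext[OF lift[OF r[OF dd]]
          add_map_plus[OF abelian_group_tensor lift[OF r[OF d(1)]] lift[OF r[OF d(2)]]] _ X])
      fix x y assume "x \<in> carrier TP" "y \<in> carrier TP"
      with d dd show "lift TP (r (d \<oplus>\<^bsub>TP\<^esub> d')) (CC.pure x y) =
          lift TP (r d) (CC.pure x y) \<oplus>\<^bsub>TP\<^esub> lift TP (r d') (CC.pure x y)"
        by (simp add: lift_pure[OF r] app add_map_add[OF add_map_pure_left[OF \<gamma>s]]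
            pure_closed[OF \<gamma>s] CC.M_rules)
    qed
  qed
  \<comment> \<open>The two arguments are made pure one after the other: \<open>c\<close> with
    \<open>d\<close> arbitrary, then \<open>d\<close>. The additivity facts \<open>L\<close> and
    \<open>R\<close> are what permit this for the argument hidden in the lifted map.\<close>
  have main: "lift TP (l d) (\<Delta> c) = lift TP (r c) (\<Delta> d)"
    if c: "c \<in> carrier TP" and d: "d \<in> carrier TP" for c d
  proof (rule add_map_ext[OF add_map_comp[OF \<Delta> lift[OF l[OF d]]] R[OF \<Delta>c[OF d]] _ c])
    fix p q assume p: "p \<in> carrier M" "q \<in> carrier N"
    note pq = tens_closed[OF p]
    show "lift TP (l d) (\<Delta> (pure p q)) = lift TP (r (pure p q)) (\<Delta> d)"
    proof (rule add_map_ext[OF L[OF \<Delta>c[OF pq]] add_map_comp[OF \<Delta> lift[OF r[OF pq]]] _ d])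
      fix p' q' assume p': "p' \<in> carrier M" "q' \<in> carrier N"
      note J = a[OF p] b[OF p] a[OF p'] b[OF p']
      have "lift TP (l (pure p' q')) (\<Delta> (pure p q)) =
          finsum TP (\<lambda>j. ract TP (a p q j) (\<gamma> (CC.pure (b p q j) (pure p' q')))) J"
        unfolding l_def \<Delta>_pure[OF p]
        by (rule lift_cointegral_left[OF \<gamma>s]) (use J tens_closed[OF p'] in auto)
      also have "\<dots> = finsum TP (\<lambda>j. lact TP (\<gamma> (CC.pure (pure p q) (a p' q' j))) (b p' q' j)) J"
        by (rule colinear[OF p p'])
      also have "\<dots> = lift TP (r (pure p q)) (\<Delta> (pure p' q'))"
        unfolding r_def \<Delta>_pure[OF p']
        by (rule lift_cointegral_right[OF \<gamma>s, symmetric]) (use J pq in auto)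
      finally show "lift TP (l (pure p' q')) (\<Delta> (pure p q)) = \<dots>" .
    qed
  qed
  have "\<gamma> (\<Delta> c) = \<epsilon> c" if c: "c \<in> carrier TP" for c
  proof (rule add_map_ext[OF add_map_comp[OF \<Delta> \<gamma>] \<epsilon> _ c])
    fix p q assume p: "p \<in> carrier M" "q \<in> carrier N"
    have "\<gamma> (\<Delta> (pure p q)) = finsum R (\<lambda>j. \<gamma> (CC.pure (a p q j) (b p q j))) J"
      unfolding \<Delta>_pure[OF p]
      by (rule add_map_finsum[OF CC.abelian_group_tensor abelian_group_base \<gamma>])
        (use a[OF p] b[OF p] in \<open>auto intro!: CC.tens_closed\<close>)
    then show "\<gamma> (\<Delta> (pure p q)) = \<epsilon> (pure p q)" by (simp add: counit p)
  qed
  then show ?thesis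
    using main \<gamma> \<gamma>_lact \<gamma>_ract by (auto simp: cointegral_def Let_def l_def r_def add_map_def)
qed

end

subsection \<open>Dual modules and the endomorphism ring\<close>

locale bimodule_pair =
  fixes A :: "('a, 'x) ring_scheme" and B :: "('b, 'y) ring_scheme" and M :: "('b, 'a, 'm) bimod"
  assumes bimodule: "bimodule B A M"
begin

text \<open>\<open>D\<close> is the right dual \<open>M*\<close>, \<open>L\<close> the left dual;
  \<open>SB\<close> and \<open>BS\<close> are \<open>S\<close> with its right, respectively left,
  action restricted along \<open>B \<rightarrow> S\<close>.\<close>

abbreviation "D \<equiv> rdual A M"
abbreviation "L \<equiv> ldual B M"
abbreviation "S \<equiv> endo_ring A M"
abbreviation "SB \<equiv> endo_SB A M"
abbreviation "BS \<equiv> endo_BS A M"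

sublocale A: ring A using bimodule by (rule bimoduleD)
sublocale B: ring B using bimodule by (rule bimoduleD)
sublocale M: abelian_group M using bimodule by (rule bimoduleD)

lemmas M_rules = bimodule_rules[OF bimodule]

lemma add_map_restrict: "add_map M G (restrict F (carrier M)) = add_map M G F"
  by (auto simp: add_map_def Pi_def)

lemma add_map_minus:
  assumes "abelian_group G" "add_map M G F"
  shows "add_map M G (\<lambda>x. \<ominus>\<^bsub>G\<^esub> F x)"
proof -
  interpret G: abelian_group G by fact
  show ?thesis
    by (rule add_mapI) (simp_all add: add_map_closed[OF assms(2)] add_map_add[OF assms(2)] G.minus_add)
qed

lemma add_map_const_zero: "abelian_group G \<Longrightarrow> add_map M G (\<lambda>x. \<zero>\<^bsub>G\<^esub>)"
  by (rule add_mapI) (simp_all add: abelian_group.axioms abelian_monoid.l_zero abelian_monoid.zero_closed)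

section \<open>The right dual\<close>

lemma rdual_iff:
  "f \<in> carrier D \<longleftrightarrow> f \<in> extensional (carrier M) \<and> add_map M A f \<and>
    (\<forall>x\<in>carrier M. \<forall>a\<in>carrier A. f (ract M x a) = f x \<otimes>\<^bsub>A\<^esub> a)"
  by (auto simp: rdual_def add_map_def PiE_def)

lemma rdualD:
  assumes "f \<in> carrier D"
  shows "add_map M A f"
    and "x \<in> carrier M \<Longrightarrow> f x \<in> carrier A"
    and "x \<in> carrier M \<Longrightarrow> y \<in> carrier M \<Longrightarrow> f (x \<oplus>\<^bsub>M\<^esub> y) = f x \<oplus>\<^bsub>A\<^esub> f y"
    and "x \<in> carrier M \<Longrightarrow> a \<in> carrier A \<Longrightarrow> f (ract M x a) = f x \<otimes>\<^bsub>A\<^esub> a"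
  using assms add_map_closed[of M A f] add_map_add[of M A f] by (simp_all add: rdual_iff)

lemma rdual_app:
  assumes "x \<in> carrier M"
  shows "(f \<oplus>\<^bsub>D\<^esub> g) x = f x \<oplus>\<^bsub>A\<^esub> g x" "\<zero>\<^bsub>D\<^esub> x = \<zero>\<^bsub>A\<^esub>"
    "lact D a f x = a \<otimes>\<^bsub>A\<^esub> f x" "ract D f b x = f (lact M b x)"
  using assms by (simp_all add: rdual_def)

text \<open>Elements of the dual have a fixed default value outside \<open>carrier M\<close>, so
  agreement on the carrier is equality. The left dual and \<open>S\<close> follow the same
  pattern.\<close>

lemma rdual_ext:
  "f \<in> carrier D \<Longrightarrow> g \<in> carrier D \<Longrightarrow> (\<And>x. x \<in> carrier M \<Longrightarrow> f x = g x) \<Longrightarrow> f = g"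
  by (rule extensionalityI) (auto simp: rdual_iff)

lemma rdual_closed:
  shows "f \<in> carrier D \<Longrightarrow> g \<in> carrier D \<Longrightarrow> f \<oplus>\<^bsub>D\<^esub> g \<in> carrier D"
    and "\<zero>\<^bsub>D\<^esub> \<in> carrier D"
    and "f \<in> carrier D \<Longrightarrow> (\<lambda>x\<in>carrier M. \<ominus>\<^bsub>A\<^esub> f x) \<in> carrier D"
    and "a \<in> carrier A \<Longrightarrow> f \<in> carrier D \<Longrightarrow> lact D a f \<in> carrier D"
    and "b \<in> carrier B \<Longrightarrow> f \<in> carrier D \<Longrightarrow> ract D f b \<in> carrier D"
proof -
  note A = A.abelian_group_axioms
  have eq: "f \<oplus>\<^bsub>D\<^esub> g = (\<lambda>x\<in>carrier M. f x \<oplus>\<^bsub>A\<^esub> g x)" "\<zero>\<^bsub>D\<^esub> = (\<lambda>x\<in>carrier M. \<zero>\<^bsub>A\<^esub>)"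
      "lact D a f = (\<lambda>x\<in>carrier M. a \<otimes>\<^bsub>A\<^esub> f x)" "ract D f b = (\<lambda>x\<in>carrier M. f (lact M b x))"
    for f g a b by (simp_all add: rdual_def)
  show "f \<in> carrier D \<Longrightarrow> g \<in> carrier D \<Longrightarrow> f \<oplus>\<^bsub>D\<^esub> g \<in> carrier D"
    unfolding eq
    by (simp add: rdual_iff add_map_restrict add_map_plus A A.l_distr M_rules add_map_closed[of M A])
  show "\<zero>\<^bsub>D\<^esub> \<in> carrier D"
    unfolding eq by (simp add: rdual_iff add_map_restrict add_map_const_zero A M_rules)
  show "f \<in> carrier D \<Longrightarrow> (\<lambda>x\<in>carrier M. \<ominus>\<^bsub>A\<^esub> f x) \<in> carrier D"
    by (simp add: rdual_iff add_map_restrict add_map_minus A M_rules A.l_minus add_map_closed[of M A])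
  show "a \<in> carrier A \<Longrightarrow> f \<in> carrier D \<Longrightarrow> lact D a f \<in> carrier D"
    unfolding eq
    by (simp add: rdual_iff add_map_restrict M_rules A.m_assoc add_map_closed[of M A]
        add_map_comp[OF _ add_map_mult_left[OF A.ring_axioms]])
  show "b \<in> carrier B \<Longrightarrow> f \<in> carrier D \<Longrightarrow> ract D f b \<in> carrier D"
    unfolding eq
    by (simp add: rdual_iff add_map_restrict M_rules add_map_comp[OF add_map_lact[OF bimodule]])
qed

lemma bimodule_rdual: "bimodule A B D"
proof -
  have "abelian_group D"
  proof (rule abelian_groupI)
    fix f assume f: "f \<in> carrier D"
    then have "(\<lambda>x\<in>carrier M. \<ominus>\<^bsub>A\<^esub> f x) \<oplus>\<^bsub>D\<^esub> f = \<zero>\<^bsub>D\<^esub>"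
      by (intro rdual_ext rdual_closed) (simp_all add: rdual_app A.l_neg rdualD)
    then show "\<exists>g\<in>carrier D. g \<oplus>\<^bsub>D\<^esub> f = \<zero>\<^bsub>D\<^esub>" using f rdual_closed(3) by blast
  qed (auto intro!: rdual_closed rdual_ext simp: rdual_app rdualD A.a_ac)
  then show ?thesis
    unfolding bimodule_def
    by (auto intro!: rdual_closed rdual_ext A.a_closed A.m_closed B.a_closed B.m_closed
        A.ring_axioms B.ring_axioms simp: rdual_app rdualD M_rules A.l_distr A.r_distr A.m_assoc)
qed

section \<open>The left dual\<close>

lemma ldual_iff:
  "f \<in> carrier L \<longleftrightarrow> f \<in> extensional (carrier M) \<and> add_map M B f \<and>
    (\<forall>x\<in>carrier M. \<forall>b\<in>carrier B. f (lact M b x) = b \<otimes>\<^bsub>B\<^esub> f x)"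
  by (auto simp: ldual_def add_map_def PiE_def)

lemma ldualD:
  assumes "f \<in> carrier L"
  shows "add_map M B f"
    and "x \<in> carrier M \<Longrightarrow> f x \<in> carrier B"
    and "x \<in> carrier M \<Longrightarrow> y \<in> carrier M \<Longrightarrow> f (x \<oplus>\<^bsub>M\<^esub> y) = f x \<oplus>\<^bsub>B\<^esub> f y"
    and "x \<in> carrier M \<Longrightarrow> b \<in> carrier B \<Longrightarrow> f (lact M b x) = b \<otimes>\<^bsub>B\<^esub> f x"
  using assms add_map_closed[of M B f] add_map_add[of M B f] by (simp_all add: ldual_iff)

lemma ldual_app:
  assumes "x \<in> carrier M"
  shows "(f \<oplus>\<^bsub>L\<^esub> g) x = f x \<oplus>\<^bsub>B\<^esub> g x" "\<zero>\<^bsub>L\<^esub> x = \<zero>\<^bsub>B\<^esub>"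
    "lact L a f x = f (ract M x a)" "ract L f b x = f x \<otimes>\<^bsub>B\<^esub> b"
  using assms by (simp_all add: ldual_def)

lemma ldual_ext:
  "f \<in> carrier L \<Longrightarrow> g \<in> carrier L \<Longrightarrow> (\<And>x. x \<in> carrier M \<Longrightarrow> f x = g x) \<Longrightarrow> f = g"
  by (rule extensionalityI) (auto simp: ldual_iff)

lemma ldual_closed:
  shows "f \<in> carrier L \<Longrightarrow> g \<in> carrier L \<Longrightarrow> f \<oplus>\<^bsub>L\<^esub> g \<in> carrier L"
    and "\<zero>\<^bsub>L\<^esub> \<in> carrier L"
    and "f \<in> carrier L \<Longrightarrow> (\<lambda>x\<in>carrier M. \<ominus>\<^bsub>B\<^esub> f x) \<in> carrier L"
    and "a \<in> carrier A \<Longrightarrow> f \<in> carrier L \<Longrightarrow> lact L a f \<in> carrier L"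
    and "b \<in> carrier B \<Longrightarrow> f \<in> carrier L \<Longrightarrow> ract L f b \<in> carrier L"
proof -
  note B = B.abelian_group_axioms
  have eq: "f \<oplus>\<^bsub>L\<^esub> g = (\<lambda>x\<in>carrier M. f x \<oplus>\<^bsub>B\<^esub> g x)" "\<zero>\<^bsub>L\<^esub> = (\<lambda>x\<in>carrier M. \<zero>\<^bsub>B\<^esub>)"
      "lact L a f = (\<lambda>x\<in>carrier M. f (ract M x a))" "ract L f b = (\<lambda>x\<in>carrier M. f x \<otimes>\<^bsub>B\<^esub> b)"
    for f g a b by (simp_all add: ldual_def)
  show "f \<in> carrier L \<Longrightarrow> g \<in> carrier L \<Longrightarrow> f \<oplus>\<^bsub>L\<^esub> g \<in> carrier L"
    unfolding eq
    by (simp add: ldual_iff add_map_restrict add_map_plus B B.r_distr M_rules add_map_closed[of M B])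
  show "\<zero>\<^bsub>L\<^esub> \<in> carrier L"
    unfolding eq by (simp add: ldual_iff add_map_restrict add_map_const_zero B M_rules)
  show "f \<in> carrier L \<Longrightarrow> (\<lambda>x\<in>carrier M. \<ominus>\<^bsub>B\<^esub> f x) \<in> carrier L"
    by (simp add: ldual_iff add_map_restrict add_map_minus B M_rules B.r_minus add_map_closed[of M B])
  show "a \<in> carrier A \<Longrightarrow> f \<in> carrier L \<Longrightarrow> lact L a f \<in> carrier L"
    unfolding eq
    by (simp add: ldual_iff add_map_restrict M_rules add_map_comp[OF add_map_ract[OF bimodule]]
        flip: M_rules(11))
  show "b \<in> carrier B \<Longrightarrow> f \<in> carrier L \<Longrightarrow> ract L f b \<in> carrier L"
    unfolding eq
    by (simp add: ldual_iff add_map_restrict M_rules B.m_assoc add_map_closed[of M B]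
        add_map_comp[OF _ add_map_mult_right[OF B.ring_axioms]])
qed

lemma bimodule_ldual: "bimodule A B L"
proof -
  have "abelian_group L"
  proof (rule abelian_groupI)
    fix f assume f: "f \<in> carrier L"
    then have "(\<lambda>x\<in>carrier M. \<ominus>\<^bsub>B\<^esub> f x) \<oplus>\<^bsub>L\<^esub> f = \<zero>\<^bsub>L\<^esub>"
      by (intro ldual_ext ldual_closed) (simp_all add: ldual_app B.l_neg ldualD)
    then show "\<exists>g\<in>carrier L. g \<oplus>\<^bsub>L\<^esub> f = \<zero>\<^bsub>L\<^esub>" using f ldual_closed(3) by blast
  qed (auto intro!: ldual_closed ldual_ext simp: ldual_app ldualD B.a_ac)
  then show ?thesis
    unfolding bimodule_def
    by (auto intro!: ldual_closed ldual_ext A.a_closed A.m_closed B.a_closed B.m_closed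
        A.ring_axioms B.ring_axioms simp: ldual_app ldualD M_rules B.l_distr B.r_distr B.m_assoc)
qed

section \<open>The endomorphism ring\<close>

lemma endo_iff:
  "f \<in> carrier S \<longleftrightarrow> f \<in> extensional (carrier M) \<and> add_map M M f \<and>
    (\<forall>x\<in>carrier M. \<forall>a\<in>carrier A. f (ract M x a) = ract M (f x) a)"
  by (auto simp: endo_ring_def add_map_def PiE_def)

lemma endoD:
  assumes "f \<in> carrier S"
  shows "add_map M M f"
    and "x \<in> carrier M \<Longrightarrow> f x \<in> carrier M"
    and "x \<in> carrier M \<Longrightarrow> y \<in> carrier M \<Longrightarrow> f (x \<oplus>\<^bsub>M\<^esub> y) = f x \<oplus>\<^bsub>M\<^esub> f y"
    and "x \<in> carrier M \<Longrightarrow> a \<in> carrier A \<Longrightarrow> f (ract M x a) = ract M (f x) a"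
  using assms add_map_closed[of M M f] add_map_add[of M M f] by (simp_all add: endo_iff)

lemma endo_app:
  assumes "x \<in> carrier M"
  shows "(f \<oplus>\<^bsub>S\<^esub> g) x = f x \<oplus>\<^bsub>M\<^esub> g x" "\<zero>\<^bsub>S\<^esub> x = \<zero>\<^bsub>M\<^esub>"
    "(f \<otimes>\<^bsub>S\<^esub> g) x = f (g x)" "\<one>\<^bsub>S\<^esub> x = x"
    "ract SB f b x = f (lact M b x)" "lact BS b f x = lact M b (f x)"
  using assms by (simp_all add: endo_ring_def endo_SB_def endo_BS_def)

lemma endo_ext:
  "f \<in> carrier S \<Longrightarrow> g \<in> carrier S \<Longrightarrow> (\<And>x. x \<in> carrier M \<Longrightarrow> f x = g x) \<Longrightarrow> f = g"
  by (rule extensionalityI) (auto simp: endo_iff)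

lemma endo_closed:
  shows "f \<in> carrier S \<Longrightarrow> g \<in> carrier S \<Longrightarrow> f \<oplus>\<^bsub>S\<^esub> g \<in> carrier S"
    and "\<zero>\<^bsub>S\<^esub> \<in> carrier S"
    and "f \<in> carrier S \<Longrightarrow> (\<lambda>x\<in>carrier M. \<ominus>\<^bsub>M\<^esub> f x) \<in> carrier S"
    and "f \<in> carrier S \<Longrightarrow> g \<in> carrier S \<Longrightarrow> f \<otimes>\<^bsub>S\<^esub> g \<in> carrier S"
    and "\<one>\<^bsub>S\<^esub> \<in> carrier S"
    and "b \<in> carrier B \<Longrightarrow> f \<in> carrier S \<Longrightarrow> ract SB f b \<in> carrier S"
    and "b \<in> carrier B \<Longrightarrow> f \<in> carrier S \<Longrightarrow> lact BS b f \<in> carrier S"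
proof -
  note M = M.abelian_group_axioms
  \<comment> \<open>Makes the negative of an endomorphism right \<open>A\<close>-linear; it follows
    from uniqueness of additive inverses.\<close>
  have minus: "\<ominus>\<^bsub>M\<^esub> (ract M x a) = ract M (\<ominus>\<^bsub>M\<^esub> x) a" if "x \<in> carrier M" "a \<in> carrier A" for x a
  proof (rule M.minus_equality)
    have "ract M (\<ominus>\<^bsub>M\<^esub> x) a \<oplus>\<^bsub>M\<^esub> ract M x a = ract M \<zero>\<^bsub>M\<^esub> a"
      using that by (simp add: M.l_neg flip: M_rules(7))
    also have "\<dots> = \<zero>\<^bsub>M\<^esub>"
      by (rule add_map_zero[OF M M add_map_ract[OF bimodule that(2)]])
    finally show "ract M (\<ominus>\<^bsub>M\<^esub> x) a \<oplus>\<^bsub>M\<^esub> ract M x a = \<zero>\<^bsub>M\<^esub>" .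
  qed (use that in \<open>simp_all add: M_rules\<close>)
  have eq: "f \<oplus>\<^bsub>S\<^esub> g = (\<lambda>x\<in>carrier M. f x \<oplus>\<^bsub>M\<^esub> g x)" "\<zero>\<^bsub>S\<^esub> = (\<lambda>x\<in>carrier M. \<zero>\<^bsub>M\<^esub>)"
      "f \<otimes>\<^bsub>S\<^esub> g = (\<lambda>x\<in>carrier M. f (g x))" "\<one>\<^bsub>S\<^esub> = (\<lambda>x\<in>carrier M. x)"
      "ract SB f b = (\<lambda>x\<in>carrier M. f (lact M b x))" "lact BS b f = (\<lambda>x\<in>carrier M. lact M b (f x))"
    for f g b by (simp_all add: endo_ring_def endo_SB_def endo_BS_def)
  show "f \<in> carrier S \<Longrightarrow> g \<in> carrier S \<Longrightarrow> f \<oplus>\<^bsub>S\<^esub> g \<in> carrier S"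
    unfolding eq
    by (simp add: endo_iff add_map_restrict add_map_plus M M_rules add_map_closed[of M M])
  show "\<zero>\<^bsub>S\<^esub> \<in> carrier S"
    unfolding eq
    by (simp add: endo_iff add_map_restrict add_map_const_zero M M_rules
        add_map_zero[OF M M add_map_ract[OF bimodule]])
  show "f \<in> carrier S \<Longrightarrow> (\<lambda>x\<in>carrier M. \<ominus>\<^bsub>M\<^esub> f x) \<in> carrier S"
    by (simp add: endo_iff add_map_restrict add_map_minus M M_rules minus add_map_closed[of M M])
  show "f \<in> carrier S \<Longrightarrow> g \<in> carrier S \<Longrightarrow> f \<otimes>\<^bsub>S\<^esub> g \<in> carrier S"
    unfolding eq
    by (simp add: endo_iff add_map_restrict M_rules add_map_closed[of M M] add_map_comp[of M M _ M])
  show "\<one>\<^bsub>S\<^esub> \<in> carrier S"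
    unfolding eq by (simp add: endo_iff add_map_restrict M_rules add_map_id)
  show "b \<in> carrier B \<Longrightarrow> f \<in> carrier S \<Longrightarrow> ract SB f b \<in> carrier S"
    unfolding eq
    by (simp add: endo_iff add_map_restrict M_rules add_map_comp[OF add_map_lact[OF bimodule]])
  show "b \<in> carrier B \<Longrightarrow> f \<in> carrier S \<Longrightarrow> lact BS b f \<in> carrier S"
    unfolding eq
    by (simp add: endo_iff add_map_restrict M_rules add_map_closed[of M M]
        add_map_comp[OF _ add_map_lact[OF bimodule]])
qed

lemma abelian_group_endo: "abelian_group S"
proof (rule abelian_groupI)
  fix f assume f: "f \<in> carrier S"
  then have "(\<lambda>x\<in>carrier M. \<ominus>\<^bsub>M\<^esub> f x) \<oplus>\<^bsub>S\<^esub> f = \<zero>\<^bsub>S\<^esub>"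
    by (intro endo_ext endo_closed) (simp_all add: endo_app M.l_neg endoD)
  then show "\<exists>g\<in>carrier S. g \<oplus>\<^bsub>S\<^esub> f = \<zero>\<^bsub>S\<^esub>" using f endo_closed(3) by blast
qed (auto intro!: endo_closed endo_ext simp: endo_app endoD M.a_ac)

lemma ring_endo: "ring S"
proof (rule ringI)
  show "abelian_group S" by (rule abelian_group_endo)
  show "monoid S"
    by (rule monoidI) (auto intro!: endo_closed endo_ext simp: endo_app endoD)
qed (auto intro!: endo_closed endo_ext simp: endo_app endoD)

sublocale S: ring S by (rule ring_endo)

lemma endo_bimodules_simps [simp]:
  "carrier SB = carrier S" "add SB = add S" "zero SB = zero S" "lact SB = mult S"
  "carrier BS = carrier S" "add BS = add S" "zero BS = zero S" "ract BS = mult S"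
  by (simp_all add: endo_SB_def endo_BS_def)

lemma bimodule_endo_SB: "bimodule S B SB"
proof -
  have "abelian_group SB"
    using abelian_group_endo abelian_groupE[OF abelian_group_endo] by (intro abelian_groupI) simp_all
  then show ?thesis
    unfolding bimodule_def
    by (auto intro!: endo_closed endo_ext B.a_closed B.m_closed S.ring_axioms B.ring_axioms
        simp: endo_app endoD M_rules)
qed

lemma bimodule_endo_BS: "bimodule B S BS"
proof -
  have "abelian_group BS"
    using abelian_group_endo abelian_groupE[OF abelian_group_endo] by (intro abelian_groupI) simp_all
  then show ?thesis
    unfolding bimodule_def
    by (auto intro!: endo_closed endo_ext B.a_closed B.m_closed S.ring_axioms B.ring_axioms
        simp: endo_app endoD M_rules)
qed

section \<open>Rank one endomorphisms\<close>

definition rank_one :: "'m \<Rightarrow> ('m \<Rightarrow> 'a) \<Rightarrow> 'm \<Rightarrow> 'm" where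
  "rank_one m g = (\<lambda>x\<in>carrier M. ract M m (g x))"

lemma rank_one_app: "x \<in> carrier M \<Longrightarrow> rank_one m g x = ract M m (g x)"
  by (simp add: rank_one_def)

lemma rank_one_closed: "m \<in> carrier M \<Longrightarrow> g \<in> carrier D \<Longrightarrow> rank_one m g \<in> carrier S"
  by (simp add: rank_one_def endo_iff rdualD add_map_restrict M_rules
      add_map_comp[OF rdualD(1) add_map_ract_scalar[OF bimodule]])

lemma add_map_rank_one_left: "g \<in> carrier D \<Longrightarrow> add_map M S (\<lambda>m. rank_one m g)"
  by (rule add_mapI)
    (auto intro!: endo_ext endo_closed rank_one_closed simp: endo_app rank_one_app M_rules rdualD)

lemma add_map_rank_one_right: "m \<in> carrier M \<Longrightarrow> add_map D S (rank_one m)"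
  by (rule add_mapI)
    (auto intro!: endo_ext endo_closed rank_one_closed rdual_closed
      simp: endo_app rank_one_app M_rules rdualD rdual_app)

text \<open>The \<open>A\<close>-balancing that lets \<open>rank_one\<close> stand for the map from
  \<open>M \<otimes>\<^sub>A M*\<close> to \<open>S\<close>.\<close>

lemma rank_one_ract:
  "m \<in> carrier M \<Longrightarrow> a \<in> carrier A \<Longrightarrow> g \<in> carrier D \<Longrightarrow>
    rank_one (ract M m a) g = rank_one m (lact D a g)"
  by (auto intro!: endo_ext rank_one_closed rdual_closed M_rules simp: rank_one_app M_rules rdualD rdual_app)

text \<open>With its mirror below, this is \<open>B\<close>-bilinearity of that map. It converts
  balancing conditions over \<open>B\<close> between \<open>M\<close>, \<open>D\<close> and the two
  copies of \<open>S\<close>.\<close>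

lemma rank_one_lact_base:
  "m \<in> carrier M \<Longrightarrow> b \<in> carrier B \<Longrightarrow> g \<in> carrier D \<Longrightarrow>
    rank_one (lact M b m) g = lact BS b (rank_one m g)"
  by (auto intro!: endo_ext endo_closed rank_one_closed simp: rank_one_app M_rules rdualD endo_app)

lemma rank_one_ract_base:
  "m \<in> carrier M \<Longrightarrow> b \<in> carrier B \<Longrightarrow> g \<in> carrier D \<Longrightarrow>
    rank_one m (ract D g b) = ract SB (rank_one m g) b"
  by (auto intro!: endo_ext endo_closed rank_one_closed rdual_closed
      simp: rank_one_app M_rules rdualD endo_app rdual_app)

end

section \<open>The right action of \<open>S\<close> on the dual module\<close>

context bimodule_pair
begin

sublocale C: tensor_coring A B D M
  by unfold_locales (rule bimodule_rdual bimodule)+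

sublocale SW: tensor_coring S B SB BS
  by unfold_locales (rule bimodule_endo_SB bimodule_endo_BS)+

text \<open>Precomposition makes \<open>M*\<close> a right \<open>S\<close>-module; restricting it
  along \<open>B \<rightarrow> S\<close> gives back the right \<open>B\<close>-action of
  \<open>D\<close>.\<close>

definition dual_comp :: "('m \<Rightarrow> 'a) \<Rightarrow> ('m \<Rightarrow> 'm) \<Rightarrow> 'm \<Rightarrow> 'a" where
  "dual_comp f s = (\<lambda>x\<in>carrier M. f (s x))"

lemma dual_comp_app: "x \<in> carrier M \<Longrightarrow> dual_comp f s x = f (s x)"
  by (simp add: dual_comp_def)

lemma dual_comp_closed: "f \<in> carrier D \<Longrightarrow> s \<in> carrier S \<Longrightarrow> dual_comp f s \<in> carrier D"
  using add_map_comp[OF endoD(1)[of s] rdualD(1)[of f]]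
  by (simp add: dual_comp_def rdual_iff add_map_restrict M_rules endo_iff add_map_closed[of M M])

lemma add_map_dual_comp_left: "s \<in> carrier S \<Longrightarrow> add_map D D (\<lambda>f. dual_comp f s)"
  by (rule add_mapI)
    (auto intro!: rdual_ext rdual_closed dual_comp_closed simp: dual_comp_app rdual_app endoD)

lemma add_map_dual_comp_right: "f \<in> carrier D \<Longrightarrow> add_map S D (dual_comp f)"
  by (rule add_mapI)
    (auto intro!: rdual_ext rdual_closed endo_closed dual_comp_closed
      simp: dual_comp_app rdual_app rdualD endo_app endoD)

lemma dual_comp_lact:
  "a \<in> carrier A \<Longrightarrow> f \<in> carrier D \<Longrightarrow> s \<in> carrier S \<Longrightarrow> dual_comp (lact D a f) s = lact D a (dual_comp f s)"
  by (auto intro!: rdual_ext rdual_closed dual_comp_closed simp: dual_comp_app rdual_app endoD)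

lemma dual_comp_ract:
  "b \<in> carrier B \<Longrightarrow> f \<in> carrier D \<Longrightarrow> s \<in> carrier S \<Longrightarrow>
    dual_comp f (ract SB s b) = ract D (dual_comp f s) b"
  by (auto intro!: rdual_ext rdual_closed endo_closed dual_comp_closed
      simp: dual_comp_app rdual_app endo_app M_rules)

lemma dual_comp_mult:
  "f \<in> carrier D \<Longrightarrow> s \<in> carrier S \<Longrightarrow> t \<in> carrier S \<Longrightarrow>
    dual_comp f (s \<otimes>\<^bsub>S\<^esub> t) = dual_comp (dual_comp f s) t"
  by (auto intro!: rdual_ext rdual_closed endo_closed dual_comp_closed
      simp: dual_comp_app endo_app endoD)

lemma dual_comp_one: "f \<in> carrier D \<Longrightarrow> dual_comp f \<one>\<^bsub>S\<^esub> = f"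
  by (auto intro!: rdual_ext endo_closed dual_comp_closed simp: dual_comp_app endo_app)

lemma add_map_rdual_eval: "x \<in> carrier M \<Longrightarrow> add_map D A (\<lambda>f. f x)"
  by (rule add_mapI) (simp_all add: rdual_app rdualD)

lemma add_map_endo_eval: "x \<in> carrier M \<Longrightarrow> add_map S M (\<lambda>s. s x)"
  by (rule add_mapI) (simp_all add: endo_app endoD)

end

section \<open>Expansions in the dual basis\<close>

locale dual_basis_bimodule = bimodule_pair A B M
  for A :: "('a, 'x) ring_scheme" and B :: "('b, 'y) ring_scheme" and M :: "('b, 'a, 'm) bimod" +
  fixes I :: "'i set" and e :: "'i \<Rightarrow> 'm" and es :: "'i \<Rightarrow> 'm \<Rightarrow> 'a"
  assumes dual_basis: "dual_basis A M I e es"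
begin

lemma dual_basisD:
  shows "finite I" "i \<in> I \<Longrightarrow> e i \<in> carrier M" "i \<in> I \<Longrightarrow> es i \<in> carrier D"
    and "m \<in> carrier M \<Longrightarrow> finsum M (\<lambda>i. ract M (e i) (es i m)) I = m"
  using dual_basis by (auto simp: dual_basis_def)

lemma add_map_expand:
  assumes "abelian_group G" "add_map M G F" "m \<in> carrier M"
  shows "F m = finsum G (\<lambda>i. F (ract M (e i) (es i m))) I"
proof -
  have "F m = F (finsum M (\<lambda>i. ract M (e i) (es i m)) I)" by (simp add: dual_basisD assms(3))
  also have "\<dots> = finsum G (\<lambda>i. F (ract M (e i) (es i m))) I"
    by (rule add_map_finsum[OF M.abelian_group_axioms assms(1,2)])
      (use assms(3) in \<open>simp add: Pi_iff M_rules rdualD dual_basisD\<close>)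
  finally show ?thesis .
qed

text \<open>The dual basis read from the other side: the \<open>es i\<close> generate
  \<open>M*\<close> as a left \<open>A\<close>-module, with coordinates the values at the
  \<open>e i\<close>. Evaluating at \<open>x\<close> reduces this to the expansion of
  \<open>x\<close>.\<close>

lemma rdual_expand:
  assumes f: "f \<in> carrier D"
  shows "finsum D (\<lambda>i. lact D (f (e i)) (es i)) I = f"
proof (rule rdual_ext[OF _ f])
  have c: "(\<lambda>i. lact D (f (e i)) (es i)) \<in> I \<rightarrow> carrier D"
    using f by (simp add: Pi_iff rdual_closed rdualD dual_basisD)
  then show "finsum D (\<lambda>i. lact D (f (e i)) (es i)) I \<in> carrier D"
    by (rule C.M.finsum_closed)
  fix x assume x: "x \<in> carrier M"
  have "finsum D (\<lambda>i. lact D (f (e i)) (es i)) I x = finsum A (\<lambda>i. lact D (f (e i)) (es i) x) I"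
    by (rule add_map_finsum[OF C.M.abelian_group_axioms A.abelian_group_axioms add_map_rdual_eval[OF x] c])
  also have "\<dots> = finsum A (\<lambda>i. f (ract M (e i) (es i x))) I"
    by (rule A.finsum_cong') (auto simp: rdual_app x f rdualD dual_basisD)
  also have "\<dots> = f x"
    by (rule add_map_expand[OF A.abelian_group_axioms rdualD(1)[OF f] x, symmetric])
  finally show "finsum D (\<lambda>i. lact D (f (e i)) (es i)) I x = f x" .
qed

text \<open>The identity of \<open>M\<close> is the sum of the rank one maps of the dual basis;
  composing it with \<open>s\<close> gives the claim. In particular \<open>S\<close> is additively
  generated by rank one maps.\<close>

lemma endo_expand:
  assumes s: "s \<in> carrier S"
  shows "finsum S (\<lambda>i. rank_one (s (e i)) (es i)) I = s"
proof (rule endo_ext[OF _ s])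
  have c: "(\<lambda>i. rank_one (s (e i)) (es i)) \<in> I \<rightarrow> carrier S"
    using s by (simp add: Pi_iff rank_one_closed endoD dual_basisD)
  then show "finsum S (\<lambda>i. rank_one (s (e i)) (es i)) I \<in> carrier S"
    by (rule S.finsum_closed)
  fix x assume x: "x \<in> carrier M"
  have "finsum S (\<lambda>i. rank_one (s (e i)) (es i)) I x = finsum M (\<lambda>i. rank_one (s (e i)) (es i) x) I"
    by (rule add_map_finsum[OF S.abelian_group_axioms M.abelian_group_axioms add_map_endo_eval[OF x] c])
  also have "\<dots> = finsum M (\<lambda>i. s (ract M (e i) (es i x))) I"
    by (rule M.finsum_cong') (auto simp: rank_one_app x s rdualD endoD dual_basisD M_rules)
  also have "\<dots> = s x"
    by (rule add_map_expand[OF M.abelian_group_axioms endoD(1)[OF s] x, symmetric])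
  finally show "finsum S (\<lambda>i. rank_one (s (e i)) (es i)) I x = s x" .
qed

text \<open>The canonical element of \<open>M \<otimes> M*\<close> commutes with \<open>S\<close>.\<close>

lemma dual_basis_central:
  assumes G: "abelian_group G" and K: "balanced A M D G K" and s: "s \<in> carrier S"
  shows "finsum G (\<lambda>i. K (s (e i)) (es i)) I = finsum G (\<lambda>i. K (e i) (dual_comp (es i) s)) I"
proof -
  interpret G: abelian_group G by (rule G)
  note Kc = balanced_closed[OF K] and cl = dual_basisD rdualD endoD rdual_closed M_rules s dual_comp_closed
  \<comment> \<open>Matrix argument: \<open>s (e i)\<close> has coordinates
    \<open>es l (s (e i))\<close>. Balancing moves them to the dual side, and after swapping the
    sums, summation over \<open>i\<close> reassembles \<open>es l\<close> composed with
    \<open>s\<close>.\<close>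
  have "finsum G (\<lambda>i. K (s (e i)) (es i)) I =
      finsum G (\<lambda>i. finsum G (\<lambda>l. K (e l) (lact D (es l (s (e i))) (es i))) I) I"
  proof (rule G.finsum_cong')
    fix i assume i: "i \<in> I"
    have "K (s (e i)) (es i) = finsum G (\<lambda>l. K (ract M (e l) (es l (s (e i)))) (es i)) I"
      by (rule add_map_expand[OF G balancedD(2)[OF K]]) (use i in \<open>simp_all add: cl\<close>)
    also have "\<dots> = finsum G (\<lambda>l. K (e l) (lact D (es l (s (e i))) (es i))) I"
      by (rule G.finsum_cong') (use i in \<open>simp_all add: cl balancedD(3)[OF K] Kc Pi_iff\<close>)
    finally show "K (s (e i)) (es i) = \<dots>" .
  qed (simp_all add: cl Kc Pi_iff G.finsum_closed)
  also have "\<dots> = finsum G (\<lambda>l. finsum G (\<lambda>i. K (e l) (lact D (es l (s (e i))) (es i))) I) I"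
    by (rule finsum_swap[OF G]) (simp_all add: cl Kc)
  also have "\<dots> = finsum G (\<lambda>l. K (e l) (dual_comp (es l) s)) I"
  proof (rule G.finsum_cong')
    fix l assume l: "l \<in> I"
    have "K (e l) (dual_comp (es l) s) =
        K (e l) (finsum D (\<lambda>i. lact D (dual_comp (es l) s (e i)) (es i)) I)"
      using l by (simp add: rdual_expand cl)
    also have "\<dots> = finsum G (\<lambda>i. K (e l) (lact D (dual_comp (es l) s (e i)) (es i))) I"
      by (rule add_map_finsum[OF C.M.abelian_group_axioms G balancedD(1)[OF K]])
        (use l in \<open>simp_all add: cl Pi_iff\<close>)
    also have "\<dots> = finsum G (\<lambda>i. K (e l) (lact D (es l (s (e i))) (es i))) I"
      by (rule G.finsum_cong') (use l in \<open>simp_all add: cl Pi_iff Kc dual_comp_app\<close>)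
    finally show "finsum G (\<lambda>i. K (e l) (lact D (es l (s (e i))) (es i))) I = K (e l) (dual_comp (es l) s)"
      by simp
  qed (simp_all add: cl Kc Pi_iff)
  finally show ?thesis .
qed

corollary dual_basis_central_base:
  assumes G: "abelian_group G" and K: "balanced A M D G K" and b: "b \<in> carrier B"
  shows "finsum G (\<lambda>i. K (lact M b (e i)) (es i)) I = finsum G (\<lambda>i. K (e i) (ract D (es i) b)) I"
proof -
  interpret G: abelian_group G by (rule G)
  \<comment> \<open>The image of \<open>b\<close> under \<open>B \<rightarrow> S\<close>.\<close>
  let ?s = "lact BS b \<one>\<^bsub>S\<^esub>"
  have s: "?s \<in> carrier S" by (rule endo_closed(7)[OF b endo_closed(5)])
  have "dual_comp (es i) ?s = ract D (es i) b" if "i \<in> I" for i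
    using that b s
    by (intro rdual_ext dual_comp_closed rdual_closed)
      (simp_all add: dual_comp_app rdual_app endo_app dual_basisD)
  moreover have "?s (e i) = lact M b (e i)" if "i \<in> I" for i
    using that by (simp add: endo_app dual_basisD)
  ultimately have "finsum G (\<lambda>i. K (lact M b (e i)) (es i)) I = finsum G (\<lambda>i. K (?s (e i)) (es i)) I"
      "finsum G (\<lambda>i. K (e i) (dual_comp (es i) ?s)) I = finsum G (\<lambda>i. K (e i) (ract D (es i) b)) I"
    using b by (auto intro!: G.finsum_cong' balanced_closed[OF K] rdual_closed M_rules simp: dual_basisD)
  then show ?thesis using dual_basis_central[OF G K s] by simp
qed

subsection \<open>The comatrix coring\<close>

text \<open>Makes the coproduct well defined. A scalar \<open>b\<close> travels from
  \<open>f\<close> to \<open>m\<close> in three moves: over the first tensor product onto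
  \<open>e i\<close>, across the dual basis by centrality onto \<open>es i\<close>, and over the
  last tensor product onto \<open>m\<close>.\<close>

lemma balanced_comatrix_comult:
  "balanced B D M C.CC.TP
    (\<lambda>f m. finsum C.CC.TP (\<lambda>i. C.CC.pure (C.pure f (e i)) (C.pure (es i) m)) I)"
proof (rule balancedI)
  note CC = C.CC.abelian_group_tensor
  fix f assume f: "f \<in> carrier D"
  show "add_map M C.CC.TP (\<lambda>m. finsum C.CC.TP (\<lambda>i. C.CC.pure (C.pure f (e i)) (C.pure (es i) m)) I)"
    by (rule add_map_finsum_fun[OF CC])
      (rule add_map_comp[OF C.tens_add_map_right C.CC.tens_add_map_right],
        simp_all add: C.tens_closed f dual_basisD)
next
  note CC = C.CC.abelian_group_tensor
  fix m assume m: "m \<in> carrier M"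
  show "add_map D C.CC.TP (\<lambda>f. finsum C.CC.TP (\<lambda>i. C.CC.pure (C.pure f (e i)) (C.pure (es i) m)) I)"
    by (rule add_map_finsum_fun[OF CC])
      (rule add_map_comp[OF C.tens_add_map_left C.CC.tens_add_map_left],
        simp_all add: C.tens_closed m dual_basisD)
next
  note CC = C.CC.abelian_group_tensor
  fix f b m assume f: "f \<in> carrier D" and b: "b \<in> carrier B" and m: "m \<in> carrier M"
  let ?K = "\<lambda>x g. C.CC.pure (C.pure f x) (C.pure g m)"
  have K: "balanced A M D C.CC.TP ?K"
  proof (rule balancedI)
    fix x assume "x \<in> carrier M"
    then show "add_map D C.CC.TP (?K x)"
      by (intro add_map_comp[OF C.tens_add_map_left C.CC.tens_add_map_right] C.tens_closed f m)
  next
    fix g assume "g \<in> carrier D"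
    then show "add_map M C.CC.TP (\<lambda>x. ?K x g)"
      by (intro add_map_comp[OF C.tens_add_map_right C.CC.tens_add_map_left] C.tens_closed f m)
  next
    fix x a g assume "x \<in> carrier M" "a \<in> carrier A" "g \<in> carrier D"
    then show "?K (ract M x a) g = ?K x (lact D a g)"
      by (simp add: C.CC.tens_balanced C.tens_closed f m flip: C.ract_tens C.lact_tens)
  qed
  have "finsum C.CC.TP (\<lambda>i. C.CC.pure (C.pure (ract D f b) (e i)) (C.pure (es i) m)) I =
      finsum C.CC.TP (\<lambda>i. ?K (lact M b (e i)) (es i)) I"
    by (rule C.CC.TP.finsum_cong')
      (auto simp: C.tens_balanced f b m dual_basisD M_rules C.tens_closed C.CC.tens_closed)
  also have "\<dots> = finsum C.CC.TP (\<lambda>i. ?K (e i) (ract D (es i) b)) I"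
    by (rule dual_basis_central_base[OF CC K b])
  also have "\<dots> = finsum C.CC.TP (\<lambda>i. C.CC.pure (C.pure f (e i)) (C.pure (es i) (lact M b m))) I"
    by (rule C.CC.TP.finsum_cong')
      (auto simp: C.tens_balanced f b m dual_basisD M_rules C.tens_closed C.CC.tens_closed)
  finally show "finsum C.CC.TP (\<lambda>i. C.CC.pure (C.pure (ract D f b) (e i)) (C.pure (es i) m)) I =
      finsum C.CC.TP (\<lambda>i. C.CC.pure (C.pure f (e i)) (C.pure (es i) (lact M b m))) I" .
qed

lemma comatrix_comult_eq:
  "comatrix_comult A B M I e es =
    lift C.CC.TP (\<lambda>f m. finsum C.CC.TP (\<lambda>i. C.CC.pure (C.pure f (e i)) (C.pure (es i) m)) I)"
  by (simp add: comatrix_comult_def comatrix_def fun_eq_iff)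

lemma add_map_comatrix_comult: "add_map C.TP C.CC.TP (comatrix_comult A B M I e es)"
  unfolding comatrix_comult_eq
  by (rule C.lift_add_map[OF C.CC.abelian_group_tensor balanced_comatrix_comult])

lemma comatrix_comult_pure:
  "f \<in> carrier D \<Longrightarrow> m \<in> carrier M \<Longrightarrow> comatrix_comult A B M I e es (C.pure f m) =
    finsum C.CC.TP (\<lambda>i. C.CC.pure (C.pure f (e i)) (C.pure (es i) m)) I"
  unfolding comatrix_comult_eq
  by (rule C.lift_tens[OF C.CC.abelian_group_tensor balanced_comatrix_comult])

lemma balanced_comatrix_counit: "balanced B D M A (\<lambda>f m. f m)"
  by (rule balancedI) (simp_all add: rdualD add_map_rdual_eval rdual_app)

lemma add_map_comatrix_counit: "add_map C.TP A (comatrix_counit A B M)"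
  using C.lift_add_map[OF A.abelian_group_axioms balanced_comatrix_counit]
  by (simp add: comatrix_counit_def[abs_def])

lemma comatrix_counit_pure:
  "f \<in> carrier D \<Longrightarrow> m \<in> carrier M \<Longrightarrow> comatrix_counit A B M (C.pure f m) = f m"
  using C.lift_tens[OF A.abelian_group_axioms balanced_comatrix_counit]
  by (simp add: comatrix_counit_def)

end

subsection \<open>Separable bimodules\<close>

context bimodule_pair
begin

sublocale ME: tensor_pair B A B M L
  by unfold_locales (rule bimodule bimodule_ldual)+

lemma add_map_ldual_eval: "x \<in> carrier M \<Longrightarrow> add_map L B (\<lambda>f. f x)"
  by (rule add_mapI) (simp_all add: ldual_app ldualD)

text \<open>If \<open>\<Sum> m \<otimes> \<phi>\<close> is the image of \<open>1\<close> under the splitting of the evaluation map, then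
  \<open>s \<mapsto> \<Sum> \<phi> (s m)\<close> is a bimodule retraction of \<open>B \<rightarrow> S\<close>.\<close>

lemma separable_retraction:
  assumes "separable_bimodule A B M"
  obtains \<psi> where "add_map S B \<psi>"
    and "\<And>b s. b \<in> carrier B \<Longrightarrow> s \<in> carrier S \<Longrightarrow> \<psi> (lact BS b s) = b \<otimes>\<^bsub>B\<^esub> \<psi> s"
    and "\<And>b s. b \<in> carrier B \<Longrightarrow> s \<in> carrier S \<Longrightarrow> \<psi> (ract SB s b) = \<psi> s \<otimes>\<^bsub>B\<^esub> b"
    and "\<psi> \<one>\<^bsub>S\<^esub> = \<one>\<^bsub>B\<^esub>"
proof -
  note B = B.abelian_group_axioms
  obtain \<sigma> where \<sigma>: "\<sigma> \<in> carrier B \<rightarrow> carrier ME.TP"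
    and \<sigma>_lact: "\<forall>b\<in>carrier B. \<forall>b'\<in>carrier B. \<sigma> (b \<otimes>\<^bsub>B\<^esub> b') = lact ME.TP b (\<sigma> b')"
    and \<sigma>_ract: "\<forall>b\<in>carrier B. \<forall>b'\<in>carrier B. \<sigma> (b \<otimes>\<^bsub>B\<^esub> b') = ract ME.TP (\<sigma> b) b'"
    and \<sigma>_ev: "\<forall>b\<in>carrier B. lift B (\<lambda>m f. f m) (\<sigma> b) = b"
    using assms unfolding separable_bimodule_def Let_def by blast
  define X where "X = \<sigma> \<one>\<^bsub>B\<^esub>"
  have X: "X \<in> carrier ME.TP" using \<sigma> by (auto simp: X_def)
  \<comment> \<open>Both sides equal \<open>\<sigma> b\<close>, by left and right linearity of
    \<open>\<sigma>\<close> applied to \<open>b\<close> times 1 and 1 times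
    \<open>b\<close>.\<close>
  have X_central: "lact ME.TP b X = ract ME.TP X b" if "b \<in> carrier B" for b
    using that \<sigma>_lact \<sigma>_ract unfolding X_def by (metis B.l_one B.one_closed B.r_one)
  \<comment> \<open>For fixed \<open>s\<close> this is evaluation after applying \<open>s\<close> to
    the \<open>M\<close>-factor; it is balanced over \<open>A\<close> because \<open>s\<close> is
    right \<open>A\<close>-linear.\<close>
  define k where "k s m \<phi> = \<phi> (s m)" for s :: "'m \<Rightarrow> 'm" and m and \<phi> :: "'m \<Rightarrow> 'b"
  have bal: "balanced A M L B (k s)" if s: "s \<in> carrier S" for s
    unfolding k_def
  proof (rule balancedI)
    fix x assume "x \<in> carrier M"
    then show "add_map L B (\<lambda>\<phi>. \<phi> (s x))" by (simp add: add_map_ldual_eval endoD s)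
  next
    fix \<phi> assume "\<phi> \<in> carrier L"
    then show "add_map M B (\<lambda>x. \<phi> (s x))" by (rule add_map_comp[OF endoD(1)[OF s] ldualD(1)])
  next
    fix x a \<phi> assume "x \<in> carrier M" "a \<in> carrier A" "\<phi> \<in> carrier L"
    with s show "\<phi> (s (ract M x a)) = lact L a \<phi> (s x)" by (simp add: endoD ldual_app)
  qed
  define \<psi> where "\<psi> s = lift B (k s) X" for s
  note lift = ME.lift_add_map[OF B bal] and lift_pure = ME.lift_tens[OF B bal]
  show thesis
  proof (rule that)
    show "add_map S B \<psi>"
    proof (rule add_mapI)
      fix s t assume s: "s \<in> carrier S" "t \<in> carrier S"
      show "\<psi> s \<in> carrier B" unfolding \<psi>_def by (rule add_map_closed[OF lift[OF s(1)] X])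
      note st = endo_closed(1)[OF s]
      show "\<psi> (s \<oplus>\<^bsub>S\<^esub> t) = \<psi> s \<oplus>\<^bsub>B\<^esub> \<psi> t" unfolding \<psi>_def
        by (rule ME.add_map_ext[OF lift[OF st] add_map_plus[OF B lift[OF s(1)] lift[OF s(2)]] _ X])
          (simp add: lift_pure s st k_def endo_app ldualD endoD)
    qed
  next
    fix b s assume b: "b \<in> carrier B" and s: "s \<in> carrier S"
    note bs = endo_closed(7)[OF b s] and sb = endo_closed(6)[OF b s]
    show "\<psi> (lact BS b s) = b \<otimes>\<^bsub>B\<^esub> \<psi> s" unfolding \<psi>_def
      by (rule ME.add_map_ext[OF lift[OF bs]
            add_map_comp[OF lift[OF s] add_map_mult_left[OF B.ring_axioms b]] _ X])
        (simp add: lift_pure s bs b k_def endo_app ldualD endoD)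
    \<comment> \<open>Precomposing \<open>s\<close> with \<open>b\<close> amounts to multiplying
      \<open>X\<close> by \<open>b\<close> from the left. Centrality moves \<open>b\<close> to the
      right, onto the functionals, where it multiplies their values.\<close>
    have "\<psi> (ract SB s b) = lift B (k s) (lact ME.TP b X)" unfolding \<psi>_def
      by (rule ME.add_map_ext[OF lift[OF sb]
            add_map_comp[OF ME.add_map_tensor_lact[OF b] lift[OF s]] _ X])
        (simp add: lift_pure ME.lact_tens s sb b M_rules, simp add: k_def endo_app)
    also have "\<dots> = lift B (k s) (ract ME.TP X b)" by (simp add: X_central b)
    also have "\<dots> = \<psi> s \<otimes>\<^bsub>B\<^esub> b" unfolding \<psi>_def
      by (rule ME.add_map_ext[OF add_map_comp[OF ME.add_map_tensor_ract[OF b] lift[OF s]]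
            add_map_comp[OF lift[OF s] add_map_mult_right[OF B.ring_axioms b]] _ X])
        (simp add: lift_pure ME.ract_tens s b ME.N_rules, simp add: k_def ldual_app endoD s)
    finally show "\<psi> (ract SB s b) = \<psi> s \<otimes>\<^bsub>B\<^esub> b" .
  next
    have ev: "balanced A M L B (\<lambda>m f. f m)"
      by (rule balancedI) (simp_all add: ldualD(1) add_map_ldual_eval ldual_app)
    have "\<psi> \<one>\<^bsub>S\<^esub> = lift B (\<lambda>m f. f m) X" unfolding \<psi>_def
      by (rule ME.add_map_ext[OF lift[OF endo_closed(5)] ME.lift_add_map[OF B ev] _ X])
        (simp add: lift_pure[OF endo_closed(5)] ME.lift_tens[OF B ev] k_def endo_app)
    then show "\<psi> \<one>\<^bsub>S\<^esub> = \<one>\<^bsub>B\<^esub>" using \<sigma>_ev by (simp add: X_def)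
  qed
qed

end

context dual_basis_bimodule
begin

theorem comatrix_coseparable:
  assumes "separable_bimodule A B M"
  shows "coseparable A (comatrix A B M) (comatrix_comult A B M I e es) (comatrix_counit A B M)"
proof -
  obtain \<psi> where \<psi>: "add_map S B \<psi>"
    and \<psi>_lact: "\<And>b s. b \<in> carrier B \<Longrightarrow> s \<in> carrier S \<Longrightarrow> \<psi> (lact BS b s) = b \<otimes>\<^bsub>B\<^esub> \<psi> s"
    and \<psi>_ract: "\<And>b s. b \<in> carrier B \<Longrightarrow> s \<in> carrier S \<Longrightarrow> \<psi> (ract SB s b) = \<psi> s \<otimes>\<^bsub>B\<^esub> b"
    and \<psi>_one: "\<psi> \<one>\<^bsub>S\<^esub> = \<one>\<^bsub>B\<^esub>"
    using separable_retraction[OF assms] by metis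
  \<comment> \<open>The functional \<open>f\<close> evaluated at the product of
    \<open>\<psi>\<close> of the middle endomorphism with \<open>n\<close>. Left and right
    \<open>B\<close>-linearity of \<open>\<psi>\<close> balance the left and right pair
    respectively.\<close>
  define h where "h f m g n = f (lact M (\<psi> (rank_one m g)) n)"
    for f :: "'m \<Rightarrow> 'a" and m g n
  note \<psi>c = add_map_closed[OF \<psi>]
  note A = A.abelian_group_axioms
  have \<psi>r: "\<psi> (rank_one m g) \<in> carrier B" if "m \<in> carrier M" "g \<in> carrier D" for m g
    by (rule \<psi>c[OF rank_one_closed[OF that]])
  have h1: "add_map D A (\<lambda>f. h f m g n)" if "m \<in> carrier M" "g \<in> carrier D" "n \<in> carrier M" for m g n
    unfolding h_def by (rule add_map_rdual_eval) (use that in \<open>simp add: M_rules \<psi>r\<close>)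
  have h2: "add_map M A (\<lambda>m. h f m g n)" if "f \<in> carrier D" "g \<in> carrier D" "n \<in> carrier M" for f g n
    unfolding h_def
    by (rule add_map_comp[OF add_map_comp[OF add_map_comp[OF add_map_rank_one_left[OF that(2)] \<psi>]
            add_map_lact_scalar[OF bimodule that(3)]] rdualD(1)[OF that(1)]])
  have h3: "add_map D A (\<lambda>g. h f m g n)" if "f \<in> carrier D" "m \<in> carrier M" "n \<in> carrier M" for f m n
    unfolding h_def
    by (rule add_map_comp[OF add_map_comp[OF add_map_comp[OF add_map_rank_one_right[OF that(2)] \<psi>]
            add_map_lact_scalar[OF bimodule that(3)]] rdualD(1)[OF that(1)]])
  have h4: "add_map M A (h f m g)" if "f \<in> carrier D" "m \<in> carrier M" "g \<in> carrier D" for f m g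
    unfolding h_def
    by (rule add_map_comp[OF add_map_lact[OF bimodule \<psi>r[OF that(2,3)]] rdualD(1)[OF that(1)]])
  obtain \<gamma> where \<gamma>: "add_map C.CC.TP A \<gamma>"
    and \<gamma>_lact: "\<And>a X. a \<in> carrier A \<Longrightarrow> X \<in> carrier C.CC.TP \<Longrightarrow> \<gamma> (lact C.CC.TP a X) = a \<otimes>\<^bsub>A\<^esub> \<gamma> X"
    and \<gamma>_ract: "\<And>a X. a \<in> carrier A \<Longrightarrow> X \<in> carrier C.CC.TP \<Longrightarrow> \<gamma> (ract C.CC.TP X a) = \<gamma> X \<otimes>\<^bsub>A\<^esub> a"
    and \<gamma>_pure: "\<And>f m g n. f \<in> carrier D \<Longrightarrow> m \<in> carrier M \<Longrightarrow> g \<in> carrier D \<Longrightarrow> n \<in> carrier M \<Longrightarrow>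
      \<gamma> (C.CC.pure (C.pure f m) (C.pure g n)) = h f m g n"
  proof (rule C.balanced_extension[of h])
    fix g n assume gn: "g \<in> carrier D" "n \<in> carrier M"
    show "balanced B D M A (\<lambda>f m. h f m g n)"
      by (rule balancedI[OF h2 h1])
        (use gn in \<open>simp_all add: h_def rdual_app rank_one_lact_base \<psi>_lact rank_one_closed \<psi>r M_rules\<close>)
  next
    fix f m assume fm: "f \<in> carrier D" "m \<in> carrier M"
    show "balanced B D M A (h f m)"
      by (rule balancedI[OF h4 h3])
        (use fm in \<open>simp_all add: h_def rank_one_ract_base \<psi>_ract rank_one_closed \<psi>r M_rules\<close>)
  next
    fix f m a g n
    assume "f \<in> carrier D" "m \<in> carrier M" "a \<in> carrier A" "g \<in> carrier D" "n \<in> carrier M"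
    then show "h f (ract M m a) g n = h f m (lact D a g) n"
      and "h (lact D a f) m g n = a \<otimes>\<^bsub>A\<^esub> h f m g n"
      and "h f m g (ract M n a) = h f m g n \<otimes>\<^bsub>A\<^esub> a"
      by (simp_all add: h_def rank_one_ract rdual_app M_rules \<psi>r rdualD)
  qed blast
  have "cointegral A C.TP (comatrix_comult A B M I e es) (comatrix_counit A B M) \<gamma>"
  proof (rule C.cointegralI[OF \<gamma> \<gamma>_lact \<gamma>_ract add_map_comatrix_comult add_map_comatrix_counit
        comatrix_comult_pure])
    fix f m g n assume f: "f \<in> carrier D" and m: "m \<in> carrier M" and g: "g \<in> carrier D" and n: "n \<in> carrier M"
    let ?b = "\<psi> (rank_one m g)"
    let ?y = "lact M ?b n"
    note cl = f m g n \<psi>r dual_basisD(2,3) M_rules rdualD rdual_closed rank_one_closed C.tens_closed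
    have y: "?y \<in> carrier M" by (simp add: cl)
    have fb: "ract D f ?b \<in> carrier D" by (simp add: cl)
    have "finsum C.TP (\<lambda>i. ract C.TP (C.pure f (e i)) (\<gamma> (C.CC.pure (C.pure (es i) m) (C.pure g n)))) I =
        finsum C.TP (\<lambda>i. C.pure f (ract M (e i) (es i ?y))) I"
      by (rule C.TP.finsum_cong') (simp_all add: cl \<gamma>_pure h_def C.ract_tens Pi_iff)
    also have "\<dots> = C.pure f ?y"
      by (rule add_map_expand[OF C.abelian_group_tensor C.tens_add_map_right[OF f] y, symmetric])
    \<comment> \<open>The crossing point of the two sides: the left one sums to
      \<open>f \<otimes> ?b n\<close> by expanding \<open>?y\<close> in the \<open>e i\<close>, the
      right one to \<open>f ?b \<otimes> n\<close> by expanding \<open>f ?b\<close> in the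
      \<open>es i\<close>. Since \<open>?b\<close> lies in \<open>B\<close>, the two tensors
      agree.\<close>
    also have "\<dots> = C.pure (ract D f ?b) n"
      by (simp add: C.tens_balanced cl)
    also have "\<dots> = C.pure (finsum D (\<lambda>i. lact D (ract D f ?b (e i)) (es i)) I) n"
      by (simp add: rdual_expand[OF fb])
    also have "\<dots> = finsum C.TP (\<lambda>i. C.pure (lact D (ract D f ?b (e i)) (es i)) n) I"
      by (rule add_map_finsum[OF C.M.abelian_group_axioms C.abelian_group_tensor C.tens_add_map_left[OF n]])
        (simp add: cl fb Pi_iff)
    also have "\<dots> = finsum C.TP (\<lambda>i. lact C.TP (\<gamma> (C.CC.pure (C.pure f m) (C.pure g (e i)))) (C.pure (es i) n)) I"
      by (rule C.TP.finsum_cong') (simp_all add: cl \<gamma>_pure h_def C.lact_tens Pi_iff rdual_app)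
    finally show "finsum C.TP (\<lambda>i. ract C.TP (C.pure f (e i)) (\<gamma> (C.CC.pure (C.pure (es i) m) (C.pure g n)))) I =
        finsum C.TP (\<lambda>i. lact C.TP (\<gamma> (C.CC.pure (C.pure f m) (C.pure g (e i)))) (C.pure (es i) n)) I" .
  next
    fix f m assume f: "f \<in> carrier D" and m: "m \<in> carrier M"
    note cl = f m \<psi>r dual_basisD(2,3) M_rules rdualD rdual_closed rank_one_closed C.tens_closed
    \<comment> \<open>Additivity in the endomorphism lets the sum over the dual basis move inside
      \<open>\<psi>\<close>, where it becomes the identity of \<open>M\<close>.\<close>
    have F: "add_map S A (\<lambda>s. f (lact M (\<psi> s) m))"
      by (rule add_map_comp[OF add_map_comp[OF \<psi> add_map_lact_scalar[OF bimodule m]] rdualD(1)[OF f]])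
    have "finsum A (\<lambda>i. \<gamma> (C.CC.pure (C.pure f (e i)) (C.pure (es i) m))) I =
        finsum A (\<lambda>i. f (lact M (\<psi> (rank_one (e i) (es i))) m)) I"
      by (rule A.finsum_cong') (simp_all add: cl \<gamma>_pure h_def Pi_iff)
    also have "\<dots> = f (lact M (\<psi> (finsum S (\<lambda>i. rank_one (e i) (es i)) I)) m)"
      by (rule add_map_finsum[OF S.abelian_group_axioms A F, symmetric]) (simp add: cl Pi_iff)
    \<comment> \<open>The identity is inserted only to give the sum the form of
      \<open>endo_expand\<close>.\<close>
    also have "finsum S (\<lambda>i. rank_one (e i) (es i)) I = finsum S (\<lambda>i. rank_one (\<one>\<^bsub>S\<^esub> (e i)) (es i)) I"
      by (rule S.finsum_cong') (simp_all add: cl Pi_iff endo_app)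
    also have "\<dots> = \<one>\<^bsub>S\<^esub>" by (rule endo_expand[OF endo_closed(5)])
    finally show "finsum A (\<lambda>i. \<gamma> (C.CC.pure (C.pure f (e i)) (C.pure (es i) m))) I =
        comatrix_counit A B M (C.pure f m)"
      by (simp add: \<psi>_one comatrix_counit_pure cl)
  qed (simp_all add: C.tens_closed dual_basisD)
  then show ?thesis by (auto simp: coseparable_def comatrix_def)
qed

end

subsection \<open>The Sweedler coring\<close>

context dual_basis_bimodule
begin

text \<open>The scalar \<open>b\<close> crosses the outer tensor product as its image
  \<open>?b\<close> in \<open>S\<close>: on the left it is absorbed by the inserted unit as a right
  \<open>S\<close>-scalar, on the right it emerges from the inserted unit as a left one.\<close>

lemma balanced_sweedler_comult:
  "balanced B SB BS SW.CC.TP (\<lambda>s t. SW.CC.pure (SW.pure s \<one>\<^bsub>S\<^esub>) (SW.pure \<one>\<^bsub>S\<^esub> t))"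
proof (rule balancedI)
  note c = SW.tens_closed[simplified] endo_closed
  fix s assume s: "s \<in> carrier SB"
  show "add_map BS SW.CC.TP (\<lambda>t. SW.CC.pure (SW.pure s \<one>\<^bsub>S\<^esub>) (SW.pure \<one>\<^bsub>S\<^esub> t))"
    by (rule add_map_comp[OF SW.tens_add_map_right SW.CC.tens_add_map_right]) (use s in \<open>simp_all add: c\<close>)
next
  note c = SW.tens_closed[simplified] endo_closed
  fix t assume t: "t \<in> carrier BS"
  show "add_map SB SW.CC.TP (\<lambda>s. SW.CC.pure (SW.pure s \<one>\<^bsub>S\<^esub>) (SW.pure \<one>\<^bsub>S\<^esub> t))"
    by (rule add_map_comp[OF SW.tens_add_map_left SW.CC.tens_add_map_left]) (use t in \<open>simp_all add: c\<close>)
next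
  note c = SW.tens_closed[simplified] endo_closed
  fix s b t assume s: "s \<in> carrier SB" and b: "b \<in> carrier B" and t: "t \<in> carrier BS"
  let ?b = "lact BS b \<one>\<^bsub>S\<^esub>"
  have bS: "?b \<in> carrier S" by (rule endo_closed(7)[OF b endo_closed(5)])
  have 1: "ract SB \<one>\<^bsub>S\<^esub> b = ?b"
    using b bS by (intro endo_ext endo_closed) (simp_all add: endo_app M_rules)
  have 2: "SW.pure (ract SB s b) \<one>\<^bsub>S\<^esub> = ract SW.TP (SW.pure s \<one>\<^bsub>S\<^esub>) ?b"
    using s b bS by (simp add: SW.tens_balanced SW.ract_tens endo_closed)
  have 3: "SW.pure \<one>\<^bsub>S\<^esub> (lact BS b t) = lact SW.TP ?b (SW.pure \<one>\<^bsub>S\<^esub> t)"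
    using t b bS by (simp add: SW.lact_tens endo_closed 1 flip: SW.tens_balanced)
  show "SW.CC.pure (SW.pure (ract SB s b) \<one>\<^bsub>S\<^esub>) (SW.pure \<one>\<^bsub>S\<^esub> t) =
      SW.CC.pure (SW.pure s \<one>\<^bsub>S\<^esub>) (SW.pure \<one>\<^bsub>S\<^esub> (lact BS b t))"
    unfolding 2 3 by (rule SW.CC.tens_balanced) (use s t bS in \<open>simp_all add: c\<close>)
qed

lemma sweedler_comult_eq:
  "sweedler_comult A B M = lift SW.CC.TP (\<lambda>s t. SW.CC.pure (SW.pure s \<one>\<^bsub>S\<^esub>) (SW.pure \<one>\<^bsub>S\<^esub> t))"
  by (simp add: sweedler_comult_def sweedler_def fun_eq_iff)

lemma add_map_sweedler_comult: "add_map SW.TP SW.CC.TP (sweedler_comult A B M)"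
  unfolding sweedler_comult_eq
  by (rule SW.lift_add_map[OF SW.CC.abelian_group_tensor balanced_sweedler_comult])

lemma sweedler_comult_pure:
  "s \<in> carrier S \<Longrightarrow> t \<in> carrier S \<Longrightarrow>
    sweedler_comult A B M (SW.pure s t) = SW.CC.pure (SW.pure s \<one>\<^bsub>S\<^esub>) (SW.pure \<one>\<^bsub>S\<^esub> t)"
  unfolding sweedler_comult_eq
  by (rule SW.lift_tens[OF SW.CC.abelian_group_tensor balanced_sweedler_comult]) simp_all

lemma balanced_sweedler_counit: "balanced B SB BS S (\<lambda>s t. s \<otimes>\<^bsub>S\<^esub> t)"
proof (rule balancedI)
  fix s b t assume "s \<in> carrier SB" "b \<in> carrier B" "t \<in> carrier BS"
  then show "ract SB s b \<otimes>\<^bsub>S\<^esub> t = s \<otimes>\<^bsub>S\<^esub> lact BS b t"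
    by (auto intro!: endo_ext endo_closed simp: endo_app endoD)
qed (auto intro!: add_mapI simp: S.r_distr S.l_distr)

lemma add_map_sweedler_counit: "add_map SW.TP S (sweedler_counit A B M)"
  using SW.lift_add_map[OF S.abelian_group_axioms balanced_sweedler_counit]
  by (simp add: sweedler_counit_def[abs_def])

lemma sweedler_counit_pure:
  "s \<in> carrier S \<Longrightarrow> t \<in> carrier S \<Longrightarrow> sweedler_counit A B M (SW.pure s t) = s \<otimes>\<^bsub>S\<^esub> t"
  using SW.lift_tens[OF S.abelian_group_axioms balanced_sweedler_counit]
  by (simp add: sweedler_counit_def)

text \<open>The proof transports \<open>\<gamma>\<close> to a form \<open>P\<close> with an
  arbitrary endomorphism in the middle, tensors it to the \<open>S\<close>-valued map
  \<open>T\<close>, and derives each axiom from its counterpart for \<open>\<gamma>\<close>.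
  Centrality of the dual basis supplies the linearity that the explicit sums hide.\<close>

theorem sweedler_coseparable:
  assumes "coseparable A (comatrix A B M) (comatrix_comult A B M I e es) (comatrix_counit A B M)"
  shows "coseparable S (sweedler A B M) (sweedler_comult A B M) (sweedler_counit A B M)"
proof -
  obtain \<gamma> where cointegral: "cointegral A C.TP (comatrix_comult A B M I e es) (comatrix_counit A B M) \<gamma>"
    using assms by (auto simp: coseparable_def comatrix_def)
  then have \<gamma>: "add_map C.CC.TP A \<gamma>"
    and \<gamma>_lact: "\<forall>a\<in>carrier A. \<forall>X\<in>carrier C.CC.TP. \<gamma> (lact C.CC.TP a X) = a \<otimes>\<^bsub>A\<^esub> \<gamma> X"
    and \<gamma>_ract: "\<forall>a\<in>carrier A. \<forall>X\<in>carrier C.CC.TP. \<gamma> (ract C.CC.TP X a) = \<gamma> X \<otimes>\<^bsub>A\<^esub> a"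
    and \<gamma>_colinear: "\<And>c d. c \<in> carrier C.TP \<Longrightarrow> d \<in> carrier C.TP \<Longrightarrow>
      lift C.TP (\<lambda>x y. ract C.TP x (\<gamma> (C.CC.pure y d))) (comatrix_comult A B M I e es c) =
      lift C.TP (\<lambda>x y. lact C.TP (\<gamma> (C.CC.pure c x)) y) (comatrix_comult A B M I e es d)"
    and \<gamma>_counit: "\<And>c. c \<in> carrier C.TP \<Longrightarrow> \<gamma> (comatrix_comult A B M I e es c) = comatrix_counit A B M c"
    by (auto simp: cointegral_def Let_def add_map_def)
  note A = A.abelian_group_axioms and Mg = M.abelian_group_axioms
    and Dg = C.M.abelian_group_axioms and Sg = S.abelian_group_axioms
  note p_left = C.add_map_pure_left[OF \<gamma> \<gamma>_lact \<gamma>_ract] and p_right = C.add_map_pure_right[OF \<gamma> \<gamma>_lact \<gamma>_ract]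
    and p_lact = C.pure_lact[OF \<gamma> \<gamma>_lact \<gamma>_ract] and p_ract = C.pure_ract[OF \<gamma> \<gamma>_lact \<gamma>_ract]
  define G where "G f m g n = \<gamma> (C.CC.pure (C.pure f m) (C.pure g n))" for f m g n
  have G1: "add_map D A (\<lambda>f. G f m g n)" if "m \<in> carrier M" "g \<in> carrier D" "n \<in> carrier M" for m g n
    unfolding G_def by (rule add_map_comp[OF C.tens_add_map_left[OF that(1)] p_left[OF C.tens_closed[OF that(2,3)]]])
  have G2: "add_map M A (\<lambda>m. G f m g n)" if "f \<in> carrier D" "g \<in> carrier D" "n \<in> carrier M" for f g n
    unfolding G_def by (rule add_map_comp[OF C.tens_add_map_right[OF that(1)] p_left[OF C.tens_closed[OF that(2,3)]]])
  have G3: "add_map D A (\<lambda>g. G f m g n)" if "f \<in> carrier D" "m \<in> carrier M" "n \<in> carrier M" for f m n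
    unfolding G_def by (rule add_map_comp[OF C.tens_add_map_left[OF that(3)] p_right[OF C.tens_closed[OF that(1,2)]]])
  have G4: "add_map M A (G f m g)" if "f \<in> carrier D" "m \<in> carrier M" "g \<in> carrier D" for f m g
    unfolding G_def by (rule add_map_comp[OF C.tens_add_map_right[OF that(3)] p_right[OF C.tens_closed[OF that(1,2)]]])
  have Gc: "G f m g n \<in> carrier A"
    if "f \<in> carrier D" "m \<in> carrier M" "g \<in> carrier D" "n \<in> carrier M" for f m g n
    by (rule add_map_closed[OF G1[OF that(2-4)] that(1)])
  have G_base: "G (ract D f b) m g n = G f (lact M b m) g n"
      "G f m (ract D g b) n = G f m g (lact M b n)"
    if "f \<in> carrier D" "m \<in> carrier M" "g \<in> carrier D" "n \<in> carrier M" "b \<in> carrier B"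
    for f m g n b
    using that by (simp_all add: G_def C.tens_balanced)
  have G_alg: "G f (ract M m a) g n = G f m (lact D a g) n"
      "G (lact D a f) m g n = a \<otimes>\<^bsub>A\<^esub> G f m g n"
      "G f m g (ract M n a) = G f m g n \<otimes>\<^bsub>A\<^esub> a"
    if "f \<in> carrier D" "m \<in> carrier M" "g \<in> carrier D" "n \<in> carrier M" "a \<in> carrier A"
    for f m g n a
    using that p_lact[of a "C.pure f m" "C.pure g n"] p_ract[of a "C.pure f m" "C.pure g n"]
      C.CC.tens_balanced[of "C.pure f m" a "C.pure g n"]
    by (simp_all add: G_def C.tens_closed C.lact_tens C.ract_tens)
  note G_rules = G_base G_alg

  \<comment> \<open>The form that \<open>\<gamma>\<close> induces on
    \<open>M* \<otimes>\<^sub>B S \<otimes>\<^sub>B M\<close>: the middle endomorphism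
    \<open>w\<close> is replaced by the sum of the \<open>w (e j) \<otimes> es j\<close>.\<close>
  define P where "P f w n = finsum A (\<lambda>j. G f (w (e j)) (es j) n) I" for f w n
  note cl = dual_basisD(2,3) endoD rdualD
  have P1: "add_map D A (\<lambda>f. P f w n)" if "w \<in> carrier S" "n \<in> carrier M" for w n
    unfolding P_def by (rule add_map_finsum_fun[OF A G1]) (use that in \<open>simp_all add: cl\<close>)
  have P2: "add_map S A (\<lambda>w. P f w n)" if "f \<in> carrier D" "n \<in> carrier M" for f n
    unfolding P_def
    by (rule add_map_finsum_fun[OF A add_map_comp[OF add_map_endo_eval G2]])
      (use that in \<open>simp_all add: cl\<close>)
  have P3: "add_map M A (P f w)" if "f \<in> carrier D" "w \<in> carrier S" for f w
    unfolding P_def by (rule add_map_finsum_fun[OF A G4]) (use that in \<open>simp_all add: cl\<close>)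
  have Pc: "P f w n \<in> carrier A" if "f \<in> carrier D" "w \<in> carrier S" "n \<in> carrier M" for f w n
    by (rule add_map_closed[OF P3[OF that(1,2)] that(3)])
  have P_lact: "P (lact D a f) w n = a \<otimes>\<^bsub>A\<^esub> P f w n"
    if a: "a \<in> carrier A" and "f \<in> carrier D" "w \<in> carrier S" "n \<in> carrier M" for a f w n
  proof -
    have "P (lact D a f) w n = finsum A (\<lambda>j. a \<otimes>\<^bsub>A\<^esub> G f (w (e j)) (es j) n) I"
      unfolding P_def by (rule A.finsum_cong') (use that in \<open>simp_all add: cl Pi_iff Gc G_rules\<close>)
    also have "\<dots> = a \<otimes>\<^bsub>A\<^esub> P f w n"
      unfolding P_def
      by (rule add_map_finsum[OF A A add_map_mult_left[OF A.ring_axioms a], symmetric])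
        (use that in \<open>simp add: cl Pi_iff Gc\<close>)
    finally show ?thesis .
  qed
  have P_ract: "P f w (ract M n a) = P f w n \<otimes>\<^bsub>A\<^esub> a"
    if a: "a \<in> carrier A" and "f \<in> carrier D" "w \<in> carrier S" "n \<in> carrier M" for a f w n
  proof -
    have "P f w (ract M n a) = finsum A (\<lambda>j. G f (w (e j)) (es j) n \<otimes>\<^bsub>A\<^esub> a) I"
      unfolding P_def by (rule A.finsum_cong') (use that in \<open>simp_all add: cl Pi_iff Gc G_rules\<close>)
    also have "\<dots> = P f w n \<otimes>\<^bsub>A\<^esub> a"
      unfolding P_def
      by (rule add_map_finsum[OF A A add_map_mult_right[OF A.ring_axioms a], symmetric])
        (use that in \<open>simp add: cl Pi_iff Gc\<close>)
    finally show ?thesis .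
  qed
  have P_base_left: "P (ract D f b) w n = P f (lact BS b w) n"
    if "b \<in> carrier B" "f \<in> carrier D" "w \<in> carrier S" "n \<in> carrier M" for b f w n
    unfolding P_def
    by (rule A.finsum_cong') (use that in \<open>simp_all add: cl Pi_iff Gc G_rules endo_app M_rules\<close>)
  \<comment> \<open>Unlike on the left side, \<open>b\<close> now acts inside \<open>w\<close>, on
    the \<open>e j\<close>; centrality brings it to \<open>es j\<close>, next to
    \<open>n\<close>.\<close>
  have P_base_right: "P f (ract SB w b) n = P f w (lact M b n)"
    if b: "b \<in> carrier B" and f: "f \<in> carrier D" and w: "w \<in> carrier S" and n: "n \<in> carrier M" for b f w n
  proof -
    have K: "balanced A M D A (\<lambda>m g. G f (w m) g n)"
    proof (rule balancedI)
      fix g assume "g \<in> carrier D"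
      then show "add_map M A (\<lambda>m. G f (w m) g n)"
        by (intro add_map_comp[OF endoD(1)[OF w] G2] f n)
    qed (simp_all add: G3 G_rules f w n cl)
    have "P f (ract SB w b) n = finsum A (\<lambda>j. G f (w (lact M b (e j))) (es j) n) I"
      unfolding P_def by (rule A.finsum_cong') (use that in \<open>simp_all add: cl Pi_iff Gc endo_app M_rules\<close>)
    also have "\<dots> = finsum A (\<lambda>j. G f (w (e j)) (ract D (es j) b) n) I"
      by (rule dual_basis_central_base[OF A K b])
    also have "\<dots> = P f w (lact M b n)"
      unfolding P_def by (rule A.finsum_cong') (use that in \<open>simp_all add: cl Pi_iff Gc G_rules M_rules\<close>)
    finally show ?thesis .
  qed
  \<comment> \<open>The coproduct inserts exactly the dual basis that represents the middle factor
    1, so this is the counit condition on \<open>\<gamma>\<close>.\<close>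
  have P_one: "P f \<one>\<^bsub>S\<^esub> n = f n" if f: "f \<in> carrier D" and n: "n \<in> carrier M" for f n
  proof -
    have "f n = \<gamma> (finsum C.CC.TP (\<lambda>i. C.CC.pure (C.pure f (e i)) (C.pure (es i) n)) I)"
      using \<gamma>_counit[of "C.pure f n"] f n
      by (simp add: C.tens_closed comatrix_counit_pure comatrix_comult_pure)
    also have "\<dots> = finsum A (\<lambda>i. \<gamma> (C.CC.pure (C.pure f (e i)) (C.pure (es i) n))) I"
      by (rule add_map_finsum[OF C.CC.abelian_group_tensor A \<gamma>])
        (use f n in \<open>simp add: Pi_iff C.tens_closed C.CC.tens_closed cl\<close>)
    also have "\<dots> = P f \<one>\<^bsub>S\<^esub> n"
      unfolding P_def G_def[symmetric]
      by (rule A.finsum_cong') (use f n in \<open>simp_all add: cl Pi_iff Gc endo_app\<close>)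
    finally show ?thesis by simp
  qed

  \<comment> \<open>\<open>P\<close> tensored with \<open>M\<close> and \<open>M*\<close>: the first
    argument enters as the sum of the \<open>e i \<otimes> dual_comp (es i) s\<close>, and
    \<open>v\<close> is kept whole because \<open>P\<close> is evaluated at
    \<open>v x\<close>.\<close>
  define T where "T s w v = (\<lambda>x\<in>carrier M. finsum M (\<lambda>i. ract M (e i) (P (dual_comp (es i) s) w (v x))) I)" for s w v
  note cl = cl dual_comp_closed Pc M_rules
  have T_app: "T s w v x = finsum M (\<lambda>i. ract M (e i) (P (dual_comp (es i) s) w (v x))) I"
    if "x \<in> carrier M" for s w v x
    using that by (simp add: T_def)
  have Tc: "T s w v \<in> carrier S" if s: "s \<in> carrier S" and w: "w \<in> carrier S" and v: "v \<in> carrier S" for s w v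
  proof -
    have "add_map M M (\<lambda>x. finsum M (\<lambda>i. ract M (e i) (P (dual_comp (es i) s) w (v x))) I)"
      by (rule add_map_finsum_fun[OF Mg
            add_map_comp[OF add_map_comp[OF endoD(1)[OF v] P3] add_map_ract_scalar[OF bimodule]]])
        (use s w in \<open>simp_all add: cl\<close>)
    moreover have "finsum M (\<lambda>i. ract M (e i) (P (dual_comp (es i) s) w (v (ract M x a)))) I =
        ract M (finsum M (\<lambda>i. ract M (e i) (P (dual_comp (es i) s) w (v x))) I) a"
      if x: "x \<in> carrier M" and a: "a \<in> carrier A" for x a
    proof -
      have "finsum M (\<lambda>i. ract M (e i) (P (dual_comp (es i) s) w (v (ract M x a)))) I =
          finsum M (\<lambda>i. ract M (ract M (e i) (P (dual_comp (es i) s) w (v x))) a) I"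
        by (rule M.finsum_cong') (use s w v x a in \<open>simp_all add: cl Pi_iff P_ract\<close>)
      also have "\<dots> = ract M (finsum M (\<lambda>i. ract M (e i) (P (dual_comp (es i) s) w (v x))) I) a"
        by (rule add_map_finsum[OF Mg Mg add_map_ract[OF bimodule a], symmetric])
          (use s w v x in \<open>simp add: cl Pi_iff\<close>)
      finally show ?thesis .
    qed
    ultimately show ?thesis by (simp add: T_def endo_iff add_map_restrict M_rules)
  qed
  have T1: "add_map S S (\<lambda>s. T s w v)" if w: "w \<in> carrier S" and v: "v \<in> carrier S" for w v
  proof (rule add_mapI)
    fix s t assume s: "s \<in> carrier S" "t \<in> carrier S"
    show "T s w v \<in> carrier S" by (rule Tc[OF s(1) w v])
    show "T (s \<oplus>\<^bsub>S\<^esub> t) w v = T s w v \<oplus>\<^bsub>S\<^esub> T t w v"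
    proof (rule endo_ext)
      fix x assume x: "x \<in> carrier M"
      have "add_map S M (\<lambda>s. finsum M (\<lambda>i. ract M (e i) (P (dual_comp (es i) s) w (v x))) I)"
        by (rule add_map_finsum_fun[OF Mg
              add_map_comp[OF add_map_comp[OF add_map_dual_comp_right P1] add_map_ract_scalar[OF bimodule]]])
          (use w v x in \<open>simp_all add: cl\<close>)
      from add_map_add[OF this s] show "T (s \<oplus>\<^bsub>S\<^esub> t) w v x = (T s w v \<oplus>\<^bsub>S\<^esub> T t w v) x"
        using x by (simp add: T_app endo_app)
    qed (use s w v in \<open>simp_all add: Tc\<close>)
  qed
  have T2: "add_map S S (\<lambda>w. T s w v)" if s: "s \<in> carrier S" and v: "v \<in> carrier S" for s v
  proof (rule add_mapI)
    fix w u assume w: "w \<in> carrier S" "u \<in> carrier S"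
    show "T s w v \<in> carrier S" by (rule Tc[OF s w(1) v])
    show "T s (w \<oplus>\<^bsub>S\<^esub> u) v = T s w v \<oplus>\<^bsub>S\<^esub> T s u v"
    proof (rule endo_ext)
      fix x assume x: "x \<in> carrier M"
      have "add_map S M (\<lambda>w. finsum M (\<lambda>i. ract M (e i) (P (dual_comp (es i) s) w (v x))) I)"
        by (rule add_map_finsum_fun[OF Mg add_map_comp[OF P2 add_map_ract_scalar[OF bimodule]]])
          (use s v x in \<open>simp_all add: cl\<close>)
      from add_map_add[OF this w] show "T s (w \<oplus>\<^bsub>S\<^esub> u) v x = (T s w v \<oplus>\<^bsub>S\<^esub> T s u v) x"
        using x by (simp add: T_app endo_app)
    qed (use s w v in \<open>simp_all add: Tc\<close>)
  qed
  have T3: "add_map S S (T s w)" if s: "s \<in> carrier S" and w: "w \<in> carrier S" for s w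
  proof (rule add_mapI)
    fix v u assume v: "v \<in> carrier S" "u \<in> carrier S"
    show "T s w v \<in> carrier S" by (rule Tc[OF s w v(1)])
    show "T s w (v \<oplus>\<^bsub>S\<^esub> u) = T s w v \<oplus>\<^bsub>S\<^esub> T s w u"
    proof (rule endo_ext)
      fix x assume x: "x \<in> carrier M"
      have "add_map M M (\<lambda>y. finsum M (\<lambda>i. ract M (e i) (P (dual_comp (es i) s) w y)) I)"
        by (rule add_map_finsum_fun[OF Mg add_map_comp[OF P3 add_map_ract_scalar[OF bimodule]]])
          (use s w in \<open>simp_all add: cl\<close>)
      from add_map_add[OF this endoD(2)[OF v(1) x] endoD(2)[OF v(2) x]]
      show "T s w (v \<oplus>\<^bsub>S\<^esub> u) x = (T s w v \<oplus>\<^bsub>S\<^esub> T s w u) x"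
        using x by (simp add: T_app endo_app)
    qed (use s w v in \<open>simp_all add: Tc\<close>)
  qed
  have T_base_left: "T (ract SB s b) w v = T s (lact BS b w) v"
    if "b \<in> carrier B" "s \<in> carrier S" "w \<in> carrier S" "v \<in> carrier S" for b s w v
  proof (rule endo_ext)
    fix x assume x: "x \<in> carrier M"
    show "T (ract SB s b) w v x = T s (lact BS b w) v x"
      unfolding T_app[OF x]
      by (rule M.finsum_cong') (use that x in \<open>simp_all add: cl Pi_iff dual_comp_ract P_base_left endo_closed\<close>)
  qed (use that in \<open>simp_all add: Tc endo_closed\<close>)
  have T_base_right: "T s (ract SB w b) v = T s w (lact BS b v)"
    if "b \<in> carrier B" "s \<in> carrier S" "w \<in> carrier S" "v \<in> carrier S" for b s w v
  proof (rule endo_ext)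
    fix x assume x: "x \<in> carrier M"
    show "T s (ract SB w b) v x = T s w (lact BS b v) x"
      unfolding T_app[OF x]
      by (rule M.finsum_cong') (use that x in \<open>simp_all add: cl Pi_iff P_base_right endo_app\<close>)
  qed (use that in \<open>simp_all add: Tc endo_closed\<close>)
  have T_ract: "T s w (v \<otimes>\<^bsub>S\<^esub> r) = T s w v \<otimes>\<^bsub>S\<^esub> r"
    if "r \<in> carrier S" "s \<in> carrier S" "w \<in> carrier S" "v \<in> carrier S" for r s w v
    by (rule endo_ext) (use that in \<open>simp_all add: Tc endo_closed T_app endo_app endoD\<close>)
  \<comment> \<open>In the definition of \<open>T\<close> a left factor \<open>r\<close> is composed
    into the functionals \<open>es i\<close>; centrality turns it into \<open>r (e i)\<close>, from
    where it comes out of the sum.\<close>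
  have T_lact: "T (r \<otimes>\<^bsub>S\<^esub> s) w v = r \<otimes>\<^bsub>S\<^esub> T s w v"
    if r: "r \<in> carrier S" and s: "s \<in> carrier S" and w: "w \<in> carrier S" and v: "v \<in> carrier S" for r s w v
  proof (rule endo_ext)
    fix x assume x: "x \<in> carrier M"
    define K where "K m g = ract M m (P (dual_comp g s) w (v x))" for m g
    have K: "balanced A M D M K"
      unfolding K_def
    proof (rule balancedI)
      fix m assume m: "m \<in> carrier M"
      show "add_map D M (\<lambda>g. ract M m (P (dual_comp g s) w (v x)))"
        by (rule add_map_comp[OF add_map_comp[OF add_map_dual_comp_left[OF s] P1]
              add_map_ract_scalar[OF bimodule m]]) (use w v x in \<open>simp_all add: cl\<close>)
    next
      fix g assume "g \<in> carrier D"
      then show "add_map M M (\<lambda>m. ract M m (P (dual_comp g s) w (v x)))"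
        by (intro add_map_ract[OF bimodule]) (use s w v x in \<open>simp_all add: cl\<close>)
    qed (use s w v x in \<open>simp_all add: cl dual_comp_lact P_lact\<close>)
    have "T (r \<otimes>\<^bsub>S\<^esub> s) w v x = finsum M (\<lambda>i. K (e i) (dual_comp (es i) r)) I"
      unfolding T_app[OF x] K_def
      by (rule M.finsum_cong') (use r s w v x in \<open>simp_all add: cl Pi_iff dual_comp_mult\<close>)
    also have "\<dots> = finsum M (\<lambda>i. K (r (e i)) (es i)) I"
      by (rule dual_basis_central[OF Mg K r, symmetric])
    also have "\<dots> = finsum M (\<lambda>i. r (ract M (e i) (P (dual_comp (es i) s) w (v x)))) I"
      unfolding K_def
      by (rule M.finsum_cong') (use r s w v x in \<open>simp_all add: cl Pi_iff\<close>)
    also have "\<dots> = r (T s w v x)"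
      unfolding T_app[OF x]
      by (rule add_map_finsum[OF Mg Mg endoD(1)[OF r], symmetric]) (use s w v x in \<open>simp add: cl Pi_iff\<close>)
    finally show "T (r \<otimes>\<^bsub>S\<^esub> s) w v x = (r \<otimes>\<^bsub>S\<^esub> T s w v) x" by (simp add: endo_app x)
  qed (use that in \<open>simp_all add: Tc endo_closed\<close>)

  \<comment> \<open>The two inner factors enter \<open>T\<close> only through their product in
    \<open>S\<close>, so balancing over \<open>S\<close> in the middle is associativity.\<close>
  obtain \<Gamma> where \<Gamma>: "add_map SW.CC.TP S \<Gamma>"
    and \<Gamma>_lact: "\<And>r X. r \<in> carrier S \<Longrightarrow> X \<in> carrier SW.CC.TP \<Longrightarrow> \<Gamma> (lact SW.CC.TP r X) = r \<otimes>\<^bsub>S\<^esub> \<Gamma> X"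
    and \<Gamma>_ract: "\<And>r X. r \<in> carrier S \<Longrightarrow> X \<in> carrier SW.CC.TP \<Longrightarrow> \<Gamma> (ract SW.CC.TP X r) = \<Gamma> X \<otimes>\<^bsub>S\<^esub> r"
    and \<Gamma>_pure: "\<And>s t u v. s \<in> carrier SB \<Longrightarrow> t \<in> carrier BS \<Longrightarrow> u \<in> carrier SB \<Longrightarrow> v \<in> carrier BS \<Longrightarrow>
      \<Gamma> (SW.CC.pure (SW.pure s t) (SW.pure u v)) = T s (t \<otimes>\<^bsub>S\<^esub> u) v"
  proof (rule SW.balanced_extension[of "\<lambda>s t u v. T s (t \<otimes>\<^bsub>S\<^esub> u) v"])
    have add: "add_map SB S = add_map S S" "add_map BS S = add_map S S"
      by (simp_all add: add_map_def fun_eq_iff)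
    have base: "lact BS b s \<otimes>\<^bsub>S\<^esub> t = lact BS b (s \<otimes>\<^bsub>S\<^esub> t)" "s \<otimes>\<^bsub>S\<^esub> ract SB t b = ract SB (s \<otimes>\<^bsub>S\<^esub> t) b"
      if "b \<in> carrier B" "s \<in> carrier S" "t \<in> carrier S" for b s t
      using that by (auto intro!: endo_ext endo_closed simp: endo_app endoD M_rules)
    {
      fix u v assume u: "u \<in> carrier SB" and v: "v \<in> carrier BS"
      show "balanced B SB BS S (\<lambda>s t. T s (t \<otimes>\<^bsub>S\<^esub> u) v)"
      proof (rule balancedI)
        fix s assume "s \<in> carrier SB"
        then show "add_map BS S (\<lambda>t. T s (t \<otimes>\<^bsub>S\<^esub> u) v)"
          unfolding add by (intro add_map_comp[OF add_map_mult_right[OF S.ring_axioms] T2]) (use u v in simp_all)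
      qed (use u v in \<open>simp_all add: add T1 T_base_left base\<close>)
    next
      fix s t assume s: "s \<in> carrier SB" and t: "t \<in> carrier BS"
      show "balanced B SB BS S (\<lambda>u v. T s (t \<otimes>\<^bsub>S\<^esub> u) v)"
      proof (rule balancedI)
        fix v assume "v \<in> carrier BS"
        then show "add_map SB S (\<lambda>u. T s (t \<otimes>\<^bsub>S\<^esub> u) v)"
          unfolding add by (intro add_map_comp[OF add_map_mult_left[OF S.ring_axioms] T2]) (use s t in simp_all)
      qed (use s t in \<open>simp_all add: add T3 T_base_right base\<close>)
    next
      fix s t r u v
      assume "s \<in> carrier SB" "t \<in> carrier BS" "r \<in> carrier S" "u \<in> carrier SB" "v \<in> carrier BS"
      then show "T s (ract BS t r \<otimes>\<^bsub>S\<^esub> u) v = T s (t \<otimes>\<^bsub>S\<^esub> lact SB r u) v"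
        and "T (lact SB r s) (t \<otimes>\<^bsub>S\<^esub> u) v = r \<otimes>\<^bsub>S\<^esub> T s (t \<otimes>\<^bsub>S\<^esub> u) v"
        and "T s (t \<otimes>\<^bsub>S\<^esub> u) (ract BS v r) = T s (t \<otimes>\<^bsub>S\<^esub> u) v \<otimes>\<^bsub>S\<^esub> r"
        by (simp_all add: S.m_assoc T_lact T_ract)
    }
  qed blast

  \<comment> \<open>\<open>P f w\<close> as an element of \<open>M*\<close>: the endomorphism acts
    on the dual side, while \<open>T\<close> with outer units acts on the module side.\<close>
  define Q where "Q f w = (\<lambda>x\<in>carrier M. P f w x)" for f w
  have Qc: "Q f w \<in> carrier D" if "f \<in> carrier D" "w \<in> carrier S" for f w
    using that P3[OF that] by (simp add: Q_def rdual_iff add_map_restrict M_rules P_ract)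
  have colinear: "C.pure f (T \<one>\<^bsub>S\<^esub> w \<one>\<^bsub>S\<^esub> n) = C.pure (Q f w) n"
    if f: "f \<in> carrier D" and w: "w \<in> carrier S" and n: "n \<in> carrier M" for f w n
  proof -
    \<comment> \<open>For a rank one middle factor \<open>m \<otimes> g\<close>, \<open>U\<close>
      and \<open>V\<close> are the two sides of colinearity of \<open>\<gamma>\<close> at
      \<open>f \<otimes> m\<close> and \<open>g \<otimes> n\<close>, with the sums over the
      coproducts collected into \<open>M\<close> and into \<open>M*\<close>. A general
      \<open>w\<close> is then a sum of such factors.\<close>
    define U where "U m g = finsum M (\<lambda>i. ract M (e i) (G (es i) m g n)) I" for m g
    define V where "V m g = (\<lambda>x\<in>carrier M. G f m g x)" for m g
    have Uc: "U m g \<in> carrier M" if "m \<in> carrier M" "g \<in> carrier D" for m g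
      unfolding U_def by (rule M.finsum_closed) (use that n in \<open>simp add: cl Pi_iff Gc\<close>)
    have Vc: "V m g \<in> carrier D" if "m \<in> carrier M" "g \<in> carrier D" for m g
    proof -
      have "\<forall>x\<in>carrier M. \<forall>a\<in>carrier A. G f m g (ract M x a) = G f m g x \<otimes>\<^bsub>A\<^esub> a"
        using that by (simp add: G_alg f)
      then show ?thesis using G4[OF f that] by (simp add: V_def rdual_iff add_map_restrict M_rules)
    qed
    have UV: "C.pure f (U m g) = C.pure (V m g) n" if m: "m \<in> carrier M" and g: "g \<in> carrier D" for m g
    proof -
      note tc = C.tens_closed f m g n cl Gc
      have "C.pure f (U m g) = finsum C.TP (\<lambda>i. C.pure f (ract M (e i) (G (es i) m g n))) I"
        unfolding U_def
        by (rule add_map_finsum[OF Mg C.abelian_group_tensor C.tens_add_map_right[OF f]]) (simp add: tc Pi_iff)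
      also have "\<dots> = finsum C.TP (\<lambda>i. ract C.TP (C.pure f (e i)) (\<gamma> (C.CC.pure (C.pure (es i) m) (C.pure g n)))) I"
        unfolding G_def[symmetric] by (rule C.TP.finsum_cong') (simp_all add: tc C.ract_tens Pi_iff)
      also have "\<dots> = lift C.TP (\<lambda>x y. ract C.TP x (\<gamma> (C.CC.pure y (C.pure g n))))
          (comatrix_comult A B M I e es (C.pure f m))"
        unfolding comatrix_comult_pure[OF f m]
        by (rule C.lift_cointegral_left[OF \<gamma> \<gamma>_lact \<gamma>_ract, symmetric]) (simp_all add: tc Pi_iff)
      also have "\<dots> = lift C.TP (\<lambda>x y. lact C.TP (\<gamma> (C.CC.pure (C.pure f m) x)) y)
          (comatrix_comult A B M I e es (C.pure g n))"
        by (rule \<gamma>_colinear) (simp_all add: tc)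
      also have "\<dots> = finsum C.TP (\<lambda>i. lact C.TP (\<gamma> (C.CC.pure (C.pure f m) (C.pure g (e i)))) (C.pure (es i) n)) I"
        unfolding comatrix_comult_pure[OF g n]
        by (rule C.lift_cointegral_right[OF \<gamma> \<gamma>_lact \<gamma>_ract]) (simp_all add: tc Pi_iff)
      also have "\<dots> = finsum C.TP (\<lambda>i. C.pure (lact D (V m g (e i)) (es i)) n) I"
        unfolding G_def[symmetric]
        by (rule C.TP.finsum_cong') (simp_all add: tc C.lact_tens Pi_iff V_def rdual_closed)
      also have "\<dots> = C.pure (finsum D (\<lambda>i. lact D (V m g (e i)) (es i)) I) n"
        by (rule add_map_finsum[OF Dg C.abelian_group_tensor C.tens_add_map_left[OF n], symmetric])
          (simp add: tc Pi_iff rdual_closed Vc)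
      also have "\<dots> = C.pure (V m g) n" by (simp only: rdual_expand[OF Vc[OF m g]])
      finally show ?thesis .
    qed
    have "T \<one>\<^bsub>S\<^esub> w \<one>\<^bsub>S\<^esub> n = finsum M (\<lambda>i. ract M (e i) (P (es i) w n)) I"
      unfolding T_app[OF n]
      by (rule M.finsum_cong') (use w n in \<open>simp_all add: cl Pi_iff dual_comp_one endo_app\<close>)
    also have "\<dots> = finsum M (\<lambda>i. finsum M (\<lambda>j. ract M (e i) (G (es i) (w (e j)) (es j) n)) I) I"
    proof (rule M.finsum_cong')
      fix i assume i: "i \<in> I"
      show "ract M (e i) (P (es i) w n) = finsum M (\<lambda>j. ract M (e i) (G (es i) (w (e j)) (es j) n)) I"
        unfolding P_def
        by (rule add_map_finsum[OF A Mg add_map_ract_scalar[OF bimodule]])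
          (use i w n in \<open>simp_all add: cl Pi_iff Gc\<close>)
    qed (use w n in \<open>simp_all add: cl Pi_iff Gc M.finsum_closed\<close>)
    \<comment> \<open>The order of summation changes so that the outer sum runs over the expansion
      of \<open>w\<close>; \<open>UV\<close> then applies termwise.\<close>
    also have "\<dots> = finsum M (\<lambda>j. U (w (e j)) (es j)) I"
      unfolding U_def
      by (rule finsum_swap[OF Mg dual_basisD(1)]) (use w n in \<open>simp add: cl Gc\<close>)
    finally have TU: "T \<one>\<^bsub>S\<^esub> w \<one>\<^bsub>S\<^esub> n = finsum M (\<lambda>j. U (w (e j)) (es j)) I" .
    have Vs: "finsum D (\<lambda>j. V (w (e j)) (es j)) I \<in> carrier D"
      by (rule C.M.finsum_closed) (use w in \<open>simp add: cl Pi_iff Vc\<close>)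
    have QV: "finsum D (\<lambda>j. V (w (e j)) (es j)) I = Q f w"
    proof (rule rdual_ext[OF Vs Qc[OF f w]])
      fix x assume x: "x \<in> carrier M"
      have "finsum D (\<lambda>j. V (w (e j)) (es j)) I x = finsum A (\<lambda>j. V (w (e j)) (es j) x) I"
        by (rule add_map_finsum[OF Dg A add_map_rdual_eval[OF x]]) (use w in \<open>simp add: cl Pi_iff Vc\<close>)
      then show "finsum D (\<lambda>j. V (w (e j)) (es j)) I x = Q f w x"
        using x by (simp add: Q_def V_def P_def)
    qed
    have "C.pure f (T \<one>\<^bsub>S\<^esub> w \<one>\<^bsub>S\<^esub> n) = finsum C.TP (\<lambda>j. C.pure f (U (w (e j)) (es j))) I"
      unfolding TU
      by (rule add_map_finsum[OF Mg C.abelian_group_tensor C.tens_add_map_right[OF f]])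
        (use w in \<open>simp add: cl Pi_iff Uc\<close>)
    also have "\<dots> = finsum C.TP (\<lambda>j. C.pure (V (w (e j)) (es j)) n) I"
      by (rule C.TP.finsum_cong') (use w n in \<open>simp_all add: cl Pi_iff UV Vc C.tens_closed\<close>)
    also have "\<dots> = C.pure (Q f w) n"
      unfolding QV[symmetric]
      by (rule add_map_finsum[OF Dg C.abelian_group_tensor C.tens_add_map_left[OF n], symmetric])
        (use w in \<open>simp add: cl Pi_iff Vc\<close>)
    finally show ?thesis .
  qed

  note SWg = SW.abelian_group_tensor
  have SW_left: "add_map S SW.TP (\<lambda>s. SW.pure s t)" if "t \<in> carrier S" for t
    using SW.tens_add_map_left[of t] that by (simp add: add_map_def)
  have SW_right: "add_map S SW.TP (SW.pure s)" if "s \<in> carrier S" for s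
    using SW.tens_add_map_right[of s] that by (simp add: add_map_def)
  have SWc: "SW.pure s t \<in> carrier SW.TP" if "s \<in> carrier S" "t \<in> carrier S" for s t
    using that by (simp add: SW.tens_closed)
  \<comment> \<open>The identity \<open>colinear\<close> holds in
    \<open>M* \<otimes>\<^sub>B M\<close>. Placing \<open>y\<close> on its left and \<open>g\<close>
    on its right is a well-defined map to \<open>S \<otimes>\<^sub>B S\<close>, because
    \<open>rank_one\<close> is linear over \<open>B\<close> on both sides, and it carries the
    identity over.\<close>
  have transfer: "SW.pure (rank_one y f) (rank_one (T \<one>\<^bsub>S\<^esub> w \<one>\<^bsub>S\<^esub> n) g) = SW.pure (rank_one y (Q f w)) (rank_one n g)"
    if y: "y \<in> carrier M" and f: "f \<in> carrier D" and w: "w \<in> carrier S" and n: "n \<in> carrier M"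
      and g: "g \<in> carrier D" for y f w n g
  proof -
    let ?h = "\<lambda>f m. SW.pure (rank_one y f) (rank_one m g)"
    have bal: "balanced B D M SW.TP ?h"
    proof (rule balancedI)
      fix f assume f: "f \<in> carrier D"
      show "add_map M SW.TP (?h f)"
        by (rule add_map_comp[OF add_map_rank_one_left[OF g] SW_right[OF rank_one_closed[OF y f]]])
    next
      fix m assume m: "m \<in> carrier M"
      show "add_map D SW.TP (\<lambda>f. ?h f m)"
        by (rule add_map_comp[OF add_map_rank_one_right[OF y] SW_left[OF rank_one_closed[OF m g]]])
    next
      fix f b m assume "f \<in> carrier D" "b \<in> carrier B" "m \<in> carrier M"
      with y g show "?h (ract D f b) m = ?h f (lact M b m)"
        by (simp add: rank_one_ract_base rank_one_lact_base SW.tens_balanced rank_one_closed)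
    qed
    have Tn: "T \<one>\<^bsub>S\<^esub> w \<one>\<^bsub>S\<^esub> n \<in> carrier M" using w n by (simp add: endoD(2) Tc)
    have "?h f (T \<one>\<^bsub>S\<^esub> w \<one>\<^bsub>S\<^esub> n) = lift SW.TP ?h (C.pure f (T \<one>\<^bsub>S\<^esub> w \<one>\<^bsub>S\<^esub> n))"
      by (rule C.lift_tens[OF SWg bal f Tn, symmetric])
    also have "\<dots> = ?h (Q f w) n"
      unfolding colinear[OF f w n] by (rule C.lift_tens[OF SWg bal Qc[OF f w] n])
    finally show ?thesis .
  qed
  have rank_one_balanced: "balanced A M D S rank_one"
    by (rule balancedI) (simp_all add: add_map_rank_one_left add_map_rank_one_right rank_one_ract)
  \<comment> \<open>Colinearity for the Sweedler coring. By additivity it suffices to expand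
    \<open>s\<close> and \<open>t\<close> into rank one maps and apply \<open>transfer\<close> to
    each pair.\<close>
  have key: "SW.pure s (T \<one>\<^bsub>S\<^esub> w t) = SW.pure (T s w \<one>\<^bsub>S\<^esub>) t"
    if s: "s \<in> carrier S" and w: "w \<in> carrier S" and t: "t \<in> carrier S" for s w t
  proof -
    let ?T = "T \<one>\<^bsub>S\<^esub> w \<one>\<^bsub>S\<^esub>"
    have T: "?T \<in> carrier S" by (rule Tc) (use w in simp_all)
    have Tt: "?T \<otimes>\<^bsub>S\<^esub> t \<in> carrier S" using T t by simp
    note rc = rank_one_closed cl s w t T Tt Qc SWc
    have row: "SW.pure (rank_one (e l) (dual_comp (es l) s)) (?T \<otimes>\<^bsub>S\<^esub> t) =
        SW.pure (rank_one (e l) (Q (dual_comp (es l) s) w)) t" if l: "l \<in> I" for l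
    proof -
      have r1: "rank_one (e l) (dual_comp (es l) s) \<in> carrier S"
          "rank_one (e l) (Q (dual_comp (es l) s) w) \<in> carrier S" using l by (simp_all add: rc)
      have "SW.pure (rank_one (e l) (dual_comp (es l) s)) (?T \<otimes>\<^bsub>S\<^esub> t) =
          SW.pure (rank_one (e l) (dual_comp (es l) s)) (finsum S (\<lambda>k. rank_one ((?T \<otimes>\<^bsub>S\<^esub> t) (e k)) (es k)) I)"
        by (simp only: endo_expand[OF Tt])
      also have "\<dots> = finsum SW.TP (\<lambda>k. SW.pure (rank_one (e l) (dual_comp (es l) s))
          (rank_one ((?T \<otimes>\<^bsub>S\<^esub> t) (e k)) (es k))) I"
        by (rule add_map_finsum[OF Sg SWg SW_right[OF r1(1)]]) (simp add: rc Pi_iff)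
      also have "\<dots> = finsum SW.TP (\<lambda>k. SW.pure (rank_one (e l) (Q (dual_comp (es l) s) w))
          (rank_one (t (e k)) (es k))) I"
        by (rule SW.TP.finsum_cong') (use l in \<open>simp_all add: rc Pi_iff endo_app transfer\<close>)
      also have "\<dots> = SW.pure (rank_one (e l) (Q (dual_comp (es l) s) w)) (finsum S (\<lambda>k. rank_one (t (e k)) (es k)) I)"
        by (rule add_map_finsum[OF Sg SWg SW_right[OF r1(2)], symmetric]) (simp add: rc Pi_iff)
      finally show ?thesis by (simp only: endo_expand[OF t])
    qed
    \<comment> \<open>\<open>s\<close> is expanded with the \<open>e l\<close> untouched and
      \<open>s\<close> absorbed into the functionals, a form obtained from
      \<open>endo_expand\<close> by centrality. After \<open>Q\<close> has acted on those
      functionals, the sum is \<open>T s w 1\<close> by its very definition.\<close>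
    have "SW.pure s (?T \<otimes>\<^bsub>S\<^esub> t) = SW.pure (finsum S (\<lambda>l. rank_one (e l) (dual_comp (es l) s)) I) (?T \<otimes>\<^bsub>S\<^esub> t)"
      using dual_basis_central[OF Sg rank_one_balanced s] endo_expand[OF s] by simp
    also have "\<dots> = finsum SW.TP (\<lambda>l. SW.pure (rank_one (e l) (dual_comp (es l) s)) (?T \<otimes>\<^bsub>S\<^esub> t)) I"
      by (rule add_map_finsum[OF Sg SWg SW_left[OF Tt]]) (simp add: rc Pi_iff)
    also have "\<dots> = finsum SW.TP (\<lambda>l. SW.pure (rank_one (e l) (Q (dual_comp (es l) s) w)) t) I"
      by (rule SW.TP.finsum_cong') (simp_all add: row rc Pi_iff)
    also have "\<dots> = SW.pure (finsum S (\<lambda>l. rank_one (e l) (Q (dual_comp (es l) s) w)) I) t"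
      by (rule add_map_finsum[OF Sg SWg SW_left[OF t], symmetric]) (simp add: rc Pi_iff)
    also have "finsum S (\<lambda>l. rank_one (e l) (Q (dual_comp (es l) s) w)) I = T s w \<one>\<^bsub>S\<^esub>"
    proof (rule endo_ext)
      fix x assume x: "x \<in> carrier M"
      have "finsum S (\<lambda>l. rank_one (e l) (Q (dual_comp (es l) s) w)) I x =
          finsum M (\<lambda>l. rank_one (e l) (Q (dual_comp (es l) s) w) x) I"
        by (rule add_map_finsum[OF Sg Mg add_map_endo_eval[OF x]]) (simp add: rc Pi_iff)
      also have "\<dots> = T s w \<one>\<^bsub>S\<^esub> x"
        by (simp add: T_app x rank_one_app Q_def endo_app)
      finally show "finsum S (\<lambda>l. rank_one (e l) (Q (dual_comp (es l) s) w)) I x = T s w \<one>\<^bsub>S\<^esub> x" .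
    qed (simp_all add: Tc s w S.finsum_closed rc Pi_iff)
    also have "?T \<otimes>\<^bsub>S\<^esub> t = T \<one>\<^bsub>S\<^esub> w t"
      using T_ract[of t "\<one>\<^bsub>S\<^esub>" w "\<one>\<^bsub>S\<^esub>"] w t by simp
    finally show ?thesis .
  qed
  \<comment> \<open>The counit condition: with middle factor 1, \<open>P\<close> is evaluation, and
    the sum over \<open>i\<close> is the dual basis expansion of \<open>s (t x)\<close>.\<close>
  have T_unit: "T s \<one>\<^bsub>S\<^esub> t = s \<otimes>\<^bsub>S\<^esub> t" if s: "s \<in> carrier S" and t: "t \<in> carrier S" for s t
  proof (rule endo_ext)
    fix x assume x: "x \<in> carrier M"
    have "T s \<one>\<^bsub>S\<^esub> t x = finsum M (\<lambda>i. ract M (e i) (es i (s (t x)))) I"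
      unfolding T_app[OF x]
      by (rule M.finsum_cong') (use s t x in \<open>simp_all add: cl Pi_iff P_one dual_comp_app\<close>)
    also have "\<dots> = (s \<otimes>\<^bsub>S\<^esub> t) x" using s t x by (simp add: dual_basisD(4) endoD endo_app)
    finally show "T s \<one>\<^bsub>S\<^esub> t x = (s \<otimes>\<^bsub>S\<^esub> t) x" .
  qed (use s t in \<open>simp_all add: Tc\<close>)

  have single: "finsum H k {()} = k ()" if "abelian_group H" "k () \<in> carrier H"
    for H :: "('h, 'l) ring_scheme" and k
  proof -
    interpret H: abelian_group H by (rule that(1))
    show ?thesis using that(2) by (simp add: H.finsum_insert)
  qed
  have "cointegral S SW.TP (sweedler_comult A B M) (sweedler_counit A B M) \<Gamma>"
  \<comment> \<open>The Sweedler coproduct of a pure tensor is again a single pure tensor, so the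
    sum in the criterion is indexed by a one-point set.\<close>
  proof (rule SW.cointegralI[where J = "{()}"
        and a = "\<lambda>s t j. SW.pure s \<one>\<^bsub>S\<^esub>" and b = "\<lambda>s t j. SW.pure \<one>\<^bsub>S\<^esub> t",
        OF \<Gamma> \<Gamma>_lact \<Gamma>_ract add_map_sweedler_comult add_map_sweedler_counit])
    fix s t assume s: "s \<in> carrier SB" and t: "t \<in> carrier BS"
    then show "sweedler_comult A B M (SW.pure s t) =
        finsum SW.CC.TP (\<lambda>j. SW.CC.pure (SW.pure s \<one>\<^bsub>S\<^esub>) (SW.pure \<one>\<^bsub>S\<^esub> t)) {()}"
      by (simp add: single[OF SW.CC.abelian_group_tensor] SW.CC.tens_closed SWc sweedler_comult_pure)
    show "finsum S (\<lambda>j. \<Gamma> (SW.CC.pure (SW.pure s \<one>\<^bsub>S\<^esub>) (SW.pure \<one>\<^bsub>S\<^esub> t))) {()} =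
        sweedler_counit A B M (SW.pure s t)"
      using s t by (simp add: single[OF Sg] \<Gamma>_pure Tc T_unit sweedler_counit_pure)
    fix u v assume u: "u \<in> carrier SB" and v: "v \<in> carrier BS"
    show "finsum SW.TP (\<lambda>j. ract SW.TP (SW.pure s \<one>\<^bsub>S\<^esub>) (\<Gamma> (SW.CC.pure (SW.pure \<one>\<^bsub>S\<^esub> t) (SW.pure u v)))) {()} =
        finsum SW.TP (\<lambda>j. lact SW.TP (\<Gamma> (SW.CC.pure (SW.pure s t) (SW.pure u \<one>\<^bsub>S\<^esub>))) (SW.pure \<one>\<^bsub>S\<^esub> v)) {()}"
      using s t u v
      by (simp add: single[OF SWg] \<Gamma>_pure Tc SWc SW.ract_tens SW.lact_tens key)
  qed (simp_all add: SWc)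
  then show ?thesis by (auto simp: coseparable_def sweedler_def)
qed

end

theorem theorem3p5:
  fixes A :: "'a ring" and B :: "'b ring" and M :: "('b, 'a, 'm) bimod"
    and I :: "'i set" and e :: "'i \<Rightarrow> 'm" and es :: "'i \<Rightarrow> 'm \<Rightarrow> 'a"
  assumes "ring A" and "ring B" and "bimodule B A M"
    and "fg_projective_right A M"
    and "dual_basis A M I e es"
  shows "(separable_bimodule A B M \<longrightarrow>
            coseparable A (comatrix A B M) (comatrix_comult A B M I e es) (comatrix_counit A B M))
       \<and> (coseparable A (comatrix A B M) (comatrix_comult A B M I e es) (comatrix_counit A B M) \<longrightarrow>
            coseparable (endo_ring A M) (sweedler A B M) (sweedler_comult A B M) (sweedler_counit A B M))"
proof -
  interpret dual_basis_bimodule A B M I e es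
    by unfold_locales (rule assms)+
  show ?thesis using comatrix_coseparable sweedler_coseparable by blast
qed

end
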